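(* Let $(X,d,\sigma)$ be a compatible metric-topological space with $(X,d)$ complete, let $\phi:X\to(-\infty,\infty]$ be proper and satisfy the LSCC assumptions with coercivity constant $\mathsf B$, and let $\varepsilon>0$ with $\frac1{16\varepsilon}>\mathsf B$. Then: (1) for all $(x_n)_n\subset X$ and $x\in X$, $d_\phi(x_n,x)\to0$ as $n\to\infty$ implies $\lim_{n\to\infty}V_\varepsilon(x_n)=V_\varepsilon(x)$; (2) for every curve $u\in AC([a,b];(X,d_\phi))$ the map $t\mapsto V_\varepsilon(u(t))$ is absolutely continuous, and $$\Big|\frac{d}{dt}V_\varepsilon(u(t))\Big|\le G_\varepsilon(u(t))\,|u'|(t)\qquad\text{for a.e. }t\in(a,b),$$ where $|u'|$ is the metric derivative of $u$ with respect to $d$.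
   Context: **Setting.** $(X,d)$ is a complete metric space and $\sigma$ is a Hausdorff topology on $X$; $(X,d,\sigma)$ is called compatible if (MT1) $u_n\to u$ and $v_n\to v$ in $\sigma$ imply $\liminf_n d(u_n,v_n)\ge d(u,v)$; (MT2) for every $\sigma$-open set $U$ and $x\in U$ there exist a $\sigma$-open neighborhood $V$ of $x$ and $\delta>0$ such that $d(y,V)<\delta$ implies $y\in U$, where $d(y,V)=\inf_{v\in V}d(y,v)$. For an interval $I\subset\mathbb R$ and $p\in[1,\infty]$, $AC^p(I;X)=AC^p(I;(X,d))$ is the set of curves $u:I\to X$ for which there is $m\in L^p(I)$ with $d(u(s),u(t))\le\int_s^t m(r)\,dr$ for all $s\le t$ in $I$; $AC=AC^1$; $AC^p_{\rm loc}(I;X)$ is the set of curves belonging to $AC^p(J;X)$ for every compact interval $J\subset I$; the same definition is used for other (extended) distances. The metric derivative $|u'|(t)=\lim_{s\to t}\frac{d(u(s),u(t))}{|t-s|}$ exists for a.e. $t\in I$. **LSCC assumptions.** $\phi:X\to(-\infty,\infty]$ is proper, and: (Lower semicontinuity) if $\sup_{n,m}d(u_n,u_m)<\infty$ and $u_n\to u$ in $\sigma$, then $\liminf_n\phi(u_n)\ge\phi(u)$; (Compactness) every sequence with $\sup_n\phi(u_n)<\infty$ and $\sup_{n,m}d(u_n,u_m)<\infty$ has a $\sigma$-convergent subsequence; (Coercivity) there are $u_*\in X$ and constants $\mathsf A,\mathsf B\ge0$ such that $\phi(u)\ge-\mathsf B\,d^2(u,v)-\mathsf Q(v)$ for all $u,v\in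 X$, where $\mathsf Q(v)=\mathsf B\,d^2(v,u_* )+\mathsf A$. **WED functional and value function.** $\mu_\varepsilon$ is the probability measure on $(0,\infty)$ with density $\frac1\varepsilon e^{-t/\varepsilon}$; $\mathcal I_\varepsilon[u]=\int_0^\infty\big(\frac\varepsilon2|u'|^2+\phi(u)\big)\,d\mu_\varepsilon$ for $u\in\mathscr C_\varepsilon(x)=\{u\in AC^2_{\rm loc}([0,\infty);X): u(0)=x,\ \int_0^\infty|u'|^2\,d\mu_\varepsilon<\infty\}$. The value function is $V_\varepsilon(x)=\inf_{u\in\mathscr C_\varepsilon(x)}\mathcal I_\varepsilon[u]$, $D(V_\varepsilon)=\{V_\varepsilon<\infty\}$. Set $G_\varepsilon(x)=\sqrt{2(\phi(x)-V_\varepsilon(x))/\varepsilon}$ if $x\in D(V_\varepsilon)$ and $G_\varepsilon(x)=\infty$ otherwise. **Finsler distance.** $d_\phi(u_0,u_1)=\inf\big\{\int_a^b(\phi(\vartheta(t))\vee1)^{1/2}|\vartheta'|(t)\,dt:\ \vartheta\in AC([a,b];(X,d)),\ \vartheta(a)=u_0,\ \vartheta(b)=u_1\big\}$, equal to $\infty$ if no absolutely continuous curve connects $u_0$ to $u_1$; it is an extended distance with $d_\phi\ge d$. *)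

theory Defs
  imports "HOL-Analysis.Analysis"
begin

subsection \<open>Compatible metric-topological spaces\<close>

text \<open>The distance is the one of a type of class \<^class>\<open>metric_space\<close>; the second topology
  is an abstract topology on the whole type, unrelated to the topology of the type class.\<close>

definition compatible :: "'a::metric_space topology \<Rightarrow> bool" where
  "compatible \<sigma> \<longleftrightarrow>
     topspace \<sigma> = UNIV \<and> Hausdorff_space \<sigma> \<and>
     (\<forall>us vs u v. limitin \<sigma> us u sequentially \<and> limitin \<sigma> vs v sequentially \<longrightarrow>
        ereal (dist u v) \<le> liminf (\<lambda>n. ereal (dist (us n) (vs n)))) \<and>
     (\<forall>U x. openin \<sigma> U \<and> x \<in> U \<longrightarrow>
        (\<exists>V \<delta>. openin \<sigma> V \<and> x \<in> V \<and> \<delta> > 0 \<and> (\<forall>y. infdist y V < \<delta> \<longrightarrow> y \<in> U)))"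

subsection \<open>Absolutely continuous curves\<close>

text \<open>Curves are functions on all of \<^typ>\<open>real\<close>, of which only the values on \<open>I\<close> matter.
  The extended distance \<open>D\<close> is a parameter, and the exponent \<open>p\<close> is finite.\<close>

definition AC :: "real \<Rightarrow> real set \<Rightarrow> ('b \<Rightarrow> 'b \<Rightarrow> ereal) \<Rightarrow> (real \<Rightarrow> 'b) \<Rightarrow> bool" where
  "AC p I D u \<longleftrightarrow>
     (\<exists>m :: real \<Rightarrow> real.
        m \<in> borel_measurable (lebesgue_on I) \<and>
        integrable (lebesgue_on I) (\<lambda>r. \<bar>m r\<bar> powr p) \<and>
        (\<forall>s\<in>I. \<forall>t\<in>I. s \<le> t \<longrightarrow> D (u s) (u t) \<le> ereal (integral\<^sup>L (lebesgue_on {s..t}) m)))"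

definition AC_loc :: "real \<Rightarrow> real set \<Rightarrow> ('b \<Rightarrow> 'b \<Rightarrow> ereal) \<Rightarrow> (real \<Rightarrow> 'b) \<Rightarrow> bool" where
  "AC_loc p I D u \<longleftrightarrow> (\<forall>c d. c \<le> d \<and> {c..d} \<subseteq> I \<longrightarrow> AC p {c..d} D u)"

abbreviation edist :: "'a::metric_space \<Rightarrow> 'a \<Rightarrow> ereal" where
  "edist x y \<equiv> ereal (dist x y)"

text \<open>The metric derivative is an arbitrary real number at points where the limit does not exist, and
  at the end points of the interval on which a curve is considered it may depend on values
  outside the interval. For absolutely continuous curves these points form a null set.\<close>

definition metric_deriv :: "(real \<Rightarrow> 'a::metric_space) \<Rightarrow> real \<Rightarrow> real" where
  "metric_deriv u t = Lim (at t) (\<lambda>s. dist (u s) (u t) / \<bar>t - s\<bar>)"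

subsection \<open>Assumptions on the functional\<close>

definition proper_functional :: "('a \<Rightarrow> ereal) \<Rightarrow> bool" where
  "proper_functional \<phi> \<longleftrightarrow> (\<forall>x. \<phi> x \<noteq> -\<infinity>) \<and> (\<exists>x. \<phi> x < \<infinity>)"

definition bounded_seq :: "(nat \<Rightarrow> 'a::metric_space) \<Rightarrow> bool" where
  "bounded_seq us \<longleftrightarrow> (SUP n. SUP m. edist (us n) (us m)) < \<infinity>"

definition LSCC :: "'a::metric_space topology \<Rightarrow> ('a \<Rightarrow> ereal) \<Rightarrow> 'a \<Rightarrow> real \<Rightarrow> real \<Rightarrow> bool" where
  "LSCC \<sigma> \<phi> u\<^sub>s A B \<longleftrightarrow>
     (\<forall>us u. bounded_seq us \<and> limitin \<sigma> us u sequentially \<longrightarrow>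
        \<phi> u \<le> liminf (\<lambda>n. \<phi> (us n))) \<and>
     (\<forall>us. (SUP n. \<phi> (us n)) < \<infinity> \<and> bounded_seq us \<longrightarrow>
        (\<exists>r u. strict_mono (r :: nat \<Rightarrow> nat) \<and> limitin \<sigma> (us \<circ> r) u sequentially)) \<and>
     A \<ge> 0 \<and> B \<ge> 0 \<and>
     (\<forall>u v. \<phi> u \<ge> ereal (- B * (dist u v)\<^sup>2 - (B * (dist v u\<^sub>s)\<^sup>2 + A)))"

subsection \<open>Weighted energy-dissipation functional and value function\<close>

definition exp_measure :: "real \<Rightarrow> real measure" where
  "exp_measure \<epsilon> = density (lebesgue_on {0<..}) (\<lambda>t. ennreal (exp (- t / \<epsilon>) / \<epsilon>))"

text \<open>Integral of an extended real function whose negative part has finite integral.\<close>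

definition ext_integral :: "'b measure \<Rightarrow> ('b \<Rightarrow> ereal) \<Rightarrow> ereal" where
  "ext_integral M f =
     enn2ereal (\<integral>\<^sup>+ t. e2ennreal (f t) \<partial>M) - enn2ereal (\<integral>\<^sup>+ t. e2ennreal (- f t) \<partial>M)"

definition WED_curves :: "real \<Rightarrow> 'a::metric_space \<Rightarrow> (real \<Rightarrow> 'a) set" where
  "WED_curves \<epsilon> x =
     {u. AC_loc 2 {0..} edist u \<and> u 0 = x \<and>
         (\<integral>\<^sup>+ t. ennreal ((metric_deriv u t)\<^sup>2) \<partial>exp_measure \<epsilon>) < \<infinity>}"

definition WED :: "real \<Rightarrow> ('a::metric_space \<Rightarrow> ereal) \<Rightarrow> (real \<Rightarrow> 'a) \<Rightarrow> ereal" where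
  "WED \<epsilon> \<phi> u =
     ext_integral (exp_measure \<epsilon>) (\<lambda>t. ereal (\<epsilon> / 2 * (metric_deriv u t)\<^sup>2) + \<phi> (u t))"

definition value_fun :: "real \<Rightarrow> ('a::metric_space \<Rightarrow> ereal) \<Rightarrow> 'a \<Rightarrow> ereal" where
  "value_fun \<epsilon> \<phi> x = (INF u\<in>WED_curves \<epsilon> x. WED \<epsilon> \<phi> u)"

definition ereal_root2 :: "ereal \<Rightarrow> ereal" where
  "ereal_root2 x = (if x = \<infinity> then \<infinity> else ereal (sqrt (real_of_ereal x)))"

definition G_fun :: "real \<Rightarrow> ('a::metric_space \<Rightarrow> ereal) \<Rightarrow> 'a \<Rightarrow> ereal" where
  "G_fun \<epsilon> \<phi> x =
     (if value_fun \<epsilon> \<phi> x < \<infinity> then ereal_root2 (2 * (\<phi> x - value_fun \<epsilon> \<phi> x) / ereal \<epsilon>) else \<infinity>)"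

subsection \<open>Finsler distance\<close>

text \<open>The product follows the convention \<open>\<infinity> \<cdot> 0 = 0\<close>, so constant curves have length \<open>0\<close>
  everywhere; the infimum of the empty set is \<open>\<infinity>\<close>.\<close>

definition finsler_dist :: "('a::metric_space \<Rightarrow> ereal) \<Rightarrow> 'a \<Rightarrow> 'a \<Rightarrow> ereal" where
  "finsler_dist \<phi> u\<^sub>0 u\<^sub>1 =
     Inf {enn2ereal (\<integral>\<^sup>+ t. e2ennreal (ereal_root2 (max (\<phi> (\<theta> t)) 1) * ereal (metric_deriv \<theta> t))
            \<partial>lebesgue_on {a..b}) | a b \<theta>.
          a \<le> b \<and> AC 1 {a..b} edist \<theta> \<and> \<theta> a = u\<^sub>0 \<and> \<theta> b = u\<^sub>1}"

subsection \<open>Absolute continuity of functions with values in \<open>(-\<infinity>, \<infinity>]\<close>\<close>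

text \<open>The usual distance, extended to \<open>(-\<infinity>, \<infinity>]\<close> by putting \<open>\<infinity>\<close> at infinite distance from the
  reals. The value \<open>-\<infinity>\<close> is excluded by having infinite distance even to itself.
  Lemma \<open>AC_ext_real_dist_iff\<close> says what absolute continuity then means.
  The case of the constant \<open>\<infinity>\<close> cannot be
  avoided: a curve that stays at a point where the value function is infinite is
  absolutely continuous for the Finsler distance.\<close>

definition ext_real_dist :: "ereal \<Rightarrow> ereal \<Rightarrow> ereal" where
  "ext_real_dist x y = (if x = \<infinity> \<and> y = \<infinity> then 0 else \<bar>x - y\<bar>)"

lemma AC_cong: "(\<And>t. t \<in> I \<Longrightarrow> u t = v t) \<Longrightarrow> AC p I D u \<longleftrightarrow> AC p I D v"
  unfolding AC_def by (simp cong: ball_cong)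

lemma ext_real_dist_real: "ext_real_dist (ereal x) (ereal y) = edist x y"
  by (simp add: ext_real_dist_def dist_real_def)

lemma ext_real_dist_finite:
  "ext_real_dist x y \<noteq> \<infinity> \<Longrightarrow> x = \<infinity> \<and> y = \<infinity> \<or> \<bar>x\<bar> \<noteq> \<infinity> \<and> \<bar>y\<bar> \<noteq> \<infinity>"
  by (cases x; cases y) (simp_all add: ext_real_dist_def)

lemma AC_ext_real_dist_iff:
  "AC p I ext_real_dist f \<longleftrightarrow>
     (\<forall>t\<in>I. f t = \<infinity>) \<or> (\<exists>g. (\<forall>t\<in>I. f t = ereal (g t)) \<and> AC p I edist g)"
proof
  assume L: "AC p I ext_real_dist f"
  then have fin: "ext_real_dist (f s) (f t) \<noteq> \<infinity>" if "s \<in> I" "t \<in> I" "s \<le> t" for s t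
  proof -
    from L obtain m where
      "\<forall>s\<in>I. \<forall>t\<in>I. s \<le> t \<longrightarrow> ext_real_dist (f s) (f t) \<le> ereal (integral\<^sup>L (lebesgue_on {s..t}) m)"
      unfolding AC_def by blast
    with that have "ext_real_dist (f s) (f t) \<le> ereal (integral\<^sup>L (lebesgue_on {s..t}) m)" by blast
    then show ?thesis by (metis PInfty_neq_ereal(1) ereal_infty_less_eq(1))
  qed
  show "(\<forall>t\<in>I. f t = \<infinity>) \<or> (\<exists>g. (\<forall>t\<in>I. f t = ereal (g t)) \<and> AC p I edist g)"
  proof (cases "\<forall>t\<in>I. f t = \<infinity>")
    case False
    then obtain r where r: "r \<in> I" "f r \<noteq> \<infinity>" by blast
    have "\<bar>f t\<bar> \<noteq> \<infinity>" if "t \<in> I" for t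
      using ext_real_dist_finite fin[OF that r(1)] fin[OF r(1) that] r(2) linear[of t r] by metis
    then have eq: "f t = ereal (real_of_ereal (f t))" if "t \<in> I" for t
      using that by (simp add: ereal_real)
    have "AC p I edist (\<lambda>t. real_of_ereal (f t))"
      using iffD1[OF AC_cong[OF eq] L] by (simp add: AC_def ext_real_dist_real)
    then show ?thesis
      by (intro disjI2 exI[of _ "\<lambda>t. real_of_ereal (f t)"] conjI ballI eq)
  qed (rule disjI1)
next
  assume "(\<forall>t\<in>I. f t = \<infinity>) \<or> (\<exists>g. (\<forall>t\<in>I. f t = ereal (g t)) \<and> AC p I edist g)"
  then show "AC p I ext_real_dist f"
  proof
    assume "\<forall>t\<in>I. f t = \<infinity>"
    then show ?thesis
      unfolding AC_def by (intro exI[of _ "\<lambda>_. 0"]) (auto simp: ext_real_dist_def)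
  next
    assume "\<exists>g. (\<forall>t\<in>I. f t = ereal (g t)) \<and> AC p I edist g"
    then obtain g where g: "\<And>t. t \<in> I \<Longrightarrow> f t = ereal (g t)" "AC p I edist g" by blast
    from g(2) have "AC p I ext_real_dist (\<lambda>t. ereal (g t))"
      by (simp add: AC_def ext_real_dist_real)
    then show ?thesis
      using AC_cong[of I f "\<lambda>t. ereal (g t)" p ext_real_dist] g(1) by blast
  qed
qed

end

theory Submission
  imports Defs
begin

text \<open>The value function \<open>V\<close> satisfies a dynamic programming inequality: a curve that runs from \<open>x\<close> to \<open>y\<close>
in time \<open>T\<close> and continues with a competitor for \<open>y\<close> is a competitor for \<open>x\<close>, so that \<open>V x\<close> is at most the
weighted action of the first piece plus \<open>exp (- T / \<epsilon>) * V y\<close> (\<open>value_fun_concat\<close>). The time in which a curve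
\<open>u\<close> is traversed is free. Let \<open>S = sqrt (max \<phi> 1)\<close> be the Finsler weight. Traversing \<open>u\<close> with speed \<open>q * S\<close> takes
the time \<open>\<integral> |u'| / (q * S)\<close>, which is at most \<open>1 / q\<close> times the Finsler length \<open>\<integral> S * |u'|\<close>, and the action
density \<open>(\<epsilon> / 2 * q\<^sup>2 * S\<^sup>2 + \<phi>) * |u'| / (q * S)\<close> is also controlled by \<open>S * |u'|\<close>. The resulting inequality
is \<open>dynamic_programming\<close>.

With \<open>q = 1\<close>, applied to \<open>u\<close> and to the reversed curve, it bounds the oscillation of \<open>V\<close> by a modulus of the
Finsler length (\<open>value_fun_modulus\<close>). This gives the continuity of \<open>V\<close> and its absolute continuity along
curves. Differentiating it at a Lebesgue point \<open>t\<close> gives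
\<open>- (V \<circ> u)' \<le> |u'| / \<epsilon> * (\<epsilon> / 2 * q * S + (\<phi> - V) / (q * S))\<close> at \<open>t\<close>, for all rational \<open>q > 0\<close> at once, and the infimum
of the right-hand side over \<open>q\<close> is \<open>sqrt (2 * (\<phi> - V) / \<epsilon>) * |u'|\<close> (\<open>value_fun_derivative_upper\<close>). The reversed
curve yields the other sign.

A curve that is absolutely continuous for the Finsler distance has finite Finsler length, because lower
semicontinuity of \<open>\<phi>\<close> bounds the Finsler distance from below by \<open>\<alpha> * d\<close> near a point with \<open>S > \<alpha>\<close>
(\<open>AC_finsler_dist_imp_finsler_curve\<close>). The value \<open>-\<infinity>\<close> is excluded by coercivity and a weighted Hardy
inequality (\<open>weighted_hardy\<close>).

Two facts from real analysis carry these arguments: indefinite integrals are differentiable almost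
everywhere (\<open>lebesgue_differentiation\<close>), and a function whose increments are dominated by an integral is
itself an indefinite integral (\<open>dominated_increments_derivative\<close>). They also give the almost everywhere
existence of the metric derivative (\<open>metric_derivative_dominated\<close>).\<close>

section \<open>Differentiation of indefinite integrals\<close>

text \<open>Around each bad point there are arbitrarily short bad intervals, which by Vitali's theorem contain a
disjoint family that covers almost all bad points. Tagged by these points, finitely many of them form a
partial division, so Henstock's lemma bounds the total error on them, and hence their total length, by
any given \<open>e\<close>.\<close>

lemma negligible_bad_averages:
  fixes f :: "real \<Rightarrow> real"
  assumes f: "f integrable_on {a..b}" and k: "k > 0"
  defines "F \<equiv> \<lambda>x. integral {a..x} f"
  shows "negligible {x \<in> {a<..<b}. \<forall>d>0. \<exists>h. 0 < \<bar>h\<bar> \<and> \<bar>h\<bar> < d \<and> x + h \<in> {a..b} \<and>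
           \<bar>F (x + h) - F x - h * f x\<bar> > k * \<bar>h\<bar>}" (is "negligible ?S")
proof -
  define S where "S = ?S"
  have "negligible S"
    unfolding negligible_outer_le
  proof (intro allI impI)
    fix e :: real assume "e > 0"
    then have "k * e > 0" using k by simp
    obtain \<gamma> where "gauge \<gamma>" and \<gamma>: "\<And>p. \<lbrakk>p tagged_partial_division_of (cbox a b); \<gamma> fine p\<rbrakk> \<Longrightarrow>
               (\<Sum>(x,I)\<in>p. norm(measure lborel I * f x - integral I f)) < k * e"
      using Henstock_lemma[of f a b, OF _ \<open>k * e > 0\<close>] f by auto
    define K where "K = {(x, h). x \<in> {a<..<b} \<and> h \<noteq> 0 \<and> x + h \<in> {a..b} \<and>
       cball (x + h/2) (\<bar>h\<bar>/2) \<subseteq> \<gamma> x \<and> \<bar>F (x + h) - F x - h * f x\<bar> > k * \<bar>h\<bar>}"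
    define c where "c = (\<lambda>i :: real \<times> real. fst i + snd i / 2)"
    define r where "r = (\<lambda>i :: real \<times> real. \<bar>snd i\<bar> / 2)"
    define B where "B = (\<lambda>i. cball (c i) (r i))"
    have B: "B i = cbox (min (fst i) (fst i + snd i)) (max (fst i) (fst i + snd i))" for i
      unfolding B_def c_def r_def cball_eq_atLeastAtMost box_real by (auto simp: min_def max_def field_simps)
    have Bm: "B i \<in> lmeasurable" for i
      by (simp only: B lmeasurable_cbox)
    have rpos: "0 < r i" if "i \<in> K" for i
      using that by (auto simp: K_def r_def)
    have cov: "\<exists>i. i \<in> K \<and> x \<in> cball (c i) (r i) \<and> r i < d" if x: "x \<in> S" and d: "0 < d" for x d
    proof -
      obtain \<delta> where \<delta>: "\<delta> > 0" "ball x \<delta> \<subseteq> \<gamma> x"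
        using \<open>gauge \<gamma>\<close> unfolding gauge_def by (meson open_contains_ball)
      obtain h where h: "0 < \<bar>h\<bar>" "\<bar>h\<bar> < min d \<delta>" "x + h \<in> {a..b}" "\<bar>F (x + h) - F x - h * f x\<bar> > k * \<bar>h\<bar>"
      proof -
        have "\<forall>d>0. \<exists>h. 0 < \<bar>h\<bar> \<and> \<bar>h\<bar> < d \<and> x + h \<in> {a..b} \<and>
            \<bar>F (x + h) - F x - h * f x\<bar> > k * \<bar>h\<bar>"
          using x unfolding S_def mem_Collect_eq by (rule conjunct2)
        from this[rule_format, of "min d \<delta>"] d \<delta>(1) show thesis
          by (metis that min_less_iff_conj)
      qed
      have "cball (x + h/2) (\<bar>h\<bar>/2) \<subseteq> ball x \<delta>"
        using h(2) by (auto simp: subset_iff dist_real_def abs_real_def split: if_splits)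
      moreover have "x \<in> {a<..<b}" using x unfolding S_def by blast
      ultimately have "(x, h) \<in> K" using h \<delta>(2) by (auto simp: K_def)
      moreover have "x \<in> cball (c (x, h)) (r (x, h))" by (auto simp: c_def r_def dist_real_def)
      moreover have "r (x, h) < d" using h by (auto simp: r_def)
      ultimately show ?thesis by blast
    qed
    obtain C where C: "countable C" "C \<subseteq> K" "pairwise (\<lambda>i j. disjnt (B i) (B j)) C"
       "negligible (S - (\<Union>i\<in>C. B i))"
      using Vitali_covering_theorem_cballs[of K r S c, OF rpos cov] unfolding B_def by blast
    have fin: "measure lebesgue (\<Union>(B ` D)) \<le> e" if D: "D \<subseteq> C" "finite D" for D
    proof -
      define p where "p = (\<lambda>i. (fst i, B i)) ` D"
      have disj: "B i \<inter> B j = {}" if "i \<in> D" "j \<in> D" "i \<noteq> j" for i j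
        using C(3) that D(1) unfolding pairwise_def disjnt_def by blast
      have mem: "fst i \<in> B i" for i unfolding B by auto
      have inj: "inj_on (\<lambda>i. (fst i, B i)) D"
        by (rule inj_onI) (metis disj mem disjoint_iff prod.inject)
      have "p tagged_partial_division_of (cbox a b)"
        unfolding tagged_partial_division_of_def
      proof (intro conjI allI impI)
        show "finite p" using D by (simp add: p_def)
        fix x I assume "(x, I) \<in> p"
        then obtain i where i: "i \<in> D" "x = fst i" "I = B i" by (auto simp: p_def)
        then show "x \<in> I" "\<exists>a b. I = cbox a b" using mem B by auto
        have "i \<in> K" using i D C by blast
        then show "I \<subseteq> cbox a b" unfolding i B by (cases i) (auto simp: K_def)
      next
        fix x I y J assume "(x, I) \<in> p \<and> (y, J) \<in> p \<and> (x, I) \<noteq> (y, J)"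
        then obtain i j where ij: "i \<in> D" "j \<in> D" "I = B i" "J = B j" "i \<noteq> j"
          by (auto simp: p_def)
        then have "I \<inter> J = {}" using disj by blast
        then show "interior I \<inter> interior J = {}"
          using interior_subset by blast
      qed
      moreover have "\<gamma> fine p"
        unfolding fine_def p_def B_def c_def r_def using D(1) C(2) unfolding K_def by fastforce
      ultimately have "(\<Sum>(x,I)\<in>p. norm(measure lborel I * f x - integral I f)) < k * e"
        by (rule \<gamma>)
      then have *: "(\<Sum>i\<in>D. norm(measure lborel (B i) * f (fst i) - integral (B i) f)) < k * e"
        unfolding p_def by (subst (asm) sum.reindex[OF inj]) (simp add: o_def)
      have int: "f integrable_on {s..t}" if "a \<le> s" "t \<le> b" for s t
        using integrable_subinterval_real[OF f] that by auto
      have "k * measure lebesgue (B i) \<le> norm (measure lborel (B i) * f (fst i) - integral (B i) f)"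
        if "i \<in> D" for i
      proof -
        obtain x h where i: "i = (x, h)" by (cases i)
        have "i \<in> K" using that D C by blast
        then have K: "a < x" "x < b" "h \<noteq> 0" "a \<le> x + h" "x + h \<le> b" "\<bar>F (x + h) - F x - h * f x\<bar> > k * \<bar>h\<bar>"
          by (auto simp: K_def i)
        show ?thesis
        proof (cases "h > 0")
          case True
          have "F (x + h) = F x + integral {x..x+h} f"
            unfolding F_def using True K int by (intro Henstock_Kurzweil_Integration.integral_combine[symmetric]) auto
          then show ?thesis using K True by (simp add: B i abs_minus_commute)
        next
          case False
          then have "F x = F (x + h) + integral {x+h..x} f"
            unfolding F_def using K int by (intro Henstock_Kurzweil_Integration.integral_combine[symmetric]) auto
          then show ?thesis using K False by (simp add: B i)
        qed
      qed
      then have "(\<Sum>i\<in>D. k * measure lebesgue (B i)) \<le> k * e"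
        using * by (smt (verit) sum_mono)
      then have "(\<Sum>i\<in>D. measure lebesgue (B i)) \<le> e"
        using k by (simp add: sum_distrib_left[symmetric])
      moreover have "measure lebesgue (\<Union>(B ` D)) \<le> (\<Sum>i\<in>D. measure lebesgue (B i))"
        by (intro measure_UNION_le D(2) fmeasurableD Bm)
      ultimately show ?thesis by simp
    qed
    define N where "N = S - \<Union>(B ` C)"
    have "N \<in> lmeasurable" "measure lebesgue N = 0"
      using C(4) unfolding N_def[symmetric] negligible_iff_measure by blast+
    moreover have "\<Union>(B ` C) \<in> lmeasurable" "measure lebesgue (\<Union>(B ` C)) \<le> e"
      using fmeasurable_UN_bound[OF C(1) Bm fin] measure_UN_bound[OF C(1) Bm fin] by blast+
    ultimately have "N \<union> \<Union>(B ` C) \<in> lmeasurable" "measure lebesgue (N \<union> \<Union>(B ` C)) \<le> e"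
      using measure_Un_le[of N lebesgue "\<Union>(B ` C)"] by (simp_all add: fmeasurableD fmeasurable.Un)
    moreover have "S \<subseteq> N \<union> \<Union>(B ` C)" unfolding N_def by blast
    ultimately show "\<exists>T. S \<subseteq> T \<and> T \<in> lmeasurable \<and> measure lebesgue T \<le> e"
      by blast
  qed
  then show ?thesis unfolding S_def .
qed

theorem lebesgue_differentiation:
  fixes f :: "real \<Rightarrow> real"
  assumes f: "f integrable_on {a..b}"
  shows "AE x in lebesgue_on {a<..<b}. ((\<lambda>x. integral {a..x} f) has_real_derivative f x) (at x)"
proof -
  define F where "F = (\<lambda>x. integral {a..x} f)"
  define S where "S k = {x \<in> {a<..<b}. \<forall>d>0. \<exists>h. 0 < \<bar>h\<bar> \<and> \<bar>h\<bar> < d \<and> x + h \<in> {a..b} \<and>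
           \<bar>F (x + h) - F x - h * f x\<bar> > k * \<bar>h\<bar>}" for k :: real
  have "negligible (S (1 / Suc n))" for n
    unfolding S_def F_def by (rule negligible_bad_averages[OF f]) simp
  then have "negligible (\<Union>n. S (1 / Suc n))"
    using negligible_countable_Union[of "range (\<lambda>n. S (1 / Suc n))"] by blast
  moreover have "(F has_real_derivative f x) (at x)" if x: "x \<in> {a<..<b}" "x \<notin> (\<Union>n. S (1 / Suc n))" for x
    unfolding has_field_derivative_iff LIM_eq
  proof (intro allI impI)
    fix e :: real assume "e > 0"
    then obtain n where n: "1 / Suc n < e" using nat_approx_posE by blast
    then obtain d where d: "d > 0" and D: "\<And>h. \<lbrakk>0 < \<bar>h\<bar>; \<bar>h\<bar> < d; x + h \<in> {a..b}\<rbrakk> \<Longrightarrow>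
           \<bar>F (x + h) - F x - h * f x\<bar> \<le> (1 / Suc n) * \<bar>h\<bar>"
    proof -
      have "x \<notin> S (1 / Suc n)" using x(2) by blast
      then have "\<exists>d>0. \<forall>h. 0 < \<bar>h\<bar> \<longrightarrow> \<bar>h\<bar> < d \<longrightarrow> x + h \<in> {a..b} \<longrightarrow>
          \<bar>F (x + h) - F x - h * f x\<bar> \<le> (1 / Suc n) * \<bar>h\<bar>"
        using x(1) unfolding S_def mem_Collect_eq by (meson not_less)
      then show thesis using that by blast
    qed
    show "\<exists>s>0. \<forall>y. y \<noteq> x \<and> norm (y - x) < s \<longrightarrow> norm ((F y - F x) / (y - x) - f x) < e"
    proof (intro exI[of _ "min d (min (x - a) (b - x))"] conjI allI impI)
      fix y assume y: "y \<noteq> x \<and> norm (y - x) < min d (min (x - a) (b - x))"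
      have "\<bar>F y - F x - (y - x) * f x\<bar> \<le> (1 / Suc n) * \<bar>y - x\<bar>"
        using D[of "y - x"] y by (auto simp: abs_real_def split: if_splits)
      also have "\<dots> < e * \<bar>y - x\<bar>" using n y by (intro mult_strict_right_mono) auto
      finally have "\<bar>F y - F x - (y - x) * f x\<bar> < e * \<bar>y - x\<bar>" .
      moreover have "(F y - F x) / (y - x) - f x = (F y - F x - (y - x) * f x) / (y - x)"
        using y by (simp add: divide_simps)
      ultimately show "norm ((F y - F x) / (y - x) - f x) < e"
        using y by (simp add: divide_simps mult.commute)
    qed (use d x in auto)
  qed
  ultimately show ?thesis
    unfolding F_def[symmetric]
    by (intro AE_I'[of "(\<Union>n. S (1 / Suc n)) \<inter> {a<..<b}"])
       (auto simp: null_sets_restrict_space negligible_iff_null_sets[symmetric] intro: negligible_Int)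
qed

section \<open>Functions with dominated increments\<close>

lemma integral_diff_Icc:
  fixes m :: "real \<Rightarrow> real"
  assumes m: "m integrable_on {a..b}" and st: "a \<le> s" "s \<le> t" "t \<le> b"
  shows "integral {a..t} m - integral {a..s} m = integral {s..t} m"
  using Henstock_Kurzweil_Integration.integral_combine[of a s t m] integrable_subinterval_real[OF m, of a t] st
  by simp

lemma clamped_integral_continuous:
  fixes m :: "real \<Rightarrow> real"
  assumes m: "m integrable_on {a..b}" and ab: "a \<le> b"
  shows "continuous_on UNIV (\<lambda>x. integral {a..max a (min b x)} m)"
proof -
  have "continuous_on UNIV ((\<lambda>x. integral {a..x} m) \<circ> (\<lambda>x. max a (min b x)))"
    by (rule continuous_on_compose[OF _ continuous_on_subset[OF indefinite_integral_continuous_1[OF m]]])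
       (use ab in \<open>auto intro!: continuous_intros\<close>)
  then show ?thesis by (simp add: o_def)
qed

lemma borel_measure_eqI_Ioc:
  fixes M N :: "real measure"
  assumes sets: "sets M = sets borel" "sets N = sets borel"
    and eq: "\<And>x y. x \<le> y \<Longrightarrow> emeasure M {x<..y} = emeasure N {x<..y}"
    and fin: "\<And>x y. x \<le> y \<Longrightarrow> emeasure M {x<..y} \<noteq> \<infinity>"
  shows "M = N"
proof (rule measure_eqI_generator_eq)
  let ?E = "range (\<lambda>(a, b). {a<..b::real})"
  show "Int_stable ?E"
  proof (rule Int_stableI, safe)
    fix a b c d :: real
    have "{a<..b} \<inter> {c<..d} = (\<lambda>(a, b). {a<..b}) (max a c, min b d)" by auto
    then show "{a<..b} \<inter> {c<..d} \<in> ?E" by blast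
  qed
  show "emeasure M X = emeasure N X" if "X \<in> ?E" for X
  proof -
    from that obtain p where "X = (\<lambda>(a, b). {a<..b}) p" by blast
    then show ?thesis using eq[of "fst p" "snd p"] by (cases "fst p \<le> snd p") (auto simp: split_beta)
  qed
  show "sets M = sigma_sets UNIV ?E" "sets N = sigma_sets UNIV ?E"
    unfolding sets by (simp_all add: borel_sigma_sets_Ioc)
  show "range (\<lambda>n. {- real n<..real n}) \<subseteq> ?E" by auto
  show "(\<Union>n. {- real n<..real n}) = UNIV"
  proof (intro equalityI subsetI)
    fix x :: real
    obtain n where "\<bar>x\<bar> < real n" using reals_Archimedean2 by blast
    then have "x \<in> {- real n<..real n}" by auto
    then show "x \<in> (\<Union>n. {- real n<..real n})" by blast
  qed simp
  show "emeasure M {- real n<..real n} \<noteq> \<infinity>" for n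
    by (rule fin) simp
qed simp

text \<open>This is how a Stieltjes measure is recognised as dominated by a measure with a density: it is one of
two nonnegative summands.\<close>

lemma emeasure_interval_measure_add:
  fixes F G :: "real \<Rightarrow> real"
  assumes F: "mono F" "continuous_on UNIV F" and G: "mono G" "continuous_on UNIV G"
    and \<mu>: "sets \<mu> = sets borel"
      "\<And>x y. x \<le> y \<Longrightarrow> emeasure \<mu> {x<..y} = ennreal (F y - F x + (G y - G x))"
    and A: "A \<in> sets borel"
  shows "emeasure \<mu> A = emeasure (interval_measure F) A + emeasure (interval_measure G) A"
proof -
  let ?F = "interval_measure F" and ?G = "interval_measure G"
  define \<nu> where "\<nu> = measure_of UNIV (sets borel) (\<lambda>A. emeasure ?F A + emeasure ?G A)"
  have sets: "sets \<nu> = sets borel" unfolding \<nu>_def using sets.sigma_sets_eq[of borel] by (simp add: sets_measure_of)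
  have \<nu>: "emeasure \<nu> A = emeasure ?F A + emeasure ?G A" if "A \<in> sets borel" for A
  proof (rule emeasure_measure_of[OF \<nu>_def])
    show "positive (sets \<nu>) (\<lambda>A. emeasure ?F A + emeasure ?G A)"
      by (simp add: positive_def)
    show "countably_additive (sets \<nu>) (\<lambda>A. emeasure ?F A + emeasure ?G A)"
      unfolding countably_additive_def sets
    proof (intro allI impI)
      fix X :: "nat \<Rightarrow> real set" assume X: "range X \<subseteq> sets borel" "disjoint_family X"
      have "(\<Sum>i. emeasure ?F (X i) + emeasure ?G (X i)) = (\<Sum>i. emeasure ?F (X i)) + (\<Sum>i. emeasure ?G (X i))"
        by (intro suminf_add[symmetric] summableI)
      then show "(\<Sum>i. emeasure ?F (X i) + emeasure ?G (X i)) = emeasure ?F (\<Union> (range X)) + emeasure ?G (\<Union> (range X))"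
        using X by (simp add: suminf_emeasure)
    qed
  qed (use that sets in auto)
  have Ioc: "emeasure (interval_measure H) {x<..y} = ennreal (H y - H x)" if "mono H" "continuous_on UNIV H" "x \<le> y" for H and x y :: real
    using that by (intro emeasure_interval_measure_Ioc) (auto simp: mono_def continuous_on_eq_continuous_within intro: continuous_at_imp_continuous_at_within)
  have "\<mu> = \<nu>"
  proof (rule borel_measure_eqI_Ioc)
    fix x y :: real assume xy: "x \<le> y"
    then have "F x \<le> F y" "G x \<le> G y" using F G by (auto simp: mono_def)
    then show "emeasure \<mu> {x<..y} = emeasure \<nu> {x<..y}"
      using xy F G by (simp add: \<mu> \<nu> Ioc ennreal_plus)
    show "emeasure \<mu> {x<..y} \<noteq> \<infinity>" using xy by (simp add: \<mu>)
  qed (simp_all add: \<mu> sets)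
  then show ?thesis using \<nu>[OF A] by simp
qed

text \<open>Let \<open>M\<close> be the indefinite integral of \<open>m\<close>. Both \<open>g + M\<close> and \<open>M - g\<close> are nondecreasing, and their Stieltjes
measures add up to the measure with density \<open>2 * m\<close>. Thus the measure of \<open>g + M\<close> is absolutely continuous
with respect to Lebesgue measure, and its Radon-Nikodym density minus \<open>m\<close> is the density of \<open>g\<close>.\<close>

lemma dominated_increments_density:
  fixes g m :: "real \<Rightarrow> real"
  assumes m: "m integrable_on {a..b}" "\<And>x. x \<in> {a..b} \<Longrightarrow> 0 \<le> m x" and ab: "a \<le> b"
    and bd: "\<And>s t. \<lbrakk>a \<le> s; s \<le> t; t \<le> b\<rbrakk> \<Longrightarrow> \<bar>g t - g s\<bar> \<le> integral {s..t} m"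
  obtains \<rho> where "\<And>s t. \<lbrakk>a \<le> s; s \<le> t; t \<le> b\<rbrakk> \<Longrightarrow> (\<rho> has_integral (g t - g s)) {s..t}"
proof -
  \<comment> \<open>Stieltjes measures live on the whole line, so all functions are extended by constants.\<close>
  define cl where "cl x = max a (min b x)" for x
  have cl: "cl x \<in> {a..b}" "x \<le> y \<Longrightarrow> cl x \<le> cl y" "x \<in> {a..b} \<Longrightarrow> cl x = x" for x y
    using ab by (auto simp: cl_def)
  define M where "M x = integral {a..cl x} m" for x
  have M_diff: "M y - M x = integral {cl x..cl y} m" if "x \<le> y" for x y
  proof -
    show ?thesis unfolding M_def
      using cl(1)[of x] cl(1)[of y] cl(2)[OF that] by (intro integral_diff_Icc[OF m(1)]) auto
  qed
  have contM: "continuous_on UNIV M"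
    unfolding M_def[abs_def] cl_def by (rule clamped_integral_continuous[OF m(1) ab])
  have g_le: "\<bar>g (cl y) - g (cl x)\<bar> \<le> M y - M x" if "x \<le> y" for x y
    unfolding M_diff[OF that] using cl(1)[of x] cl(1)[of y] cl(2)[OF that] by (intro bd) auto
  have contg: "continuous_on UNIV (\<lambda>x. g (cl x))"
    unfolding continuous_on_iff
  proof (intro ballI allI impI)
    fix x e :: real assume "e > 0"
    then obtain d where "d > 0" "\<And>y. dist y x < d \<Longrightarrow> dist (M y) (M x) < e"
      using contM unfolding continuous_on_iff by (metis UNIV_I)
    moreover have "dist (g (cl y)) (g (cl x)) \<le> dist (M y) (M x)" for y
      using g_le[of x y] g_le[of y x] by (cases "x \<le> y") (auto simp: dist_real_def)
    ultimately show "\<exists>d>0. \<forall>y\<in>UNIV. dist y x < d \<longrightarrow> dist (g (cl y)) (g (cl x)) < e"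
      by (meson le_less_trans)
  qed
  define H where "H x = g (cl x) + M x" for x
  define L where "L x = M x - g (cl x)" for x
  have H: "mono H" "continuous_on UNIV H"
    using g_le contg contM unfolding H_def by (auto simp: mono_def abs_le_iff intro!: continuous_intros) (smt (verit))
  have L: "mono L" "continuous_on UNIV L"
    using g_le contg contM unfolding L_def by (auto simp: mono_def abs_le_iff intro!: continuous_intros) (smt (verit))
  define f where "f x = indicator {a..b} x * (2 * m x)" for x
  have mabs: "m absolutely_integrable_on {a..b}"
    using m by (intro nonnegative_absolutely_integrable_1) auto
  have f: "f \<in> borel_measurable lebesgue" "\<And>x. 0 \<le> f x"
  proof -
    have "(\<lambda>x. indicator {a..b} x *\<^sub>R m x) \<in> borel_measurable lebesgue"
      using mabs by (auto simp: set_integrable_def dest: borel_measurable_integrable)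
    then have "(\<lambda>x. 2 * (indicator {a..b} x *\<^sub>R m x)) \<in> borel_measurable lebesgue" by measurable
    then show "f \<in> borel_measurable lebesgue" unfolding f_def by (simp add: mult.left_commute)
  qed (use m(2) in \<open>auto simp: f_def indicator_def\<close>)
  define \<mu> where "\<mu> = distr (density lebesgue (\<lambda>x. ennreal (f x))) borel id"
  have meas_id: "id \<in> density lebesgue (\<lambda>x. ennreal (f x)) \<rightarrow>\<^sub>M (borel :: real measure)"
    by (simp add: measurable_def)
  have \<mu>: "emeasure \<mu> A = (\<integral>\<^sup>+x. ennreal (f x) * indicator A x \<partial>lebesgue)" if "A \<in> sets borel" for A
  proof -
    have "A \<in> sets lebesgue" using that by simp
    then show ?thesis using that meas_id f(1) by (simp add: \<mu>_def emeasure_distr emeasure_density)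
  qed
  have \<mu>_Ioc: "emeasure \<mu> {x<..y} = ennreal (H y - H x + (L y - L x))" if "x \<le> y" for x y
  proof -
    have "((\<lambda>x. 2 * m x) has_integral (2 * integral {cl x..cl y} m)) {cl x..cl y}"
      using cl(1)[of x] cl(1)[of y]
      by (intro has_integral_mult_right integrable_integral integrable_subinterval_real[OF m(1)]) auto
    then have "((\<lambda>x. 2 * m x) has_integral (2 * integral {cl x..cl y} m)) ({a..b} \<inter> {x<..y})"
    proof (subst has_integral_spike_set_eq)
      show "negligible {z \<in> {a..b} \<inter> {x<..y} - {cl x..cl y}. 2 * m z \<noteq> 0}"
        by (rule negligible_subset[of "{}"]) (auto simp: cl_def)
      show "negligible {z \<in> {cl x..cl y} - {a..b} \<inter> {x<..y}. 2 * m z \<noteq> 0}"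
      proof (rule negligible_subset[of "{cl x, cl y}"])
        have "z = cl x \<or> z = cl y" if "cl x \<le> z" "z \<le> cl y" "\<not> (a \<le> z \<and> z \<le> b \<and> x < z \<and> z \<le> y)" for z
          using that ab unfolding cl_def by linarith
        then show "{z \<in> {cl x..cl y} - {a..b} \<inter> {x<..y}. 2 * m z \<noteq> 0} \<subseteq> {cl x, cl y}"
          by auto
      qed simp
    qed simp
    then have "integral\<^sup>N lborel (\<lambda>z. ennreal (2 * m z) * indicator ({a..b} \<inter> {x<..y}) z) = ennreal (2 * integral {cl x..cl y} m)"
      using m(2) by (intro nn_integral_has_integral_lebesgue') auto
    also have "(\<lambda>z. ennreal (2 * m z) * indicator ({a..b} \<inter> {x<..y}) z) = (\<lambda>z. ennreal (f z) * indicator {x<..y} z)"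
      by (auto simp: f_def indicator_def)
    finally show ?thesis
      by (simp add: \<mu> nn_integral_completion H_def L_def M_diff[OF that, symmetric])
  qed
  have split: "emeasure \<mu> A = emeasure (interval_measure H) A + emeasure (interval_measure L) A"
    if "A \<in> sets borel" for A
    by (rule emeasure_interval_measure_add[OF H L _ \<mu>_Ioc that]) (simp add: \<mu>_def)
  have "absolutely_continuous lborel (interval_measure H)"
    unfolding absolutely_continuous_def
  proof
    fix A :: "real set" assume A: "A \<in> null_sets lborel"
    then have Ab: "A \<in> sets borel" by auto
    have "A \<in> null_sets lebesgue" using A by (rule null_sets_completionI)
    then have ae: "AE x in lebesgue. ennreal (f x) * indicator A x = 0"
      by (intro AE_I'[of A]) (auto simp: indicator_def)
    have "emeasure \<mu> A = (\<integral>\<^sup>+x. 0 \<partial>(lebesgue :: real measure))"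
      unfolding \<mu>[OF Ab] by (intro nn_integral_cong_AE ae)
    then have "emeasure \<mu> A = 0" by simp
    then show "A \<in> null_sets (interval_measure H)"
      using split[OF Ab] Ab by (auto simp: null_sets_def)
  qed
  then obtain h where h: "h \<in> borel_measurable lborel" "density lborel h = interval_measure H"
    using sigma_finite_measure.Radon_Nikodym[OF sigma_finite_lborel, of "interval_measure H"] by auto
  show thesis
  proof (rule that)
    fix s t :: real assume st: "a \<le> s" "s \<le> t" "t \<le> b"
    have HH: "0 \<le> H t - H s" using H(1) st by (auto simp: mono_def)
    have "emeasure (interval_measure H) {s<..t} = ennreal (H t - H s)"
      using H st by (intro emeasure_interval_measure_Ioc)
        (auto simp: mono_def continuous_on_eq_continuous_within intro: continuous_at_imp_continuous_at_within)
    then have eq: "(\<integral>\<^sup>+x. h x * indicator {s<..t} x \<partial>lborel) = ennreal (H t - H s)"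
      unfolding h(2)[symmetric] using h(1) by (simp add: emeasure_density)
    then have "AE x in lborel. h x * indicator {s<..t} x \<noteq> \<infinity>"
      using h(1) by (intro nn_integral_PInf_AE) auto
    then have "(\<integral>\<^sup>+x. h x * indicator {s<..t} x \<partial>lborel) = (\<integral>\<^sup>+x. ennreal (enn2real (h x) * indicator {s<..t} x) \<partial>lborel)"
      by (intro nn_integral_cong_AE) (auto simp: indicator_def less_top top_neq_ennreal split: if_splits elim!: eventually_mono)
    then have "((\<lambda>x. enn2real (h x) * indicator {s<..t} x) has_integral (H t - H s)) UNIV"
      using h(1) HH eq by (intro nn_integral_has_integral) (auto intro!: borel_measurable_times)
    then have "((\<lambda>x. if x \<in> {s<..t} then enn2real (h x) else 0) has_integral (H t - H s)) UNIV"
      by (rule has_integral_eq[rotated]) (auto simp: indicator_def)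
    then have "((\<lambda>x. enn2real (h x)) has_integral (H t - H s)) {s<..t}"
      unfolding has_integral_restrict_UNIV .
    then have "((\<lambda>x. enn2real (h x)) has_integral (H t - H s)) {s..t}"
      by (subst has_integral_spike_set_eq[where T = "{s<..t}"]) (auto intro: negligible_subset[of "{s}"])
    moreover have "(m has_integral (M t - M s)) {s..t}"
      using M_diff[OF st(2)] cl(3)[of s] cl(3)[of t] st
      by (simp add: integrable_integral integrable_subinterval_real[OF m(1)])
    ultimately have "((\<lambda>x. enn2real (h x) - m x) has_integral (H t - H s - (M t - M s))) {s..t}"
      by (rule has_integral_diff)
    then show "((\<lambda>x. enn2real (h x) - m x) has_integral (g t - g s)) {s..t}"
      using st cl(3) by (simp add: H_def)
  qed
qed

theorem dominated_increments_derivative: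
  fixes g m :: "real \<Rightarrow> real"
  assumes m: "m integrable_on {a..b}" "\<And>x. x \<in> {a..b} \<Longrightarrow> 0 \<le> m x"
    and bd: "\<And>s t. \<lbrakk>a \<le> s; s \<le> t; t \<le> b\<rbrakk> \<Longrightarrow> \<bar>g t - g s\<bar> \<le> integral {s..t} m"
  obtains \<rho> where "\<And>s t. \<lbrakk>a \<le> s; s \<le> t; t \<le> b\<rbrakk> \<Longrightarrow> (\<rho> has_integral (g t - g s)) {s..t}"
    "AE x in lebesgue_on {a<..<b}. (g has_real_derivative \<rho> x) (at x)"
proof (cases "a \<le> b")
  case True
  obtain \<rho> where \<rho>: "\<And>s t. \<lbrakk>a \<le> s; s \<le> t; t \<le> b\<rbrakk> \<Longrightarrow> (\<rho> has_integral (g t - g s)) {s..t}"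
    using dominated_increments_density[OF m True bd] by blast
  have "AE x in lebesgue_on {a<..<b}. ((\<lambda>x. integral {a..x} \<rho>) has_real_derivative \<rho> x) (at x)"
    using \<rho>[of a b] True by (intro lebesgue_differentiation) (auto simp: integrable_on_def)
  moreover have "AE x in lebesgue_on {a<..<b}. x \<in> {a<..<b}"
    by (rule AE_I2) (simp add: space_restrict_space)
  ultimately have "AE x in lebesgue_on {a<..<b}. (g has_real_derivative \<rho> x) (at x)"
  proof eventually_elim
    case (elim x)
    have "((\<lambda>x. g a + integral {a..x} \<rho>) has_real_derivative \<rho> x) (at x)"
      using elim(1) by (auto intro!: derivative_eq_intros)
    then show ?case
    proof (rule has_field_derivative_transform_within_open)
      fix y assume "y \<in> {a<..<b}"
      then show "g a + integral {a..y} \<rho> = g y" using \<rho>[of a y] by (simp add: integral_unique)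
    qed (use elim(2) in auto)
  qed
  with \<rho> show thesis by (rule that)
qed (rule that[of "\<lambda>_. 0"], auto)

section \<open>Null sets of intervals and absolutely continuous curves\<close>

lemma AE_lebesgue_on_iff:
  assumes "S \<in> sets lebesgue"
  shows "(AE x in lebesgue_on S. P x) \<longleftrightarrow> negligible {x \<in> S. \<not> P x}"
proof -
  have "(AE x in lebesgue_on S. P x) \<longleftrightarrow> (AE x in lebesgue. x \<in> S \<longrightarrow> P x)"
    using assms by (intro AE_restrict_space_iff) simp
  also have "\<dots> \<longleftrightarrow> negligible {x \<in> S. \<not> P x}"
  proof
    assume "AE x in lebesgue. x \<in> S \<longrightarrow> P x"
    then obtain N where "N \<in> null_sets lebesgue" "{x \<in> S. \<not> P x} \<subseteq> N"
      unfolding eventually_ae_filter by auto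
    then show "negligible {x \<in> S. \<not> P x}"
      using negligible_iff_null_sets negligible_subset by blast
  next
    assume "negligible {x \<in> S. \<not> P x}"
    then show "AE x in lebesgue. x \<in> S \<longrightarrow> P x"
      unfolding negligible_iff_null_sets by (rule AE_I') auto
  qed
  finally show ?thesis .
qed

lemma AE_lebesgue_on_subset:
  assumes "AE x in lebesgue_on S. P x" "T \<subseteq> S" "S \<in> sets lebesgue" "T \<in> sets lebesgue"
  shows "AE x in lebesgue_on T. P x"
  using assms by (auto simp: AE_lebesgue_on_iff intro: negligible_subset)

lemma AE_lebesgue_on_Ioo_Icc:
  fixes a b :: real
  shows "(AE x in lebesgue_on {a<..<b}. P x) \<longleftrightarrow> (AE x in lebesgue_on {a..b}. P x)"
proof
  assume "AE x in lebesgue_on {a<..<b}. P x"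
  then have "negligible ({x \<in> {a<..<b}. \<not> P x} \<union> {a, b})"
    by (auto simp: AE_lebesgue_on_iff intro: negligible_Un)
  then show "AE x in lebesgue_on {a..b}. P x"
    unfolding AE_lebesgue_on_iff[of "{a..b}", simplified]
    by (rule negligible_subset) (auto simp: order_le_less)
qed (erule AE_lebesgue_on_subset, auto)

lemma AE_lebesgue_on_mem:
  fixes a b :: real
  shows AE_lebesgue_on_Ioo: "AE x in lebesgue_on {a<..<b}. a < x \<and> x < b"
    and AE_lebesgue_on_Icc: "AE x in lebesgue_on {a..b}. a \<le> x \<and> x \<le> b"
  by (rule AE_I2, simp add: space_restrict_space)+

lemma has_integral_cong_AE:
  fixes f g :: "real \<Rightarrow> real"
  assumes "AE x in lebesgue_on {a..b}. f x = g x"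
  shows "(f has_integral I) {a..b} \<longleftrightarrow> (g has_integral I) {a..b}"
  using assms by (intro has_integral_spike_eq[of "{x \<in> {a..b}. f x \<noteq> g x}"]) (auto simp: AE_lebesgue_on_iff)

lemma integral_mono_AE_Icc:
  fixes f g :: "real \<Rightarrow> real"
  assumes f: "f integrable_on {a..b}" and g: "g integrable_on {a..b}"
    and le: "AE x in lebesgue_on {a..b}. f x \<le> g x"
  shows "integral {a..b} f \<le> integral {a..b} g"
proof -
  have "AE x in lebesgue_on {a..b}. g x = max (f x) (g x)"
    using le by eventually_elim auto
  then have "((\<lambda>x. max (f x) (g x)) has_integral (integral {a..b} g)) {a..b}"
    by (rule iffD1[OF has_integral_cong_AE integrable_integral[OF g]])
  with integrable_integral[OF f] show ?thesis
    by (rule has_integral_le) auto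
qed

lemma absolutely_integrable_bound_AE:
  fixes f g :: "real \<Rightarrow> real"
  assumes f: "f \<in> borel_measurable (lebesgue_on {a..b})" and g: "g integrable_on {a..b}"
    and le: "AE x in lebesgue_on {a..b}. \<bar>f x\<bar> \<le> g x"
  shows "f absolutely_integrable_on {a..b}"
proof -
  define N where "N = {x \<in> {a..b}. \<not> \<bar>f x\<bar> \<le> g x}"
  have N: "negligible N" using le unfolding N_def by (simp add: AE_lebesgue_on_iff)
  define f' where "f' x = (if \<bar>f x\<bar> \<le> g x then f x else 0)" for x
  define g' where "g' x = (if \<bar>f x\<bar> \<le> g x then g x else 0)" for x
  have g': "g' integrable_on {a..b}"
    by (rule integrable_spike[OF g N]) (auto simp: g'_def N_def)
  have gm: "g \<in> borel_measurable (lebesgue_on {a..b})" by (rule integrable_imp_measurable[OF g])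
  have "f' absolutely_integrable_on {a..b}"
  proof (rule measurable_bounded_by_integrable_imp_absolutely_integrable[OF _ _ g'])
    show "f' \<in> borel_measurable (lebesgue_on {a..b})"
      unfolding f'_def using f gm by measurable
  qed (auto simp: f'_def g'_def)
  then show ?thesis
    by (rule absolutely_integrable_spike[OF _ N]) (auto simp: f'_def N_def)
qed

lemma integral_eq_0_imp_AE_0:
  fixes f :: "real \<Rightarrow> real"
  assumes f: "f integrable_on {a..b}" "\<And>x. x \<in> {a..b} \<Longrightarrow> 0 \<le> f x" "integral {a..b} f = 0"
  shows "AE x in lebesgue_on {a..b}. f x = 0"
proof -
  have i: "integrable (lebesgue_on {a..b}) f"
    using nonnegative_absolutely_integrable_1[OF f(1,2)] by (simp add: integrable_restrict_space set_integrable_def)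
  have "integral\<^sup>L (lebesgue_on {a..b}) f = 0"
    using lebesgue_integral_eq_integral[OF i] f(3) by simp
  moreover have "AE x in lebesgue_on {a..b}. 0 \<le> f x"
    using f(2) by (intro AE_I2) (simp add: space_restrict_space)
  ultimately show ?thesis using integral_nonneg_eq_0_iff_AE[OF i] by blast
qed

lemma AC_1_obtain:
  assumes "AC 1 {a..b} D u"
  obtains m :: "real \<Rightarrow> real" where "m integrable_on {a..b}" "\<And>t. 0 \<le> m t"
    "\<And>s t. \<lbrakk>a \<le> s; s \<le> t; t \<le> b\<rbrakk> \<Longrightarrow> D (u s) (u t) \<le> ereal (integral {s..t} m)"
proof -
  obtain m :: "real \<Rightarrow> real" where m: "m \<in> borel_measurable (lebesgue_on {a..b})"
      "integrable (lebesgue_on {a..b}) (\<lambda>r. \<bar>m r\<bar> powr 1)"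
    and D: "\<And>s t. s \<in> {a..b} \<Longrightarrow> t \<in> {a..b} \<Longrightarrow> s \<le> t \<Longrightarrow> D (u s) (u t) \<le> ereal (integral\<^sup>L (lebesgue_on {s..t}) m)"
    using assms unfolding AC_def by blast
  have mi: "integrable (lebesgue_on {a..b}) (\<lambda>r. \<bar>m r\<bar>)"
    using m(2) by simp
  then have mabs: "m absolutely_integrable_on {a..b}"
    using m(1) by (subst absolutely_integrable_measurable_real) auto
  have sub: "m absolutely_integrable_on {s..t}" if "a \<le> s" "t \<le> b" for s t
    using that by (intro absolutely_integrable_on_subinterval[OF mabs]) auto
  show thesis
  proof (rule that)
    show "(\<lambda>r. \<bar>m r\<bar>) integrable_on {a..b}"
      using mabs unfolding absolutely_integrable_on_def by simp
    fix s t assume st: "a \<le> s" "s \<le> t" "t \<le> b"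
    have "integral\<^sup>L (lebesgue_on {s..t}) m = integral {s..t} m"
      using sub[OF st(1,3)] by (intro lebesgue_integral_eq_integral) (auto simp: set_integrable_def integrable_restrict_space)
    also have "\<dots> \<le> integral {s..t} (\<lambda>r. \<bar>m r\<bar>)"
      using sub[OF st(1,3)] unfolding absolutely_integrable_on_def by (intro integral_le) auto
    finally show "D (u s) (u t) \<le> ereal (integral {s..t} (\<lambda>r. \<bar>m r\<bar>))"
      using D[of s t] st by (auto elim: order_trans)
  qed simp
qed

lemma AC_1_edist_obtain:
  assumes "AC 1 {a..b} edist u"
  obtains m :: "real \<Rightarrow> real" where "m integrable_on {a..b}" "\<And>t. 0 \<le> m t"
    "\<And>s t. \<lbrakk>a \<le> s; s \<le> t; t \<le> b\<rbrakk> \<Longrightarrow> dist (u s) (u t) \<le> integral {s..t} m"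
  using AC_1_obtain[OF assms] by (metis ereal_less_eq(3))

lemma AC_1_intro:
  fixes m :: "real \<Rightarrow> real"
  assumes m: "m integrable_on {a..b}" "\<And>t. t \<in> {a..b} \<Longrightarrow> 0 \<le> m t"
    and D: "\<And>s t. \<lbrakk>a \<le> s; s \<le> t; t \<le> b\<rbrakk> \<Longrightarrow> D (u s) (u t) \<le> ereal (integral {s..t} m)"
  shows "AC 1 {a..b} D u"
proof -
  have mabs: "m absolutely_integrable_on {s..t}" if "a \<le> s" "t \<le> b" for s t
    using that by (intro nonnegative_absolutely_integrable_1 integrable_subinterval_real[OF m(1)] m(2)) auto
  have "integrable (lebesgue_on {s..t}) m" if "a \<le> s" "t \<le> b" for s t
    using mabs[OF that] by (simp add: set_integrable_def integrable_restrict_space)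
  moreover from this have "integral\<^sup>L (lebesgue_on {s..t}) m = integral {s..t} m" if "a \<le> s" "t \<le> b" for s t
    using that by (intro lebesgue_integral_eq_integral) auto
  ultimately show ?thesis
    unfolding AC_def using D by (intro exI[of _ m]) (auto simp: integrable_abs)
qed

lemma AC_1_subset:
  assumes "AC 1 {a..b} D u" "a \<le> c" "d \<le> b"
  shows "AC 1 {c..d} D u"
proof -
  obtain m :: "real \<Rightarrow> real" where m: "m integrable_on {a..b}" "\<And>t. 0 \<le> m t"
    "\<And>s t. \<lbrakk>a \<le> s; s \<le> t; t \<le> b\<rbrakk> \<Longrightarrow> D (u s) (u t) \<le> ereal (integral {s..t} m)"
    using AC_1_obtain[OF assms(1)] by blast
  show ?thesis
    using assms(2,3) by (intro AC_1_intro[of m] m integrable_subinterval_real[OF m(1)]) auto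
qed

section \<open>The metric derivative\<close>

lemma derivative_abs_quotient:
  fixes g :: "real \<Rightarrow> real"
  assumes "(g has_real_derivative d) (at t)"
  shows "((\<lambda>s. \<bar>g s - g t\<bar> / \<bar>t - s\<bar>) \<longlongrightarrow> \<bar>d\<bar>) (at t)"
  using tendsto_rabs[OF assms[unfolded has_field_derivative_iff]]
  by (simp add: abs_divide abs_minus_commute)

lemma dominated_curve_continuous:
  fixes u :: "real \<Rightarrow> 'a::metric_space" and m :: "real \<Rightarrow> real"
  assumes m: "m integrable_on {a..b}"
    and bd: "\<And>s t. \<lbrakk>a \<le> s; s \<le> t; t \<le> b\<rbrakk> \<Longrightarrow> dist (u s) (u t) \<le> integral {s..t} m"
  shows "continuous_on {a..b} u"
  unfolding continuous_on_iff
proof (intro ballI allI impI)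
  fix x e :: real assume x: "x \<in> {a..b}" and "e > 0"
  define M where "M x = integral {a..x} m" for x
  have M: "M t - M s = integral {s..t} m" if "a \<le> s" "s \<le> t" "t \<le> b" for s t
    unfolding M_def by (rule integral_diff_Icc[OF m that])
  have "continuous_on {a..b} M" unfolding M_def by (rule indefinite_integral_continuous_1[OF m])
  then obtain d where d: "d > 0" "\<And>y. y \<in> {a..b} \<Longrightarrow> dist y x < d \<Longrightarrow> dist (M y) (M x) < e"
    using x \<open>e > 0\<close> unfolding continuous_on_iff by metis
  have "dist (u y) (u x) \<le> dist (M y) (M x)" if "y \<in> {a..b}" for y
    using bd[of x y] bd[of y x] M[of x y] M[of y x] x that
    by (cases "x \<le> y") (auto simp: dist_real_def dist_commute)
  then show "\<exists>d>0. \<forall>y\<in>{a..b}. dist y x < d \<longrightarrow> dist (u y) (u x) < e"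
    using d by (meson le_less_trans)
qed

text \<open>Where the limit that defines \<open>metric_deriv\<close> does not exist, its value is arbitrary and may be negative. The
absolute value is a nonnegative integrand everywhere.\<close>

abbreviation speed :: "(real \<Rightarrow> 'a::metric_space) \<Rightarrow> real \<Rightarrow> real" where
  "speed u t \<equiv> \<bar>metric_deriv u t\<bar>"

abbreviation has_metric_deriv :: "(real \<Rightarrow> 'a::metric_space) \<Rightarrow> real \<Rightarrow> real \<Rightarrow> bool" where
  "has_metric_deriv u D t \<equiv> ((\<lambda>s. dist (u s) (u t) / \<bar>t - s\<bar>) \<longlongrightarrow> D) (at t)"

text \<open>The metric derivative is the supremum over a countable dense set of times \<open>q\<close> of the moduli of the
derivatives \<open>\<rho> q\<close> of \<open>\<lambda>t. dist (u t) (u q)\<close>. It is at least each of them by the triangle inequality, and by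
density the integral of the supremum bounds the distances. Truncating at \<open>m\<close>, which changes the \<open>\<rho> q\<close>
only on a null set, makes the supremum finite everywhere.\<close>

theorem metric_derivative_dominated:
  fixes u :: "real \<Rightarrow> 'a::metric_space" and m :: "real \<Rightarrow> real"
  assumes ab: "a < b" and m: "m integrable_on {a..b}" "\<And>t. 0 \<le> m t"
    and bd: "\<And>s t. \<lbrakk>a \<le> s; s \<le> t; t \<le> b\<rbrakk> \<Longrightarrow> dist (u s) (u t) \<le> integral {s..t} m"
  obtains M where "M integrable_on {a..b}" "\<And>t. t \<in> {a..b} \<Longrightarrow> 0 \<le> M t \<and> M t \<le> m t"
    "\<And>s t. \<lbrakk>a \<le> s; s \<le> t; t \<le> b\<rbrakk> \<Longrightarrow> dist (u s) (u t) \<le> integral {s..t} M"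
    "AE t in lebesgue_on {a<..<b}. has_metric_deriv u (M t) t"
proof -
  have contu: "continuous_on {a..b} u"
    by (rule dominated_curve_continuous[OF m(1) bd])
  define Q where "Q = \<rat> \<inter> {a..b}"
  have Q: "countable Q" "Q \<noteq> {}"
  proof -
    show "countable Q" unfolding Q_def using countable_rat by (rule countable_Int1)
    obtain q where "q \<in> \<rat>" "a < q" "q < b" using Rats_dense_in_real[OF ab] by blast
    then show "Q \<noteq> {}" unfolding Q_def by force
  qed
  define g where "g q t = dist (u t) (u q)" for q t
  define P where "P q r \<longleftrightarrow> (\<forall>s t. a \<le> s \<longrightarrow> s \<le> t \<longrightarrow> t \<le> b \<longrightarrow> (r has_integral (g q t - g q s)) {s..t}) \<and>
     (AE x in lebesgue_on {a<..<b}. (g q has_real_derivative r x) (at x))" for q r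
  have "\<exists>r. P q r" for q
  proof -
    have "\<bar>g q t - g q s\<bar> \<le> integral {s..t} m" if "a \<le> s" "s \<le> t" "t \<le> b" for s t
    proof -
      have "\<bar>g q t - g q s\<bar> \<le> dist (u s) (u t)"
        unfolding g_def using abs_dist_diff_le[of "u t" "u q" "u s"] by (simp add: dist_commute)
      with bd[OF that] show ?thesis by simp
    qed
    from dominated_increments_derivative[OF m(1) _ this] m(2)
    obtain r where "\<And>s t. \<lbrakk>a \<le> s; s \<le> t; t \<le> b\<rbrakk> \<Longrightarrow> (r has_integral (g q t - g q s)) {s..t}"
      "AE x in lebesgue_on {a<..<b}. (g q has_real_derivative r x) (at x)"
      by blast
    then show ?thesis by (intro exI[of _ r]) (simp add: P_def)
  qed
  then obtain \<rho> where "\<And>q. P q (\<rho> q)" by metis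
  then have \<rho>: "\<And>q s t. \<lbrakk>a \<le> s; s \<le> t; t \<le> b\<rbrakk> \<Longrightarrow> (\<rho> q has_integral (g q t - g q s)) {s..t}"
    and \<rho>': "\<And>q. AE x in lebesgue_on {a<..<b}. (g q has_real_derivative \<rho> q x) (at x)"
    unfolding P_def by blast+
  have "AE x in lebesgue_on {a<..<b}. \<bar>\<rho> q x\<bar> \<le> m x" for q
    using \<rho>'[of q] lebesgue_differentiation[OF m(1)] AE_lebesgue_on_Ioo[of a b]
  proof eventually_elim
    case (elim x)
    have "eventually (\<lambda>s. \<bar>g q s - g q x\<bar> / \<bar>x - s\<bar> \<le> \<bar>integral {a..s} m - integral {a..x} m\<bar> / \<bar>x - s\<bar>) (at x)"
    proof -
      have "eventually (\<lambda>s. s \<in> {a<..<b}) (at x)"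
        using elim(3) by (intro eventually_at_in_open') auto
      then show ?thesis
      proof eventually_elim
        case (elim s)
        have "\<bar>g q s - g q x\<bar> \<le> dist (u x) (u s)"
          unfolding g_def using abs_dist_diff_le[of "u s" "u q" "u x"] by (simp add: dist_commute)
        also have "\<dots> \<le> \<bar>integral {a..s} m - integral {a..x} m\<bar>"
          using bd[of x s] bd[of s x] \<open>a < x \<and> x < b\<close> elim
            integral_diff_Icc[OF m(1), of s x] integral_diff_Icc[OF m(1), of x s]
          by (cases "x \<le> s") (auto simp: dist_commute)
        finally show ?case by (rule divide_right_mono) simp
      qed
    qed
    then have "\<bar>\<rho> q x\<bar> \<le> \<bar>m x\<bar>"
      using derivative_abs_quotient[OF elim(1)] derivative_abs_quotient[OF elim(2)]
      by (intro tendsto_le[OF _ _ _]) auto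
    then show ?case using m(2)[of x] by simp
  qed
  then have \<rho>m: "AE x in lebesgue_on {a<..<b}. \<forall>q\<in>Q. \<bar>\<rho> q x\<bar> \<le> m x"
    using Q(1) by (simp add: AE_ball_countable)
  define M where "M t = (SUP q\<in>Q. min \<bar>\<rho> q t\<bar> (m t))" for t
  have bdd: "bdd_above ((\<lambda>q. min \<bar>\<rho> q t\<bar> (m t)) ` Q)" for t
    by (rule bdd_aboveI[of _ "m t"]) auto
  have M_upper: "min \<bar>\<rho> q t\<bar> (m t) \<le> M t" if "q \<in> Q" for q t
    unfolding M_def by (rule cSUP_upper[OF that bdd])
  have M_le: "M t \<le> m t" for t unfolding M_def by (rule cSUP_least[OF Q(2)]) simp
  have M_nonneg: "0 \<le> M t" for t
    using Q(2) M_upper[of _ t] m(2)[of t] by (metis abs_ge_zero ex_in_conv min.bounded_iff order_trans)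
  have \<rho>int: "\<rho> q integrable_on {a..b}" for q
    using \<rho>[of a b q] ab by (auto simp: integrable_on_def)
  have Mint: "M integrable_on {a..b}"
  proof (rule measurable_bounded_by_integrable_imp_integrable[OF _ m(1)])
    show "M \<in> borel_measurable (lebesgue_on {a..b})"
      unfolding M_def using integrable_imp_measurable[OF \<rho>int] integrable_imp_measurable[OF m(1)] bdd Q(1)
      by (intro borel_measurable_cSUP borel_measurable_min borel_measurable_abs) auto
  qed (use M_le M_nonneg in auto)
  have Msub: "M integrable_on {s..t}" if "a \<le> s" "t \<le> b" for s t
    using that by (intro integrable_subinterval_real[OF Mint]) auto
  have g_le: "\<bar>g q t - g q s\<bar> \<le> integral {s..t} M" if "a \<le> s" "s \<le> t" "t \<le> b" "q \<in> Q" for q s t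
  proof -
    have "AE x in lebesgue_on {s..t}. \<bar>\<rho> q x\<bar> \<le> M x"
      using AE_lebesgue_on_subset[OF \<rho>m[unfolded AE_lebesgue_on_Ioo_Icc], where T = "{s..t}"] that
      by (auto elim!: eventually_mono) (metis M_upper min.absorb1)
    then have le: "AE x in lebesgue_on {s..t}. \<rho> q x \<le> M x" "AE x in lebesgue_on {s..t}. - \<rho> q x \<le> M x"
      by (auto elim!: eventually_mono)
    have I: "(\<rho> q has_integral (g q t - g q s)) {s..t}" by (rule \<rho>[OF that(1-3)])
    show ?thesis
      using integral_mono_AE_Icc[OF _ Msub le(1)] integral_mono_AE_Icc[OF _ Msub le(2)] I has_integral_neg[OF I] that
      by (auto simp: integral_unique integrable_on_def abs_le_iff)
  qed
  have dist_le: "dist (u s) (u t) \<le> integral {s..t} M" if st: "a \<le> s" "s \<le> t" "t \<le> b" for s t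
  proof (rule field_le_epsilon)
    fix e :: real assume e: "0 < e"
    obtain d where d: "d > 0" "\<And>y. y \<in> {a..b} \<Longrightarrow> dist y s < d \<Longrightarrow> dist (u y) (u s) < e / 2"
      using contu st e unfolding continuous_on_iff by (metis atLeastAtMost_iff half_gt_zero order_trans)
    have "max a (s - d) < min b (s + d)" using d(1) st ab by auto
    then obtain q where q: "q \<in> \<rat>" "max a (s - d) < q" "q < min b (s + d)"
      using Rats_dense_in_real by blast
    then have "q \<in> Q" "dist (u q) (u s) < e / 2"
      using d(2)[of q] by (auto simp: Q_def dist_real_def abs_less_iff)
    moreover have "dist (u s) (u t) \<le> \<bar>g q t - g q s\<bar> + 2 * dist (u q) (u s)"
      unfolding g_def using dist_triangle[of "u s" "u t" "u q"] by (simp add: dist_commute)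
    ultimately show "dist (u s) (u t) \<le> integral {s..t} M + e"
      using g_le[OF st \<open>q \<in> Q\<close>] by linarith
  qed
  have "AE x in lebesgue_on {a<..<b}. \<forall>q\<in>Q. (g q has_real_derivative \<rho> q x) (at x)"
    using Q(1) \<rho>' by (simp add: AE_ball_countable)
  then have lim: "AE t in lebesgue_on {a<..<b}. has_metric_deriv u (M t) t"
    using \<rho>m lebesgue_differentiation[OF Mint] AE_lebesgue_on_Ioo[of a b]
  proof eventually_elim
    case (elim t)
    have ev: "eventually (\<lambda>s. s \<in> {a<..<b} \<and> s \<noteq> t) (at t)"
      using elim(4) eventually_at_in_open[of "{a<..<b}" t] by (auto elim: eventually_mono)
    have upper: "eventually (\<lambda>s. dist (u s) (u t) / \<bar>t - s\<bar> \<le> \<bar>integral {a..s} M - integral {a..t} M\<bar> / \<bar>t - s\<bar>) (at t)"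
      using ev
    proof eventually_elim
      case (elim s)
      have "dist (u s) (u t) \<le> \<bar>integral {a..s} M - integral {a..t} M\<bar>"
        using dist_le[of t s] dist_le[of s t] \<open>a < t \<and> t < b\<close> elim
          integral_diff_Icc[OF Mint, of s t] integral_diff_Icc[OF Mint, of t s]
        by (cases "t \<le> s") (auto simp: dist_commute)
      then show ?case by (rule divide_right_mono) simp
    qed
    have lim_up: "((\<lambda>s. \<bar>integral {a..s} M - integral {a..t} M\<bar> / \<bar>t - s\<bar>) \<longlongrightarrow> M t) (at t)"
      using derivative_abs_quotient[OF elim(3)] M_nonneg[of t] by simp
    show ?case
    proof (rule order_tendstoI)
      fix y assume "y < M t"
      then obtain q where q: "q \<in> Q" "y < min \<bar>\<rho> q t\<bar> (m t)"
        unfolding M_def using less_cSUP_iff[OF Q(2) bdd] by blast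
      then have "((\<lambda>s. \<bar>g q s - g q t\<bar> / \<bar>t - s\<bar>) \<longlongrightarrow> \<bar>\<rho> q t\<bar>) (at t)"
        using elim(1) derivative_abs_quotient by blast
      then have "eventually (\<lambda>s. y < \<bar>g q s - g q t\<bar> / \<bar>t - s\<bar>) (at t)"
        using q(2) by (auto dest: order_tendstoD(1))
      then show "eventually (\<lambda>s. y < dist (u s) (u t) / \<bar>t - s\<bar>) (at t)"
      proof eventually_elim
        case (elim s)
        have "\<bar>g q s - g q t\<bar> \<le> dist (u s) (u t)"
          unfolding g_def using abs_dist_diff_le[of "u s" "u q" "u t"] by (simp add: dist_commute)
        then have "\<bar>g q s - g q t\<bar> / \<bar>t - s\<bar> \<le> dist (u s) (u t) / \<bar>t - s\<bar>"
          by (rule divide_right_mono) simp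
        with elim show ?case by simp
      qed
    next
      fix y assume "M t < y"
      from order_tendstoD(2)[OF lim_up this] upper
      show "eventually (\<lambda>s. dist (u s) (u t) / \<bar>t - s\<bar> < y) (at t)"
        by eventually_elim simp
    qed
  qed
  show thesis by (rule that[OF Mint _ dist_le lim]) (use M_nonneg M_le in auto)
qed

lemma metric_deriv_dominated:
  fixes u :: "real \<Rightarrow> 'a::metric_space" and m :: "real \<Rightarrow> real"
  assumes m: "m integrable_on {a..b}" "\<And>t. 0 \<le> m t"
    and bd: "\<And>s t. \<lbrakk>a \<le> s; s \<le> t; t \<le> b\<rbrakk> \<Longrightarrow> dist (u s) (u t) \<le> integral {s..t} m"
  shows "AE t in lebesgue_on {a..b}. has_metric_deriv u (metric_deriv u t) t \<and>
           0 \<le> metric_deriv u t \<and> metric_deriv u t \<le> m t" (is "AE t in _. ?P t")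
    and "speed u integrable_on {a..b}"
    and "\<And>s t. \<lbrakk>a \<le> s; s \<le> t; t \<le> b\<rbrakk> \<Longrightarrow> dist (u s) (u t) \<le> integral {s..t} (speed u)"
proof -
  have "(AE t in lebesgue_on {a..b}. ?P t) \<and> speed u integrable_on {a..b} \<and>
    (\<forall>s t. a \<le> s \<longrightarrow> s \<le> t \<longrightarrow> t \<le> b \<longrightarrow> dist (u s) (u t) \<le> integral {s..t} (speed u))"
  proof (cases "a < b")
    case True
    obtain M where M: "M integrable_on {a..b}" "\<And>t. t \<in> {a..b} \<Longrightarrow> 0 \<le> M t \<and> M t \<le> m t"
      "\<And>s t. \<lbrakk>a \<le> s; s \<le> t; t \<le> b\<rbrakk> \<Longrightarrow> dist (u s) (u t) \<le> integral {s..t} M"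
      "AE t in lebesgue_on {a<..<b}. has_metric_deriv u (M t) t"
      using metric_derivative_dominated[OF True m bd] by blast
    have ae: "AE t in lebesgue_on {a..b}. has_metric_deriv u (M t) t \<and> metric_deriv u t = M t \<and> t \<in> {a..b}"
      using M(4)[unfolded AE_lebesgue_on_Ioo_Icc] AE_lebesgue_on_Icc[of a b]
      by eventually_elim (auto simp: metric_deriv_def intro!: tendsto_Lim)
    have eq: "AE t in lebesgue_on {a..b}. M t = speed u t"
      by (rule eventually_mono[OF ae]) (use M(2) in auto)
    have "(speed u has_integral (integral {s..t} M)) {s..t}" if st: "a \<le> s" "t \<le> b" for s t
    proof -
      have "AE r in lebesgue_on {s..t}. M r = speed u r"
        using st by (intro AE_lebesgue_on_subset[OF eq]) auto
      then show ?thesis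
        using has_integral_cong_AE integrable_integral[OF integrable_subinterval_real[OF M(1), of s t]] st by auto
    qed
    then have "speed u integrable_on {a..b}"
      and I: "\<And>s t. a \<le> s \<Longrightarrow> t \<le> b \<Longrightarrow> integral {s..t} (speed u) = integral {s..t} M"
      by (auto simp: integral_unique)
    moreover have "AE t in lebesgue_on {a..b}. ?P t"
      by (rule eventually_mono[OF ae]) (use M(2) in auto)
    ultimately show ?thesis using M(3) by simp
  next
    case False
    then have "{a..b} \<subseteq> {a}" by auto
    then have "negligible {a..b}" by (rule negligible_subset[rotated]) simp
    then have "AE t in lebesgue_on {a..b}. ?P t" by (auto simp: AE_lebesgue_on_iff elim: negligible_subset)
    moreover have "speed u integrable_on {a..b}"
      using False integrable_on_refl[of "speed u" b] by (cases "a = b") (auto simp: integrable_on_empty)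
    moreover have "dist (u s) (u t) \<le> integral {s..t} (speed u)" if "a \<le> s" "s \<le> t" "t \<le> b" for s t
    proof -
      have "s = t" using False that by simp
      then show ?thesis by simp
    qed
    ultimately show ?thesis by blast
  qed
  then show "AE t in lebesgue_on {a..b}. ?P t" "speed u integrable_on {a..b}"
    "\<And>s t. \<lbrakk>a \<le> s; s \<le> t; t \<le> b\<rbrakk> \<Longrightarrow> dist (u s) (u t) \<le> integral {s..t} (speed u)" by blast+
qed

theorem AC_metric_deriv:
  fixes u :: "real \<Rightarrow> 'a::metric_space"
  assumes "AC 1 {a..b} edist u"
  shows AC_continuous: "continuous_on {a..b} u"
    and AC_metric_deriv_tendsto: "AE t in lebesgue_on {a..b}. has_metric_deriv u (metric_deriv u t) t"
    and AC_metric_deriv_nonneg: "AE t in lebesgue_on {a..b}. 0 \<le> metric_deriv u t"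
    and AC_speed_integrable: "speed u integrable_on {a..b}"
    and AC_dist_le_integral_speed: "\<And>s t. \<lbrakk>a \<le> s; s \<le> t; t \<le> b\<rbrakk> \<Longrightarrow> dist (u s) (u t) \<le> integral {s..t} (speed u)"
proof -
  obtain m :: "real \<Rightarrow> real" where m: "m integrable_on {a..b}" "\<And>t. 0 \<le> m t"
    "\<And>s t. \<lbrakk>a \<le> s; s \<le> t; t \<le> b\<rbrakk> \<Longrightarrow> dist (u s) (u t) \<le> integral {s..t} m"
    using AC_1_edist_obtain[OF assms] by blast
  show "continuous_on {a..b} u"
    by (rule dominated_curve_continuous[OF m(1,3)])
  have ae: "AE t in lebesgue_on {a..b}. has_metric_deriv u (metric_deriv u t) t \<and>
      0 \<le> metric_deriv u t \<and> metric_deriv u t \<le> m t"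
    by (rule metric_deriv_dominated(1)) (fact m)+
  from ae show "AE t in lebesgue_on {a..b}. has_metric_deriv u (metric_deriv u t) t"
    by eventually_elim (elim conjE)
  from ae show "AE t in lebesgue_on {a..b}. 0 \<le> metric_deriv u t"
    by eventually_elim (elim conjE)
  show "speed u integrable_on {a..b}"
    by (rule metric_deriv_dominated(2)) (fact m)+
  show "dist (u s) (u t) \<le> integral {s..t} (speed u)" if "a \<le> s" "s \<le> t" "t \<le> b" for s t
    using that by (rule metric_deriv_dominated(3)[rotated 3]) (fact m)+
qed

lemma AC_speed_le:
  fixes u :: "real \<Rightarrow> 'a::metric_space" and m :: "real \<Rightarrow> real"
  assumes m: "m integrable_on {a..b}" "\<And>t. 0 \<le> m t"
    and bd: "\<And>s t. \<lbrakk>a \<le> s; s \<le> t; t \<le> b\<rbrakk> \<Longrightarrow> dist (u s) (u t) \<le> integral {s..t} m"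
  shows "AE t in lebesgue_on {a..b}. speed u t \<le> m t"
proof -
  have "AE t in lebesgue_on {a..b}. has_metric_deriv u (metric_deriv u t) t \<and>
      0 \<le> metric_deriv u t \<and> metric_deriv u t \<le> m t"
    by (rule metric_deriv_dominated(1)) (fact m bd)+
  then show ?thesis by eventually_elim simp
qed

section \<open>Integrals of extended real functions\<close>

lemma nn_integral_mono_ext:
  "(AE x in M. f x \<le> g x) \<Longrightarrow> (\<integral>\<^sup>+x. e2ennreal (f x) \<partial>M) \<le> (\<integral>\<^sup>+x. e2ennreal (g x) \<partial>M)"
  by (rule nn_integral_mono_AE) (auto elim!: eventually_mono intro: e2ennreal_mono)

lemma ext_integral_mono:
  assumes "AE x in M. f x \<le> g x"
  shows "ext_integral M f \<le> ext_integral M g"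
proof -
  have neg: "AE x in M. - g x \<le> - f x" using assms by eventually_elim simp
  show ?thesis
    unfolding ext_integral_def using nn_integral_mono_ext[OF assms] nn_integral_mono_ext[OF neg]
    by (intro ereal_minus_mono) (simp_all add: less_eq_ennreal.rep_eq[symmetric])
qed

lemma ext_integral_ereal:
  assumes "integrable M h"
  shows "ext_integral M (\<lambda>x. ereal (h x)) = ereal (integral\<^sup>L M h)"
proof -
  have eq: "e2ennreal (ereal y) = ennreal y" for y by (simp add: ennreal.abs_eq e2ennreal_def ennreal_def)
  obtain r q where rq: "0 \<le> r" "0 \<le> q" "(\<integral>\<^sup>+x. ennreal (h x) \<partial>M) = ennreal r" "(\<integral>\<^sup>+x. ennreal (- h x) \<partial>M) = ennreal q"
    "integral\<^sup>L M h = r - q"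
    using integrableE[OF assms] by metis
  then show ?thesis
    unfolding ext_integral_def by (simp add: eq)
qed

text \<open>An integrable minorant bounds the negative part, so an integral below \<open>\<infinity>\<close> leaves the positive part
finite as well, and the integral is an ordinary one.\<close>

lemma ext_integral_finite:
  assumes h: "integrable M h" and hf: "AE x in M. ereal (h x) \<le> f x"
    and f: "f \<in> borel_measurable M" and fin: "ext_integral M f < \<infinity>"
  shows "AE x in M. f x = ereal (real_of_ereal (f x))"
    and "integrable M (\<lambda>x. real_of_ereal (f x))"
    and "ext_integral M f = ereal (\<integral>x. real_of_ereal (f x) \<partial>M)"
proof -
  have eq: "e2ennreal (ereal y) = ennreal y" for y by (simp add: ennreal.abs_eq e2ennreal_def ennreal_def)
  have "AE x in M. - f x \<le> ereal (- h x)"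
    using hf by eventually_elim (metis ereal_minus_le_minus uminus_ereal.simps(1))
  then have "(\<integral>\<^sup>+x. e2ennreal (- f x) \<partial>M) \<le> (\<integral>\<^sup>+x. ennreal (- h x) \<partial>M)"
    using nn_integral_mono_ext[of "\<lambda>x. - f x" "\<lambda>x. ereal (- h x)" M] by (simp add: eq)
  also have "\<dots> < \<infinity>"
    using integrable_minus[OF h] by (simp add: real_integrable_def less_top[symmetric])
  finally have neg: "(\<integral>\<^sup>+x. e2ennreal (- f x) \<partial>M) < \<infinity>" .
  then obtain q where q: "(\<integral>\<^sup>+x. e2ennreal (- f x) \<partial>M) = ennreal q" "0 \<le> q"
    by (cases "\<integral>\<^sup>+x. e2ennreal (- f x) \<partial>M") auto
  have pos: "(\<integral>\<^sup>+x. e2ennreal (f x) \<partial>M) \<noteq> \<infinity>"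
    using fin unfolding ext_integral_def q by auto
  have "AE x in M. e2ennreal (f x) \<noteq> \<infinity>"
    using f pos by (intro nn_integral_PInf_AE) auto
  with hf show ae: "AE x in M. f x = ereal (real_of_ereal (f x))"
  proof eventually_elim
    case (elim x)
    then show ?case by (cases "f x") simp_all
  qed
  have 1: "AE x in M. e2ennreal (f x) = ennreal (real_of_ereal (f x))"
    "AE x in M. e2ennreal (- f x) = ennreal (- real_of_ereal (f x))"
    using ae by (eventually_elim, metis eq uminus_ereal.simps(1))+
  show int: "integrable M (\<lambda>x. real_of_ereal (f x))"
    unfolding real_integrable_def using f neg pos nn_integral_cong_AE[OF 1(1)] nn_integral_cong_AE[OF 1(2)] by auto
  have "ext_integral M f = ext_integral M (\<lambda>x. ereal (real_of_ereal (f x)))"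
    unfolding ext_integral_def eq uminus_ereal.simps nn_integral_cong_AE[OF 1(1)] nn_integral_cong_AE[OF 1(2)] ..
  then show "ext_integral M f = ereal (\<integral>x. real_of_ereal (f x) \<partial>M)"
    by (simp add: ext_integral_ereal[OF int])
qed

section \<open>Reversal of curves\<close>

lemma metric_deriv_reverse: "metric_deriv (\<lambda>r. u (- r)) t = metric_deriv u (- t)"
proof -
  have "((\<lambda>s. dist (u (- s)) (u (- t)) / \<bar>t - s\<bar>) \<longlongrightarrow> l) (at t) \<longleftrightarrow>
        ((\<lambda>s. dist (u s) (u (- t)) / \<bar>- t - s\<bar>) \<longlongrightarrow> l) (at (- t))" for l
  proof -
    have "((\<lambda>s. dist (u s) (u (- t)) / \<bar>- t - s\<bar>) \<longlongrightarrow> l) (at (- t)) \<longleftrightarrow>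
      ((\<lambda>s. dist (u (- s)) (u (- t)) / \<bar>- t - - s\<bar>) \<longlongrightarrow> l) (at t)"
      unfolding filtermap_at_minus[symmetric] filterlim_filtermap ..
    also have "(\<lambda>s. dist (u (- s)) (u (- t)) / \<bar>- t - - s\<bar>) = (\<lambda>s. dist (u (- s)) (u (- t)) / \<bar>t - s\<bar>)"
      by (intro ext) (simp add: abs_minus_commute)
    finally show ?thesis ..
  qed
  then show ?thesis unfolding metric_deriv_def Topological_Spaces.Lim_def by simp
qed

lemma AC_1_reverse:
  assumes "AC 1 {a..b} edist u"
  shows "AC 1 {-b..-a} edist (\<lambda>r. u (- r))"
proof -
  obtain m :: "real \<Rightarrow> real" where m: "m integrable_on {a..b}" "\<And>t. 0 \<le> m t"
    "\<And>s t. \<lbrakk>a \<le> s; s \<le> t; t \<le> b\<rbrakk> \<Longrightarrow> dist (u s) (u t) \<le> integral {s..t} m"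
    using AC_1_edist_obtain[OF assms] by blast
  show ?thesis
  proof (rule AC_1_intro)
    show "(\<lambda>r. m (- r)) integrable_on {-b..-a}" using m(1) by simp
    fix s t assume "- b \<le> s" "s \<le> t" "t \<le> - a"
    then show "edist (u (- s)) (u (- t)) \<le> ereal (integral {s..t} (\<lambda>r. m (- r)))"
      using m(3)[of "-t" "-s"] Henstock_Kurzweil_Integration.integral_reflect_real[of "-s" "-t" m] by (simp add: dist_commute)
  qed (use m(2) in auto)
qed

lemma AE_lebesgue_on_reverse:
  fixes a b :: real
  assumes "AE t in lebesgue_on {a..b}. P t"
  shows "AE t in lebesgue_on {-b..-a}. P (- t)"
proof -
  have "negligible {t \<in> {a..b}. \<not> P t}" using assms by (simp add: AE_lebesgue_on_iff)
  then have "negligible (uminus ` {t \<in> {a..b}. \<not> P t})"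
    by (rule negligible_differentiable_image_negligible[rotated])
      (auto intro!: derivative_intros)
  moreover have "{t \<in> {-b..-a}. \<not> P (- t)} \<subseteq> uminus ` {t \<in> {a..b}. \<not> P t}"
  proof
    fix t assume "t \<in> {t \<in> {-b..-a}. \<not> P (- t)}"
    then show "t \<in> uminus ` {t \<in> {a..b}. \<not> P t}"
      by (intro image_eqI[of _ _ "- t"]) auto
  qed
  ultimately have "negligible {t \<in> {-b..-a}. \<not> P (- t)}"
    by (rule negligible_subset)
  then show ?thesis by (simp add: AE_lebesgue_on_iff)
qed

section \<open>Lower semicontinuity\<close>

text \<open>By the second compatibility axiom every \<open>\<sigma>\<close>-open set is open for the metric.\<close>

lemma compatible_limitin:
  assumes "compatible \<sigma>" "xs \<longlonglongrightarrow> x"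
  shows "limitin \<sigma> xs x sequentially"
  unfolding limitin_def
proof (intro conjI allI impI)
  show "x \<in> topspace \<sigma>" using assms(1) unfolding compatible_def by simp
  fix U assume "openin \<sigma> U \<and> x \<in> U"
  then obtain V \<delta> where V: "x \<in> V" "\<delta> > 0" "\<And>y. infdist y V < \<delta> \<Longrightarrow> y \<in> U"
    using assms(1) unfolding compatible_def by metis
  have "eventually (\<lambda>n. dist (xs n) x < \<delta>) sequentially"
    using tendstoD[OF assms(2) V(2)] .
  then show "eventually (\<lambda>n. xs n \<in> U) sequentially"
    by eventually_elim (use V infdist_le le_less_trans in metis)
qed

lemma convergent_bounded_seq:
  assumes "xs \<longlonglongrightarrow> x"
  shows "bounded_seq xs"
proof -
  have "bounded (range xs)" using assms by (rule convergent_imp_bounded)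
  then obtain e where "\<And>n m. dist (xs n) (xs m) \<le> e" unfolding bounded_two_points by blast
  then have "(SUP n. SUP m. edist (xs n) (xs m)) \<le> ereal e"
    by (intro SUP_least) simp
  then show ?thesis unfolding bounded_seq_def by (auto intro: le_less_trans)
qed

lemma LSCC_closed_sublevel:
  assumes "compatible \<sigma>" "LSCC \<sigma> \<phi> o\<^sub>0 A B"
  shows "closed {x. \<phi> x \<le> c}"
  unfolding closed_sequential_limits
proof (intro allI impI, elim conjE)
  fix xs x assume xs: "\<forall>n. xs n \<in> {x. \<phi> x \<le> c}" "xs \<longlonglongrightarrow> x"
  then have "\<phi> x \<le> liminf (\<lambda>n. \<phi> (xs n))"
    using assms compatible_limitin convergent_bounded_seq unfolding LSCC_def by metis
  also have "\<dots> \<le> c"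
    using xs(1) by (intro Liminf_le) auto
  finally show "x \<in> {x. \<phi> x \<le> c}" by simp
qed

lemma closed_sublevel_compose:
  fixes u :: "real \<Rightarrow> 'a::metric_space" and \<phi> :: "'a \<Rightarrow> ereal"
  assumes "\<And>c. closed {x. \<phi> x \<le> c}" "continuous_on S u" "closed S"
  shows "closed {t \<in> S. \<phi> (u t) \<le> c}"
  using continuous_closed_preimage[OF assms(2,3) assms(1)[of c]] by (simp add: vimage_def Int_def)

lemma lsc_curve_measurable:
  fixes u :: "real \<Rightarrow> 'a::metric_space" and \<phi> :: "'a \<Rightarrow> ereal"
  assumes "\<And>c. closed {x. \<phi> x \<le> c}" "continuous_on S u" "closed S"
  shows "(\<lambda>t. \<phi> (u t)) \<in> borel_measurable (lebesgue_on S)"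
proof (rule borel_measurableI_le)
  fix c
  have "{t \<in> S. \<phi> (u t) \<le> c} \<in> sets borel"
    by (rule borel_closed[OF closed_sublevel_compose[OF assms]])
  then have "{t \<in> S. \<phi> (u t) \<le> c} \<in> sets lebesgue" by simp
  then have "{t \<in> S. \<phi> (u t) \<le> c} \<in> sets (lebesgue_on S)"
    using assms(3) by (auto simp: sets_restrict_space_iff)
  then show "{t \<in> space (lebesgue_on S). \<phi> (u t) \<le> c} \<in> sets (lebesgue_on S)"
    by (simp add: space_restrict_space)
qed

section \<open>The exponential weight and a Hardy inequality\<close>

definition wt :: "real \<Rightarrow> real \<Rightarrow> real" where
  "wt \<epsilon> t = exp (- t / \<epsilon>) / \<epsilon>"

lemma wt_pos: "\<epsilon> > 0 \<Longrightarrow> 0 < wt \<epsilon> t"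
  by (simp add: wt_def)

lemma wt_le: "\<epsilon> > 0 \<Longrightarrow> 0 \<le> t \<Longrightarrow> wt \<epsilon> t \<le> 1 / \<epsilon>"
  by (auto simp: wt_def intro!: divide_right_mono)

lemma wt_continuous: "continuous_on S (wt \<epsilon>)"
  by (cases "\<epsilon> = 0") (auto simp: wt_def[abs_def] intro!: continuous_intros)

lemma wt_measurable: "wt \<epsilon> \<in> borel_measurable (lebesgue_on S)"
  by (intro measurable_restrict_space1 measurable_completion)
    (simp add: borel_measurable_continuous_onI wt_continuous)

lemma wt_shift: "wt \<epsilon> (s + t) = exp (- s / \<epsilon>) * wt \<epsilon> t"
  by (simp add: wt_def exp_add[symmetric] diff_divide_distrib)

lemma exp_measure_eq: "exp_measure \<epsilon> = density (lebesgue_on {0<..}) (\<lambda>t. ennreal (wt \<epsilon> t))"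
  by (simp add: exp_measure_def wt_def)

lemma abs_dist_diff: "\<bar>dist a x - dist b x\<bar> \<le> dist a (b::'a::metric_space)"
  by (metis abs_dist_diff_le dist_commute)

lemma wt_integrable:
  assumes "\<epsilon> > 0"
  shows "(wt \<epsilon> has_integral 1) {0..}"
proof -
  have "((\<lambda>t. exp (- (1 / \<epsilon>) * t)) has_integral exp (- (1 / \<epsilon>) * 0) / (1 / \<epsilon>)) {0..}"
    using assms by (intro has_integral_exp_minus_to_infinity) simp
  then have "((\<lambda>t. exp (- (1 / \<epsilon>) * t)) has_integral \<epsilon>) {0..}" by simp
  from has_integral_mult_right[OF this, of "1 / \<epsilon>"] assms show ?thesis
    by (simp add: wt_def[abs_def])
qed

lemma absolutely_integrable_Ioi_Ici:
  "(f :: real \<Rightarrow> real) absolutely_integrable_on {0<..} \<longleftrightarrow> f absolutely_integrable_on {0..}"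
  "integral {0<..} f = integral {0..} (f :: real \<Rightarrow> real)"
proof -
  have neg: "negligible {x \<in> {0<..} - {0..}. f x \<noteq> 0}" "negligible {x \<in> {0..} - {0<..}. f x \<noteq> 0}"
    by (rule negligible_subset[of "{0::real}"], simp, force)+
  show "f absolutely_integrable_on {0<..} \<longleftrightarrow> f absolutely_integrable_on {0..}"
    by (rule absolutely_integrable_spike_set_eq[OF neg])
  show "integral {0<..} f = integral {0..} f"
    by (rule integral_spike_set[OF neg])
qed

lemma exp_measure_integrable_iff:
  assumes \<epsilon>: "\<epsilon> > 0" and f: "f \<in> borel_measurable (lebesgue_on {0..})"
  shows "integrable (exp_measure \<epsilon>) f \<longleftrightarrow> (\<lambda>t. wt \<epsilon> t * f t) absolutely_integrable_on {0..}"
    and "(\<lambda>t. wt \<epsilon> t * f t) absolutely_integrable_on {0..} \<Longrightarrow>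
      integral\<^sup>L (exp_measure \<epsilon>) f = integral {0..} (\<lambda>t. wt \<epsilon> t * f t)"
proof -
  have fm: "f \<in> borel_measurable (lebesgue_on {0<..})"
    using f by (rule measurable_restrict_mono) auto
  note wm = wt_measurable[of \<epsilon> "{0<..}"]
  have "integrable (exp_measure \<epsilon>) f \<longleftrightarrow> integrable (lebesgue_on {0<..}) (\<lambda>t. wt \<epsilon> t *\<^sub>R f t)"
    unfolding exp_measure_eq using fm wm wt_pos[OF \<epsilon>] by (intro integrable_density) (auto intro: less_imp_le)
  also have "\<dots> \<longleftrightarrow> (\<lambda>t. wt \<epsilon> t * f t) absolutely_integrable_on {0<..}"
    by (simp add: integrable_restrict_space set_integrable_def)
  also have "\<dots> \<longleftrightarrow> (\<lambda>t. wt \<epsilon> t * f t) absolutely_integrable_on {0..}"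
    by (rule absolutely_integrable_Ioi_Ici)
  finally show *: "integrable (exp_measure \<epsilon>) f \<longleftrightarrow> (\<lambda>t. wt \<epsilon> t * f t) absolutely_integrable_on {0..}" .
  assume "(\<lambda>t. wt \<epsilon> t * f t) absolutely_integrable_on {0..}"
  then have "(\<lambda>t. wt \<epsilon> t * f t) absolutely_integrable_on {0<..}"
    by (simp only: absolutely_integrable_Ioi_Ici)
  then have int: "integrable (lebesgue_on {0<..}) (\<lambda>t. wt \<epsilon> t * f t)"
    by (simp add: integrable_restrict_space set_integrable_def)
  have "integral\<^sup>L (exp_measure \<epsilon>) f = integral\<^sup>L (lebesgue_on {0<..}) (\<lambda>t. wt \<epsilon> t *\<^sub>R f t)"
    unfolding exp_measure_eq using fm wm wt_pos[OF \<epsilon>] by (intro integral_density) (auto intro: less_imp_le)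
  also have "\<dots> = integral {0<..} (\<lambda>t. wt \<epsilon> t * f t)"
    using lebesgue_integral_eq_integral[OF int] by simp
  also have "\<dots> = integral {0..} (\<lambda>t. wt \<epsilon> t * f t)"
    by (rule absolutely_integrable_Ioi_Ici)
  finally show "integral\<^sup>L (exp_measure \<epsilon>) f = integral {0..} (\<lambda>t. wt \<epsilon> t * f t)" .
qed

lemma exp_measure_integrableI:
  assumes \<epsilon>: "\<epsilon> > 0" and f: "(\<lambda>t. wt \<epsilon> t * f t) absolutely_integrable_on {0..}"
  shows "integrable (exp_measure \<epsilon>) f" "integral\<^sup>L (exp_measure \<epsilon>) f = integral {0..} (\<lambda>t. wt \<epsilon> t * f t)"
proof -
  have "(\<lambda>t. wt \<epsilon> t * f t) \<in> borel_measurable (lebesgue_on {0..})"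
    using f by (rule absolutely_integrable_imp_borel_measurable) simp
  then have "(\<lambda>t. (wt \<epsilon> t * f t) / wt \<epsilon> t) \<in> borel_measurable (lebesgue_on {0..})"
    by (intro borel_measurable_divide wt_measurable)
  moreover have "(\<lambda>t. (wt \<epsilon> t * f t) / wt \<epsilon> t) = f"
    using wt_pos[OF \<epsilon>] by (intro ext) (metis less_irrefl nonzero_mult_div_cancel_left)
  ultimately have m: "f \<in> borel_measurable (lebesgue_on {0..})" by simp
  show "integrable (exp_measure \<epsilon>) f" "integral\<^sup>L (exp_measure \<epsilon>) f = integral {0..} (\<lambda>t. wt \<epsilon> t * f t)"
    using exp_measure_integrable_iff[OF \<epsilon> m] f by blast+
qed

lemma exp_measure_measurable:
  "f \<in> borel_measurable (lebesgue_on {0..}) \<Longrightarrow> f \<in> borel_measurable (exp_measure \<epsilon>)"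
  unfolding exp_measure_def by (simp, rule measurable_restrict_mono) auto

lemma AE_exp_measure_iff:
  assumes "\<epsilon> > 0"
  shows "(AE t in exp_measure \<epsilon>. P t) \<longleftrightarrow> (AE t in lebesgue_on {0..}. P t)"
proof -
  note wm = wt_measurable[of \<epsilon> "{0<..}"]
  have "(AE t in exp_measure \<epsilon>. P t) \<longleftrightarrow> (AE t in lebesgue_on {0<..}. P t)"
    unfolding exp_measure_eq using wm wt_pos[OF assms] by (subst AE_density) auto
  also have "\<dots> \<longleftrightarrow> (AE t in lebesgue_on {0..}. P t)"
  proof
    assume "AE t in lebesgue_on {0<..}. P t"
    then have "negligible ({t \<in> {0<..}. \<not> P t} \<union> {0})"
      by (auto simp: AE_lebesgue_on_iff intro: negligible_Un)
    then have "negligible {t \<in> {0..}. \<not> P t}"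
      by (rule negligible_subset) (auto simp: order_le_less)
    then show "AE t in lebesgue_on {0..}. P t" by (simp add: AE_lebesgue_on_iff)
  qed (erule AE_lebesgue_on_subset, auto)
  finally show ?thesis .
qed

lemma half_line_cover: "(\<Union>n. {0..real n}) = {0..}"
  by (auto intro: real_arch_simple)

lemma measurable_half_line:
  assumes "\<And>n::nat. f \<in> borel_measurable (lebesgue_on {0..real n})"
  shows "f \<in> borel_measurable (lebesgue_on {0..})"
proof (rule measurable_piecewise_restrict[of "range (\<lambda>n. {0..real n})"])
  show "space (lebesgue_on {0..}) \<subseteq> \<Union> (range (\<lambda>n. {0..real n}))"
    unfolding half_line_cover by simp
  fix X assume "X \<in> range (\<lambda>n. {0..real n})"
  then obtain n where X: "X = {0..real n}" by blast
  show "X \<inter> space (lebesgue_on {0..}) \<in> sets (lebesgue_on {0..})"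
    by (auto simp: X sets_restrict_space_iff)
  have "restrict_space (lebesgue_on {0..}) X = lebesgue_on {0..real n}"
    by (subst restrict_restrict_space) (auto simp: X Int_absorb1)
  then show "f \<in> restrict_space (lebesgue_on {0..}) X \<rightarrow>\<^sub>M borel"
    using assms[of n] by simp
qed simp

lemma integrable_half_line:
  fixes f :: "real \<Rightarrow> real"
  assumes nn: "\<And>t. 0 \<le> t \<Longrightarrow> 0 \<le> f t"
    and int: "\<And>n::nat. f integrable_on {0..real n}" and bd: "\<And>n::nat. integral {0..real n} f \<le> K"
  shows "f integrable_on {0..}" "integral {0..} f \<le> K"
proof -
  define g where "g n t = (if t \<in> {0..real n} then f t else 0)" for n :: nat and t
  have g: "(g n has_integral (integral {0..real n} f)) {0..}" for n
    unfolding g_def using integrable_integral[OF int[of n]]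
    by (subst has_integral_restrict) auto
  have "f integrable_on {0..} \<and> (\<lambda>n. integral {0..} (g n)) \<longlonglongrightarrow> integral {0..} f"
  proof (rule monotone_convergence_increasing)
    show "g n integrable_on {0..}" for n using g by blast
    show "g n t \<le> g (Suc n) t" if "t \<in> {0..}" for n t
      using that nn by (auto simp: g_def)
    show "(\<lambda>n. g n t) \<longlonglongrightarrow> f t" if "t \<in> {0..}" for t
    proof (rule tendsto_eventually)
      obtain N :: nat where "t \<le> real N" using real_arch_simple by blast
      then show "\<forall>\<^sub>F n in sequentially. g n t = f t"
        using that unfolding eventually_sequentially by (intro exI[of _ N]) (auto simp: g_def)
    qed
    have "\<bar>integral {0..} (g n)\<bar> \<le> K" for n
      using bd[of n] integral_unique[OF g[of n]] integral_nonneg[OF int[of n]] nn by auto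
    then show "bounded (range (\<lambda>n. integral {0..} (g n)))"
      unfolding bounded_iff by auto
  qed
  moreover have "integral {0..} (g n) \<le> K" for n
    using bd[of n] integral_unique[OF g[of n]] by simp
  ultimately show "f integrable_on {0..}" "integral {0..} f \<le> K"
    by (auto intro: LIMSEQ_le_const2)
qed

lemma distance_derivative_le_speed:
  fixes u :: "real \<Rightarrow> 'a::metric_space"
  assumes u: "AC 1 {a..b} edist u"
  obtains \<rho> where "AE t in lebesgue_on {a<..<b}. ((\<lambda>t. dist (u t) x) has_real_derivative \<rho> t) (at t) \<and> \<bar>\<rho> t\<bar> \<le> speed u t"
proof -
  have "\<bar>dist (u t) x - dist (u s) x\<bar> \<le> integral {s..t} (speed u)" if "a \<le> s" "s \<le> t" "t \<le> b" for s t
    using AC_dist_le_integral_speed[OF u that] abs_dist_diff[of "u t" x "u s"] by (simp add: dist_commute)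
  from dominated_increments_derivative[OF AC_speed_integrable[OF u] abs_ge_zero this]
  obtain \<rho> where "\<And>s t. \<lbrakk>a \<le> s; s \<le> t; t \<le> b\<rbrakk> \<Longrightarrow> (\<rho> has_integral (dist (u t) x - dist (u s) x)) {s..t}"
    and \<rho>: "AE t in lebesgue_on {a<..<b}. ((\<lambda>t. dist (u t) x) has_real_derivative \<rho> t) (at t)"
    by blast
  have "AE t in lebesgue_on {a<..<b}. ((\<lambda>t. dist (u t) x) has_real_derivative \<rho> t) (at t) \<and> \<bar>\<rho> t\<bar> \<le> speed u t"
    using \<rho> AC_metric_deriv_tendsto[OF u, folded AE_lebesgue_on_Ioo_Icc]
  proof eventually_elim
    case (elim t)
    have "\<bar>\<rho> t\<bar> \<le> metric_deriv u t"
    proof (rule tendsto_le[OF _ elim(2) derivative_abs_quotient[OF elim(1)]])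
      show "\<forall>\<^sub>F s in at t. \<bar>dist (u s) x - dist (u t) x\<bar> / \<bar>t - s\<bar> \<le> dist (u s) (u t) / \<bar>t - s\<bar>"
        by (intro always_eventually allI divide_right_mono) (simp_all add: abs_dist_diff)
    qed simp
    then show ?case using elim(1) by simp
  qed
  then show thesis by (rule that)
qed

lemma exp_neg_lipschitz:
  assumes "0 \<le> s" "s \<le> t" "\<epsilon> > (0::real)"
  shows "\<bar>exp (- t / \<epsilon>) - exp (- s / \<epsilon>)\<bar> \<le> (t - s) / \<epsilon>"
proof -
  have "exp (- t / \<epsilon>) = exp (- s / \<epsilon>) * exp (- ((t - s) / \<epsilon>))"
    by (simp add: exp_add[symmetric] diff_divide_distrib)
  then have "exp (- s / \<epsilon>) - exp (- t / \<epsilon>) = exp (- s / \<epsilon>) * (1 - exp (- ((t - s) / \<epsilon>)))"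
    by (simp add: right_diff_distrib)
  moreover have "1 - exp (- ((t - s) / \<epsilon>)) \<le> (t - s) / \<epsilon>" "0 \<le> 1 - exp (- ((t - s) / \<epsilon>))"
    using exp_ge_add_one_self[of "- ((t - s) / \<epsilon>)"] assms by (auto simp: divide_nonneg_pos)
  moreover have "exp (- s / \<epsilon>) \<le> 1" "0 \<le> exp (- s / \<epsilon>)" using assms by auto
  ultimately have "0 \<le> exp (- s / \<epsilon>) - exp (- t / \<epsilon>)" "exp (- s / \<epsilon>) - exp (- t / \<epsilon>) \<le> 1 * ((t - s) / \<epsilon>)"
    using mult_nonneg_nonneg[of "exp (- s / \<epsilon>)" "1 - exp (- ((t - s) / \<epsilon>))"]
      mult_mono[of "exp (- s / \<epsilon>)" 1 "1 - exp (- ((t - s) / \<epsilon>))" "(t - s) / \<epsilon>"]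
    by linarith+
  then show ?thesis by linarith
qed

text \<open>With \<open>F t = dist (u t) (u 0)\<close> and \<open>w = wt \<epsilon>\<close>, the derivative of \<open>w * F\<^sup>2\<close> is \<open>w * (2 * F * F' - F\<^sup>2 / \<epsilon>)\<close>, which is at
most \<open>w * (2 * \<epsilon> * F'\<^sup>2 - F\<^sup>2 / (2 * \<epsilon>))\<close> by Young's inequality. Integrate over \<open>{0..T}\<close> and use that \<open>w * F\<^sup>2\<close>
vanishes at \<open>0\<close> and is nonnegative at \<open>T\<close>, and that \<open>|F'| \<le> |u'|\<close>.\<close>

theorem weighted_hardy:
  fixes u :: "real \<Rightarrow> 'a::metric_space"
  assumes u: "AC 1 {0..T} edist u" and \<epsilon>: "\<epsilon> > 0" and T: "0 \<le> T"
    and sq: "(\<lambda>t. wt \<epsilon> t * (metric_deriv u t)\<^sup>2) integrable_on {0..T}"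
  shows "integral {0..T} (\<lambda>t. wt \<epsilon> t * (dist (u t) (u 0))\<^sup>2) \<le> 4 * \<epsilon>\<^sup>2 * integral {0..T} (\<lambda>t. wt \<epsilon> t * (metric_deriv u t)\<^sup>2)"
proof -
  define F where "F t = dist (u t) (u 0)" for t
  define G where "G t = wt \<epsilon> t * (F t)\<^sup>2" for t
  have contF: "continuous_on {0..T} F"
    unfolding F_def by (intro continuous_intros AC_continuous[OF u])
  have F0: "F t \<ge> 0" for t by (simp add: F_def)
  define K where "K = integral {0..T} (speed u)"
  have FK: "F t \<le> K" if "0 \<le> t" "t \<le> T" for t
  proof -
    have "F t \<le> integral {0..t} (speed u)"
      using AC_dist_le_integral_speed[OF u, of 0 t] that by (simp add: F_def dist_commute)
    also have "\<dots> \<le> K" unfolding K_def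
      using that by (intro integral_subset_le integrable_subinterval_real[OF AC_speed_integrable[OF u]] AC_speed_integrable[OF u]) auto
    finally show ?thesis .
  qed
  have K0: "0 \<le> K" using FK[of 0] F0[of 0] T by linarith
  have Gbd: "\<bar>G t - G s\<bar> \<le> integral {s..t} (\<lambda>r. K\<^sup>2 / \<epsilon>\<^sup>2 + 2 * K / \<epsilon> * speed u r)" if st: "0 \<le> s" "s \<le> t" "t \<le> T" for s t
  proof -
    define D where "D = integral {s..t} (speed u)"
    have sp: "speed u integrable_on {s..t}"
      using st by (intro integrable_subinterval_real[OF AC_speed_integrable[OF u]]) auto
    have "\<bar>F t - F s\<bar> \<le> D"
      using AC_dist_le_integral_speed[OF u st] abs_dist_diff[of "u t" "u 0" "u s"]
      by (simp add: D_def F_def dist_commute)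
    have bF: "F s \<le> K" "F t \<le> K" using FK st by auto
    have "\<bar>(F t)\<^sup>2 - (F s)\<^sup>2\<bar> = \<bar>F t - F s\<bar> * (F t + F s)"
      using F0[of s] F0[of t] by (simp add: power2_eq_square square_diff_square_factored abs_mult)
    also have "\<dots> \<le> D * (K + K)"
      using \<open>\<bar>F t - F s\<bar> \<le> D\<close> bF F0[of s] F0[of t] by (intro mult_mono) auto
    finally have 1: "\<bar>(F t)\<^sup>2 - (F s)\<^sup>2\<bar> \<le> 2 * K * D" by (simp add: algebra_simps)
    have 2: "\<bar>wt \<epsilon> t - wt \<epsilon> s\<bar> \<le> (t - s) / \<epsilon>\<^sup>2"
      using divide_right_mono[OF exp_neg_lipschitz[OF st(1,2) \<epsilon>], of \<epsilon>] \<epsilon>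
      by (simp add: wt_def diff_divide_distrib[symmetric] power2_eq_square)
    have 3: "(F t)\<^sup>2 \<le> K\<^sup>2" using bF F0[of t] by (intro power_mono) auto
    have 4: "0 \<le> wt \<epsilon> s" "wt \<epsilon> s \<le> 1 / \<epsilon>" using \<epsilon> st by (auto intro: wt_le less_imp_le[OF wt_pos])
    have "G t - G s = (wt \<epsilon> t - wt \<epsilon> s) * (F t)\<^sup>2 + wt \<epsilon> s * ((F t)\<^sup>2 - (F s)\<^sup>2)"
      by (simp add: G_def algebra_simps)
    then have "\<bar>G t - G s\<bar> \<le> \<bar>wt \<epsilon> t - wt \<epsilon> s\<bar> * (F t)\<^sup>2 + wt \<epsilon> s * \<bar>(F t)\<^sup>2 - (F s)\<^sup>2\<bar>"
      using 4(1) abs_triangle_ineq[of "(wt \<epsilon> t - wt \<epsilon> s) * (F t)\<^sup>2" "wt \<epsilon> s * ((F t)\<^sup>2 - (F s)\<^sup>2)"]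
      by (simp add: abs_mult)
    also have "\<dots> \<le> (t - s) / \<epsilon>\<^sup>2 * K\<^sup>2 + 1 / \<epsilon> * (2 * K * D)"
      using 1 2 3 4 \<epsilon> by (intro add_mono mult_mono) (auto simp: st)
    also have "\<dots> = integral {s..t} (\<lambda>r. K\<^sup>2 / \<epsilon>\<^sup>2 + 2 * K / \<epsilon> * speed u r)"
    proof -
      have "((\<lambda>r. K\<^sup>2 / \<epsilon>\<^sup>2 + 2 * K / \<epsilon> * speed u r) has_integral ((t - s) *\<^sub>R (K\<^sup>2 / \<epsilon>\<^sup>2) + 2 * K / \<epsilon> * D)) {s..t}"
        unfolding D_def using has_integral_const_real[of "K\<^sup>2 / \<epsilon>\<^sup>2" s t] st
        by (intro has_integral_add has_integral_mult_right integrable_integral sp) simp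
      then show ?thesis by (simp add: integral_unique)
    qed
    finally show ?thesis .
  qed
  have mint: "(\<lambda>r. K\<^sup>2 / \<epsilon>\<^sup>2 + 2 * K / \<epsilon> * speed u r) integrable_on {0..T}"
    by (intro integrable_add integrable_const_ivl
        has_integral_integrable[OF has_integral_mult_right[OF integrable_integral[OF AC_speed_integrable[OF u]]]])
  obtain \<rho> where \<rho>: "\<And>s t. \<lbrakk>0 \<le> s; s \<le> t; t \<le> T\<rbrakk> \<Longrightarrow> (\<rho> has_integral (G t - G s)) {s..t}"
    "AE x in lebesgue_on {0<..<T}. (G has_real_derivative \<rho> x) (at x)"
    using dominated_increments_derivative[OF mint _ Gbd] K0 \<epsilon> by auto
  obtain \<sigma> where \<sigma>: "AE t in lebesgue_on {0<..<T}. (F has_real_derivative \<sigma> t) (at t) \<and> \<bar>\<sigma> t\<bar> \<le> speed u t"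
    using distance_derivative_le_speed[OF u, of "u 0"] unfolding F_def by blast
  define R where "R t = 2 * \<epsilon> * (wt \<epsilon> t * (metric_deriv u t)\<^sup>2) - 1 / (2 * \<epsilon>) * G t" for t
  have le: "AE t in lebesgue_on {0<..<T}. \<rho> t \<le> R t"
    using \<rho>(2) \<sigma>
  proof eventually_elim
    case (elim t)
    have "(G has_real_derivative (wt \<epsilon> t * (2 * F t * \<sigma> t - (F t)\<^sup>2 / \<epsilon>))) (at t)"
      unfolding G_def wt_def using elim(2) \<epsilon>
      by (auto intro!: derivative_eq_intros simp: power2_eq_square field_simps)
    then have eq: "\<rho> t = wt \<epsilon> t * (2 * F t * \<sigma> t - (F t)\<^sup>2 / \<epsilon>)"
      using elim(1) DERIV_unique by blast
    have "2 * F t * \<sigma> t \<le> 2 * F t * speed u t"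
      using elim(2) F0[of t] by (intro mult_left_mono) auto
    also have "\<dots> \<le> 2 * \<epsilon> * (metric_deriv u t)\<^sup>2 + (F t)\<^sup>2 / (2 * \<epsilon>)"
    proof -
      have "0 \<le> (2 * \<epsilon> * speed u t - F t)\<^sup>2 / (2 * \<epsilon>)" using \<epsilon> by simp
      also have "\<dots> = 2 * \<epsilon> * (speed u t)\<^sup>2 + (F t)\<^sup>2 / (2 * \<epsilon>) - 2 * F t * speed u t"
        using \<epsilon> by (simp add: power2_diff field_simps power2_eq_square)
      finally show ?thesis by simp
    qed
    finally have "2 * F t * \<sigma> t - (F t)\<^sup>2 / \<epsilon> \<le> 2 * \<epsilon> * (metric_deriv u t)\<^sup>2 - (F t)\<^sup>2 / (2 * \<epsilon>)"
    proof -
      assume "2 * F t * \<sigma> t \<le> 2 * \<epsilon> * (metric_deriv u t)\<^sup>2 + (F t)\<^sup>2 / (2 * \<epsilon>)"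
      moreover have "(F t)\<^sup>2 / \<epsilon> = (F t)\<^sup>2 / (2 * \<epsilon>) + (F t)\<^sup>2 / (2 * \<epsilon>)" by simp
      ultimately show ?thesis by linarith
    qed
    then have "\<rho> t \<le> wt \<epsilon> t * (2 * \<epsilon> * (metric_deriv u t)\<^sup>2 - (F t)\<^sup>2 / (2 * \<epsilon>))"
      unfolding eq using wt_pos[OF \<epsilon>, of t] by (intro mult_left_mono) auto
    also have "\<dots> = R t" by (simp add: R_def G_def algebra_simps)
    finally show ?case .
  qed
  have Gint: "G integrable_on {0..T}"
    unfolding G_def by (intro integrable_continuous_real continuous_intros contF wt_continuous)
  have Rint: "(R has_integral (2 * \<epsilon> * integral {0..T} (\<lambda>t. wt \<epsilon> t * (metric_deriv u t)\<^sup>2) - 1 / (2 * \<epsilon>) * integral {0..T} G)) {0..T}"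
    unfolding R_def by (intro has_integral_diff has_integral_mult_right integrable_integral sq Gint)
  have \<rho>T: "(\<rho> has_integral (G T - G 0)) {0..T}" using \<rho>(1)[of 0 T] T by simp
  have "G T - G 0 \<le> integral {0..T} R"
    using integral_mono_AE_Icc[OF has_integral_integrable[OF \<rho>T] has_integral_integrable[OF Rint]
      le[unfolded AE_lebesgue_on_Ioo_Icc]] integral_unique[OF \<rho>T] by simp
  moreover have "0 \<le> G T" "G 0 = 0" using wt_pos[OF \<epsilon>, of T] by (auto simp: G_def F_def)
  ultimately have "1 / (2 * \<epsilon>) * integral {0..T} G \<le> 2 * \<epsilon> * integral {0..T} (\<lambda>t. wt \<epsilon> t * (metric_deriv u t)\<^sup>2)"
    using integral_unique[OF Rint] by simp
  then have "integral {0..T} G \<le> 4 * \<epsilon>\<^sup>2 * integral {0..T} (\<lambda>t. wt \<epsilon> t * (metric_deriv u t)\<^sup>2)"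
    using \<epsilon> by (simp add: field_simps power2_eq_square)
  then show ?thesis unfolding G_def[abs_def] F_def .
qed

section \<open>Concatenation and translation\<close>

lemma AC_1_concat:
  assumes 1: "AC 1 {a..c} edist u" and 2: "AC 1 {c..b} edist u" and acb: "a \<le> c" "c \<le> b"
  shows "AC 1 {a..b} edist u"
proof -
  obtain m where m: "m integrable_on {a..c}" "\<And>t. 0 \<le> m t"
    "\<And>s t. \<lbrakk>a \<le> s; s \<le> t; t \<le> c\<rbrakk> \<Longrightarrow> dist (u s) (u t) \<le> integral {s..t} m"
    using AC_1_edist_obtain[OF 1] by blast
  obtain n where n: "n integrable_on {c..b}" "\<And>t. 0 \<le> n t"
    "\<And>s t. \<lbrakk>c \<le> s; s \<le> t; t \<le> b\<rbrakk> \<Longrightarrow> dist (u s) (u t) \<le> integral {s..t} n"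
    using AC_1_edist_obtain[OF 2] by blast
  define k where "k t = (if t < c then m t else n t)" for t
  have km: "(k has_integral I) {s..t} \<longleftrightarrow> (m has_integral I) {s..t}" if "t \<le> c" for s t I
    by (rule has_integral_spike_eq[of "{c}"]) (use that in \<open>auto simp: k_def\<close>)
  have kn: "integral {s..t} k = integral {s..t} n" if "c \<le> s" for s t
    using that by (intro integral_cong) (auto simp: k_def)
  have km': "integral {s..t} k = integral {s..t} m" if "a \<le> s" "t \<le> c" for s t
    using km[OF that(2)] integrable_integral[OF integrable_subinterval_real[OF m(1), of s t]] that
    by (metis atLeastatMost_subset_iff integral_unique)
  have k: "k integrable_on {a..b}"
  proof (rule Henstock_Kurzweil_Integration.integrable_combine[OF acb])
    show "k integrable_on {a..c}" using km m(1) by (meson integrable_on_def order_refl)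
    show "k integrable_on {c..b}" using n(1) by (rule integrable_eq) (auto simp: k_def)
  qed
  show ?thesis
  proof (rule AC_1_intro[OF k])
    fix s t assume st: "a \<le> s" "s \<le> t" "t \<le> b"
    consider "t \<le> c" | "c \<le> s" | "s < c" "c < t" by linarith
    then have "dist (u s) (u t) \<le> integral {s..t} k"
    proof cases
      case 3
      have "dist (u s) (u t) \<le> dist (u s) (u c) + dist (u c) (u t)" by (rule dist_triangle)
      also have "\<dots> \<le> integral {s..c} k + integral {c..t} k"
        using 3 st m(3)[of s c] n(3)[of c t] km'[of s c] kn[of c t] by simp
      also have "\<dots> = integral {s..t} k"
        using 3 st by (intro Henstock_Kurzweil_Integration.integral_combine integrable_subinterval_real[OF k]) auto
      finally show ?thesis .
    qed (use st m(3) n(3) km' kn in auto)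
    then show "edist (u s) (u t) \<le> ereal (integral {s..t} k)" by simp
  qed (use m(2) n(2) in \<open>auto simp: k_def\<close>)
qed

lemma absolutely_integrable_shift:
  fixes f :: "real \<Rightarrow> real"
  assumes "S \<in> sets lebesgue"
  shows "(\<lambda>t. f (t - T)) absolutely_integrable_on ((+) T ` S) \<longleftrightarrow> f absolutely_integrable_on S" (is ?A)
    and "f absolutely_integrable_on S \<Longrightarrow> integral ((+) T ` S) (\<lambda>t. f (t - T)) = integral S f"
proof -
  have *: "(\<lambda>x. \<bar>1\<bar> * f (T + x - T)) absolutely_integrable_on S \<and> integral S (\<lambda>x. \<bar>1\<bar> * f (T + x - T)) = b
      \<longleftrightarrow> (\<lambda>t. f (t - T)) absolutely_integrable_on ((+) T ` S) \<and> integral ((+) T ` S) (\<lambda>t. f (t - T)) = b" for b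
    by (rule has_absolute_integral_change_of_variables_1'[OF assms])
      (auto intro!: derivative_eq_intros simp: inj_on_def)
  show ?A using * by auto
  show "integral ((+) T ` S) (\<lambda>t. f (t - T)) = integral S f" if "f absolutely_integrable_on S"
    using *[of "integral S f"] that by simp
qed

lemma image_plus_Ici: "(+) T ` {0..} = {T::real..}"
  by (auto simp: image_iff intro!: bexI[of _ "_ - T"])

lemma image_plus_Icc: "(+) T ` {a..b} = {T + a::real..T + b}"
  by simp

lemma AC_1_shift:
  assumes "AC 1 {a..b} edist v"
  shows "AC 1 {T + a..T + b} edist (\<lambda>t. v (t - T))"
proof -
  obtain m where m: "m integrable_on {a..b}" "\<And>t. 0 \<le> m t"
    "\<And>s t. \<lbrakk>a \<le> s; s \<le> t; t \<le> b\<rbrakk> \<Longrightarrow> dist (v s) (v t) \<le> integral {s..t} m"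
    using AC_1_edist_obtain[OF assms] by blast
  have mabs: "m absolutely_integrable_on {s..t}" if "a \<le> s" "t \<le> b" for s t
    using that m(2) by (intro nonnegative_absolutely_integrable_1 integrable_subinterval_real[OF m(1)]) auto
  have shift: "(\<lambda>t. m (t - T)) integrable_on {s..t}" "integral {s..t} (\<lambda>t. m (t - T)) = integral {s - T..t - T} m"
    if "T + a \<le> s" "t \<le> T + b" for s t
    using absolutely_integrable_shift[where S = "{s - T..t - T}" and f = m and T = T] mabs[of "s - T" "t - T"] that
    by (auto simp: image_plus_Icc dest: set_lebesgue_integral_eq_integral(1))
  show ?thesis
  proof (rule AC_1_intro)
    show "(\<lambda>t. m (t - T)) integrable_on {T + a..T + b}" by (rule shift) auto
    show "edist (v (s - T)) (v (t - T)) \<le> ereal (integral {s..t} (\<lambda>t. m (t - T)))"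
      if "T + a \<le> s" "s \<le> t" "t \<le> T + b" for s t
      using that m(3)[of "s - T" "t - T"] shift(2)[of s t] by simp
  qed (use m(2) in auto)
qed

lemma metric_deriv_cong_open:
  assumes "open S" "t \<in> S" "\<And>s. s \<in> S \<Longrightarrow> u s = v s"
  shows "metric_deriv u t = metric_deriv v t"
proof -
  have "((\<lambda>s. dist (u s) (u t) / \<bar>t - s\<bar>) \<longlongrightarrow> l) (at t) \<longleftrightarrow> ((\<lambda>s. dist (v s) (v t) / \<bar>t - s\<bar>) \<longlongrightarrow> l) (at t)" for l
    by (rule Lim_cong_within[THEN trans[OF _ refl]] filterlim_cong refl)+
      (use assms in \<open>auto simp: eventually_at_topological\<close>)
  then show ?thesis unfolding metric_deriv_def Topological_Spaces.Lim_def by simp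
qed

lemma metric_deriv_shift: "metric_deriv (\<lambda>s. v (s - T)) t = metric_deriv v (t - T)"
proof -
  have "((\<lambda>s. dist (v (s - T)) (v (t - T)) / \<bar>t - s\<bar>) \<longlongrightarrow> l) (at t) \<longleftrightarrow>
        ((\<lambda>s. dist (v s) (v (t - T)) / \<bar>t - T - s\<bar>) \<longlongrightarrow> l) (at (t - T))" for l
    unfolding filtermap_at_shift[symmetric, of t T] filterlim_filtermap by (simp add: algebra_simps)
  then show ?thesis unfolding metric_deriv_def Topological_Spaces.Lim_def by simp
qed

lemma AE_shift:
  assumes "AE t in lebesgue_on {0::real..}. P t"
  shows "AE t in lebesgue_on {T..}. P (t - T)"
proof -
  have "negligible ((+) T ` {t \<in> {0..}. \<not> P t})"
    using assms by (intro negligible_translation) (simp add: AE_lebesgue_on_iff)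
  moreover have "{t \<in> {T..}. \<not> P (t - T)} \<subseteq> (+) T ` {t \<in> {0..}. \<not> P t}"
  proof
    fix t assume "t \<in> {t \<in> {T..}. \<not> P (t - T)}"
    then show "t \<in> (+) T ` {t \<in> {0..}. \<not> P t}" by (intro image_eqI[of _ _ "t - T"]) auto
  qed
  ultimately have "negligible {t \<in> {T..}. \<not> P (t - T)}" by (rule negligible_subset)
  then show ?thesis by (simp add: AE_lebesgue_on_iff)
qed

lemma AE_Icc_Ici:
  assumes "AE t in lebesgue_on {0..T}. t < T \<longrightarrow> P t" "AE t in lebesgue_on {T..}. T < t \<longrightarrow> P t"
  shows "AE t in lebesgue_on {0::real..}. P t"
proof -
  have "negligible ({t \<in> {0..T}. \<not> (t < T \<longrightarrow> P t)} \<union> {t \<in> {T..}. \<not> (T < t \<longrightarrow> P t)} \<union> {T})"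
    using assms by (intro negligible_Un) (auto simp: AE_lebesgue_on_iff)
  then have "negligible {t \<in> {0..}. \<not> P t}"
    by (rule negligible_subset) auto
  then show ?thesis by (simp add: AE_lebesgue_on_iff)
qed

lemma absolutely_integrable_concat:
  fixes p q :: "real \<Rightarrow> real"
  assumes p: "p absolutely_integrable_on {0..T}" and q: "q absolutely_integrable_on {0..}" and T: "0 \<le> T"
  defines "k \<equiv> \<lambda>t. if t < T then p t else q (t - T)"
  shows "k absolutely_integrable_on {0..}" "integral {0..} k = integral {0..T} p + integral {0..} q"
proof -
  have k1: "k absolutely_integrable_on {0..T}"
    by (rule absolutely_integrable_spike[OF p, of "{T}"]) (auto simp: k_def)
  have qs: "(\<lambda>t. q (t - T)) absolutely_integrable_on {T..}" "integral {T..} (\<lambda>t. q (t - T)) = integral {0..} q"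
    using absolutely_integrable_shift[where S = "{0..}" and f = q and T = T] q by (simp_all only: image_plus_Ici, auto)
  have k2: "k absolutely_integrable_on {T..}"
    by (rule absolutely_integrable_spike[OF qs(1), of "{}"]) (auto simp: k_def)
  have U: "{0..T} \<union> {T..} = {0..}" using T by auto
  show "k absolutely_integrable_on {0..}"
    using absolutely_integrable_Un[OF k1 k2] by (simp only: U)
  have i1: "integral {0..T} k = integral {0..T} p"
    by (rule integral_spike[of "{T}"]) (auto simp: k_def)
  have i2: "integral {T..} k = integral {T..} (\<lambda>t. q (t - T))"
    by (rule integral_cong) (auto simp: k_def)
  have "(k has_integral (integral {0..T} k + integral {T..} k)) ({0..T} \<union> {T..})"
    using k1 k2 by (intro has_integral_Un integrable_integral)
      (auto dest: set_lebesgue_integral_eq_integral(1) intro: negligible_subset[of "{T}"])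
  then show "integral {0..} k = integral {0..T} p + integral {0..} q"
    unfolding U i1 i2 qs(2) by (rule integral_unique)
qed

lemma AC_2_imp_1:
  assumes "AC 2 {a..b::real} D u"
  shows "AC 1 {a..b} D u"
proof -
  obtain m :: "real \<Rightarrow> real" where m: "m \<in> borel_measurable (lebesgue_on {a..b})"
      "integrable (lebesgue_on {a..b}) (\<lambda>r. \<bar>m r\<bar> powr 2)"
    and D: "\<forall>s\<in>{a..b}. \<forall>t\<in>{a..b}. s \<le> t \<longrightarrow> D (u s) (u t) \<le> ereal (integral\<^sup>L (lebesgue_on {s..t}) m)"
    using assms unfolding AC_def by blast
  have "integrable (lebesgue_on {a..b}) (\<lambda>r. 1 + \<bar>m r\<bar> powr 2)"
    using m(2) by (intro Bochner_Integration.integrable_add) (auto simp: integrable_restrict_space)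
  then have "integrable (lebesgue_on {a..b}) (\<lambda>r. \<bar>m r\<bar> powr 1)"
  proof (rule Bochner_Integration.integrable_bound)
    show "(\<lambda>r. \<bar>m r\<bar> powr 1) \<in> borel_measurable (lebesgue_on {a..b})" using m(1) by simp
    have "\<bar>x\<bar> \<le> 1 + x\<^sup>2" for x :: real
    proof -
      have "0 \<le> (\<bar>x\<bar> - 1)\<^sup>2" by simp
      also have "\<dots> = x\<^sup>2 - 2 * \<bar>x\<bar> + 1" by (simp add: power2_diff)
      finally show ?thesis by simp
    qed
    then show "AE r in lebesgue_on {a..b}. norm (\<bar>m r\<bar> powr 1) \<le> norm (1 + \<bar>m r\<bar> powr 2)"
      by (intro AE_I2) simp
  qed
  then show ?thesis unfolding AC_def using m(1) D by blast
qed

lemma AC_2_intro: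
  assumes u: "AC 1 {a..b} edist u" and sq: "(\<lambda>t. (metric_deriv u t)\<^sup>2) integrable_on {a..b}"
  shows "AC 2 {a..b} edist u"
  unfolding AC_def
proof (intro exI[of _ "speed u"] conjI ballI impI)
  have sub: "speed u absolutely_integrable_on {s..t}" if "a \<le> s" "t \<le> b" for s t
    using that by (intro nonnegative_absolutely_integrable_1 integrable_subinterval_real[OF AC_speed_integrable[OF u]]) auto
  show "speed u \<in> borel_measurable (lebesgue_on {a..b})"
    using AC_speed_integrable[OF u] by (rule integrable_imp_measurable)
  have "(\<lambda>t. (metric_deriv u t)\<^sup>2) absolutely_integrable_on {a..b}"
    by (rule nonnegative_absolutely_integrable_1[OF sq]) simp
  then have "integrable (lebesgue_on {a..b}) (\<lambda>t. (metric_deriv u t)\<^sup>2)"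
    by (simp add: integrable_restrict_space set_integrable_def)
  then show "integrable (lebesgue_on {a..b}) (\<lambda>r. \<bar>speed u r\<bar> powr 2)" by simp
  fix s t assume st: "s \<in> {a..b}" "t \<in> {a..b}" "s \<le> t"
  then have "integral\<^sup>L (lebesgue_on {s..t}) (speed u) = integral {s..t} (speed u)"
    using sub[of s t] by (intro lebesgue_integral_eq_integral) (auto simp: integrable_restrict_space set_integrable_def)
  then show "edist (u s) (u t) \<le> ereal (integral\<^sup>L (lebesgue_on {s..t}) (speed u))"
    using AC_dist_le_integral_speed[OF u, of s t] st by simp
qed

section \<open>Change of the time variable\<close>

lemma borel_measure_eqI_atMost:
  fixes M N :: "real measure"
  assumes sets: "sets M = sets borel" "sets N = sets borel"
    and eq: "\<And>y. emeasure M {..y} = emeasure N {..y}" and fin: "\<And>y. emeasure M {..y} \<noteq> \<infinity>"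
  shows "M = N"
proof (rule borel_measure_eqI_Ioc[OF sets])
  fix x y :: real assume "x \<le> y"
  then have Ioc: "{x<..y} = {..y} - {..x}" "{..x} \<subseteq> {..y}" by auto
  show "emeasure M {x<..y} = emeasure N {x<..y}"
    unfolding Ioc(1) using Ioc(2) eq fin sets by (simp add: emeasure_Diff)
  have "emeasure M {x<..y} \<le> emeasure M {..y}"
    using sets by (intro emeasure_mono) auto
  then show "emeasure M {x<..y} \<noteq> \<infinity>" using fin[of y] by (auto simp: top_unique)
qed

text \<open>For \<open>y \<ge> \<tau> s\<close> the part of \<open>{s..t}\<close> where \<open>\<tau> \<le> y\<close> is an interval \<open>{s..r}\<close>, and \<open>\<tau> r = min y (\<tau> t)\<close> by the
intermediate value theorem. So the two measures agree on all half-lines.\<close>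

lemma distr_density_cumulative:
  fixes w \<tau> :: "real \<Rightarrow> real"
  assumes st: "s \<le> t" and w: "w integrable_on {s..t}" "\<And>r. r \<in> {s..t} \<Longrightarrow> 0 \<le> w r"
    and \<tau>: "\<And>x y. \<lbrakk>s \<le> x; x \<le> y; y \<le> t\<rbrakk> \<Longrightarrow> \<tau> y - \<tau> x = integral {x..y} w"
    and \<tau>c: "continuous_on UNIV \<tau>"
  shows "distr (density lebesgue (\<lambda>r. ennreal (indicator {s..t} r * w r))) borel \<tau>
       = density lborel (\<lambda>x. ennreal (indicator {\<tau> s..\<tau> t} x))"
    (is "?M = ?N")
proof (rule borel_measure_eqI_atMost)
  have wm: "(\<lambda>r. indicator {s..t} r * w r) \<in> borel_measurable lebesgue"
    using nonnegative_absolutely_integrable_1[OF w] by (auto simp: set_integrable_def dest: borel_measurable_integrable)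
  have \<tau>m: "\<tau> \<in> lebesgue \<rightarrow>\<^sub>M borel"
    by (intro measurable_completion) (simp add: borel_measurable_continuous_onI[OF \<tau>c])
  have mono: "\<tau> x \<le> \<tau> y" if "s \<le> x" "x \<le> y" "y \<le> t" for x y
    using \<tau>[OF that] integral_nonneg[OF integrable_subinterval_real[OF w(1), of x y]] w(2) that by auto
  fix y
  have M: "emeasure ?M {..y} = (\<integral>\<^sup>+r. ennreal (w r) * indicator ({s..t} \<inter> {r. \<tau> r \<le> y}) r \<partial>lborel)"
  proof -
    have "{r. \<tau> r \<le> y} \<in> sets lebesgue"
      using measurable_sets[OF \<tau>m, of "{..y}"] by (simp add: vimage_def)
    then have "emeasure ?M {..y} = (\<integral>\<^sup>+r. ennreal (indicator {s..t} r * w r) * indicator {r. \<tau> r \<le> y} r \<partial>lebesgue)"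
      using wm \<tau>m by (simp add: emeasure_distr vimage_def emeasure_density)
    also have "\<dots> = (\<integral>\<^sup>+r. ennreal (w r) * indicator ({s..t} \<inter> {r. \<tau> r \<le> y}) r \<partial>lebesgue)"
      by (intro nn_integral_cong) (auto simp: indicator_def)
    finally show ?thesis by (simp add: nn_integral_completion)
  qed
  have N: "emeasure ?N {..y} = emeasure lborel ({\<tau> s..\<tau> t} \<inter> {..y})"
    by (simp add: emeasure_density ennreal_indicator indicator_inter_arith[symmetric] del: nn_integral_indicator)
      (simp add: nn_integral_indicator)
  have "emeasure ?M {..y} = emeasure ?N {..y} \<and> emeasure ?M {..y} \<noteq> \<infinity>"
  proof (cases "\<tau> s \<le> y")
    case False
    then have "{s..t} \<inter> {r. \<tau> r \<le> y} = {}" "{\<tau> s..\<tau> t} \<inter> {..y} = {}"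
      using mono[of s] by force+
    then show ?thesis unfolding M N by simp
  next
    case True
    define E where "E = {r \<in> {s..t}. \<tau> r \<le> y}"
    have "closed E" unfolding E_def
      using continuous_closed_preimage[OF continuous_on_subset[OF \<tau>c], of "{s..t}" "{..y}"]
      by (simp add: vimage_def Int_def)
    then have "compact E" by (metis E_def bounded_closed_interval bounded_subset compact_eq_bounded_closed Collect_subset)
    moreover have "s \<in> E" using True st by (simp add: E_def)
    ultimately obtain r where r: "r \<in> E" "\<And>r'. r' \<in> E \<Longrightarrow> r' \<le> r"
      using compact_attains_sup[of E] by blast
    have E: "{s..t} \<inter> {r. \<tau> r \<le> y} = {s..r}"
    proof (intro equalityI subsetI)
      fix r' assume "r' \<in> {s..r}"
      then show "r' \<in> {s..t} \<inter> {r. \<tau> r \<le> y}"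
        using r(1) mono[of r' r] by (auto simp: E_def)
    qed (use r(2) in \<open>auto simp: E_def\<close>)
    have \<tau>r: "\<tau> r = min y (\<tau> t)"
    proof (cases "\<tau> t \<le> y")
      case True
      then have "t \<in> E" using st by (simp add: E_def)
      then have "r = t" using r by (auto simp: E_def intro: antisym)
      with True show ?thesis by simp
    next
      case False
      obtain r' where r': "s \<le> r'" "r' \<le> t" "\<tau> r' = y"
        using IVT'[of \<tau> s y t] True False st continuous_on_subset[OF \<tau>c] by auto
      then have "r' \<le> r" using r(2) by (simp add: E_def)
      then have "\<tau> r = y" using mono[of r' r] r(1) r' by (auto simp: E_def intro: antisym)
      with False show ?thesis by simp
    qed
    have srt: "s \<le> r" "r \<le> t" using r(1) by (auto simp: E_def)
    have "(w has_integral (\<tau> r - \<tau> s)) {s..r}"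
      using \<tau>[of s r] srt by (simp add: integrable_integral integrable_subinterval_real[OF w(1)])
    then have "emeasure ?M {..y} = ennreal (\<tau> r - \<tau> s)"
      unfolding M E using w(2) srt by (intro nn_integral_has_integral_lebesgue') auto
    moreover have "{\<tau> s..\<tau> t} \<inter> {..y} = {\<tau> s..\<tau> r}" unfolding \<tau>r by auto
    then have "emeasure ?N {..y} = ennreal (\<tau> r - \<tau> s)"
      unfolding N using mono[of s r] srt by simp
    ultimately show ?thesis by simp
  qed
  then show "emeasure ?M {..y} = emeasure ?N {..y}" "emeasure ?M {..y} \<noteq> \<infinity>" by blast+
qed simp_all

text \<open>The density \<open>w\<close> may vanish on a set of positive measure, on which a curve rests while no new time passes,
so \<open>\<tau>\<close> need not be injective. Stating the substitution as a push-forward of measures covers this case.\<close>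

theorem time_change:
  fixes w \<tau> h :: "real \<Rightarrow> real"
  assumes st: "s \<le> t" and w: "w integrable_on {s..t}" "\<And>r. r \<in> {s..t} \<Longrightarrow> 0 \<le> w r"
    and \<tau>: "\<And>x y. \<lbrakk>s \<le> x; x \<le> y; y \<le> t\<rbrakk> \<Longrightarrow> \<tau> y - \<tau> x = integral {x..y} w"
    and \<tau>c: "continuous_on UNIV \<tau>"
    and h: "h \<in> borel_measurable borel"
    and int: "(\<lambda>r. h (\<tau> r) * w r) absolutely_integrable_on {s..t}"
  shows "h absolutely_integrable_on {\<tau> s..\<tau> t}"
    and "integral {\<tau> s..\<tau> t} h = integral {s..t} (\<lambda>r. h (\<tau> r) * w r)"
proof -
  define W where "W r = indicator {s..t} r * w r" for r
  define D where "D = density lebesgue (\<lambda>r. ennreal (W r))"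
  have wm: "W \<in> borel_measurable lebesgue"
    using nonnegative_absolutely_integrable_1[OF w] unfolding W_def
    by (auto simp: set_integrable_def dest: borel_measurable_integrable)
  have Wnn: "AE r in lebesgue. 0 \<le> W r" using w(2) by (intro AE_I2) (auto simp: W_def indicator_def)
  have \<tau>m: "\<tau> \<in> lebesgue \<rightarrow>\<^sub>M borel"
    by (intro measurable_completion) (simp add: borel_measurable_continuous_onI[OF \<tau>c])
  have \<tau>D: "\<tau> \<in> D \<rightarrow>\<^sub>M borel" unfolding D_def using \<tau>m by simp
  have h\<tau>: "(\<lambda>r. h (\<tau> r)) \<in> borel_measurable lebesgue"
    using h \<tau>m by (rule measurable_compose[rotated])
  have eq: "distr D borel \<tau> = density lborel (\<lambda>x. ennreal (indicator {\<tau> s..\<tau> t} x))"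
    unfolding D_def W_def by (rule distr_density_cumulative[OF st w \<tau> \<tau>c])
  have Wh: "(\<lambda>r. W r *\<^sub>R h (\<tau> r)) = (\<lambda>r. indicator {s..t} r *\<^sub>R (h (\<tau> r) * w r))"
    by (auto simp: W_def)
  have int': "integrable lebesgue (\<lambda>r. W r *\<^sub>R h (\<tau> r))"
    using int unfolding Wh set_integrable_def .
  have "integrable D (\<lambda>r. h (\<tau> r))"
    unfolding D_def using int' h\<tau> wm Wnn by (subst integrable_density) auto
  then have 1: "integrable (distr D borel \<tau>) h"
    using h \<tau>D by (subst integrable_distr_eq) auto
  have 2: "integral\<^sup>L (distr D borel \<tau>) h = integral\<^sup>L lebesgue (\<lambda>r. W r *\<^sub>R h (\<tau> r))"
  proof -
    have "integral\<^sup>L (distr D borel \<tau>) h = integral\<^sup>L D (\<lambda>r. h (\<tau> r))"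
      using h \<tau>D by (intro integral_distr)
    also have "\<dots> = integral\<^sup>L lebesgue (\<lambda>r. W r *\<^sub>R h (\<tau> r))"
      unfolding D_def using h\<tau> wm Wnn by (intro integral_density)
    finally show ?thesis .
  qed
  have 3: "integrable lborel (\<lambda>x. indicator {\<tau> s..\<tau> t} x *\<^sub>R h x)"
    using 1 h unfolding eq by (subst (asm) integrable_density) auto
  have 4: "integral\<^sup>L (distr D borel \<tau>) h = integral\<^sup>L lborel (\<lambda>x. indicator {\<tau> s..\<tau> t} x *\<^sub>R h x)"
    unfolding eq using h by (intro integral_density) auto
  have 5: "integrable lebesgue (\<lambda>x. indicator {\<tau> s..\<tau> t} x *\<^sub>R h x)"
    using 3 by (subst integrable_completion) (use h in auto)
  then show habs: "h absolutely_integrable_on {\<tau> s..\<tau> t}"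
    by (simp add: set_integrable_def)
  have "integral {\<tau> s..\<tau> t} h = integral\<^sup>L lebesgue (\<lambda>x. indicator {\<tau> s..\<tau> t} x *\<^sub>R h x)"
    using set_lebesgue_integral_eq_integral(2)[OF habs] by (simp add: set_lebesgue_integral_def)
  also have "\<dots> = integral\<^sup>L lborel (\<lambda>x. indicator {\<tau> s..\<tau> t} x *\<^sub>R h x)"
    by (rule integral_completion) (use h in auto)
  also have "\<dots> = integral\<^sup>L lebesgue (\<lambda>r. W r *\<^sub>R h (\<tau> r))" using 2 4 by simp
  also have "\<dots> = integral {s..t} (\<lambda>r. h (\<tau> r) * w r)"
    unfolding Wh using set_lebesgue_integral_eq_integral(2)[OF int] by (simp add: set_lebesgue_integral_def)
  finally show "integral {\<tau> s..\<tau> t} h = integral {s..t} (\<lambda>r. h (\<tau> r) * w r)" .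
qed

section \<open>Optimisation over a rational parameter\<close>

text \<open>The minimum over real \<open>q\<close> is attained at \<open>sqrt (\<beta> / \<alpha>)\<close>. Only rational \<open>q\<close> are available when the hypothesis
comes from countably many exceptional null sets.\<close>

lemma mult_add_divide_le_sqrt:
  fixes \<alpha> \<beta> k y :: real
  assumes k: "0 \<le> k" and \<alpha>: "0 < \<alpha>" and \<beta>: "0 \<le> \<beta>"
    and le: "\<And>q. q \<in> \<rat> \<Longrightarrow> 0 < q \<Longrightarrow> y \<le> k * (\<alpha> * q + \<beta> / q)"
  shows "y \<le> 2 * k * sqrt (\<alpha> * \<beta>)"
proof -
  have real: "y \<le> k * (\<alpha> * q + \<beta> / q)" if q: "0 < q" for q
  proof (rule field_le_epsilon)
    fix e :: real assume e: "0 < e"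
    define d where "d = e / (k * \<alpha> + 1)"
    have ka: "0 < k * \<alpha> + 1" using k \<alpha> by (simp add: add_nonneg_pos)
    have d: "0 < d" "k * \<alpha> * d \<le> e"
    proof -
      show "0 < d" using e ka by (simp add: d_def)
      then show "k * \<alpha> * d \<le> e" unfolding d_def using e ka by (simp add: field_simps)
    qed
    obtain r where r: "r \<in> \<rat>" "q < r" "r < q + d" using Rats_dense_in_real[of q "q + d"] d(1) by auto
    have "y \<le> k * (\<alpha> * r + \<beta> / r)" using le r q by simp
    also have "\<dots> \<le> k * (\<alpha> * (q + d) + \<beta> / q)"
      using r q \<alpha> \<beta> k by (intro mult_left_mono add_mono divide_left_mono) auto
    also have "\<dots> = k * (\<alpha> * q + \<beta> / q) + k * \<alpha> * d" by (simp add: algebra_simps)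
    finally show "y \<le> k * (\<alpha> * q + \<beta> / q) + e" using d(2) by simp
  qed
  show ?thesis
  proof (cases "\<beta> = 0")
    case True
    have "y \<le> 0 + e" if e: "0 < e" for e
    proof -
      have ka: "0 < k * \<alpha> + 1" using k \<alpha> by (simp add: add_nonneg_pos)
      have "y \<le> k * (\<alpha> * (e / (k * \<alpha> + 1)))" using real[of "e / (k * \<alpha> + 1)"] True e ka by simp
      also have "\<dots> \<le> e" using e ka by (simp add: field_simps)
      finally show ?thesis by simp
    qed
    then have "y \<le> 0" by (rule field_le_epsilon)
    then show ?thesis using True by simp
  next
    case False
    then have b: "0 < \<beta>" using \<beta> by simp
    define q where "q = sqrt \<beta> / sqrt \<alpha>"
    have "\<alpha> * q = sqrt \<alpha> * sqrt \<beta>" unfolding q_def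
      using \<alpha> real_sqrt_mult_self[of \<alpha>] by (simp add: field_simps)
    moreover have "\<beta> / q = sqrt \<alpha> * sqrt \<beta>" unfolding q_def
      using b \<alpha> real_sqrt_mult_self[of \<beta>] by (simp add: field_simps)
    ultimately show ?thesis using real[of q] \<alpha> b by (simp add: q_def real_sqrt_mult algebra_simps)
  qed
qed

section \<open>Curves of finite weighted energy\<close>

lemma WED_curves_AC:
  assumes "u \<in> WED_curves \<epsilon> x"
  shows "AC 1 {0..T} edist u"
proof (cases "0 \<le> T")
  case True
  then show ?thesis using assms unfolding WED_curves_def AC_loc_def by (intro AC_2_imp_1) auto
next
  case False
  then show ?thesis by (intro AC_1_intro[of "\<lambda>_. 0"]) auto
qed

lemma WED_curves_sq_measurable:
  assumes "u \<in> WED_curves \<epsilon> x"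
  shows "(\<lambda>t. (metric_deriv u t)\<^sup>2) \<in> borel_measurable (lebesgue_on {0..})"
proof (rule measurable_half_line)
  fix n :: nat
  have "speed u \<in> borel_measurable (lebesgue_on {0..real n})"
    by (rule integrable_imp_measurable[OF AC_speed_integrable[OF WED_curves_AC[OF assms]]])
  then have "(\<lambda>t. (speed u t)\<^sup>2) \<in> borel_measurable (lebesgue_on {0..real n})" by measurable
  then show "(\<lambda>t. (metric_deriv u t)\<^sup>2) \<in> borel_measurable (lebesgue_on {0..real n})" by simp
qed

lemma WED_curves_sq:
  assumes u: "u \<in> WED_curves \<epsilon> x" and \<epsilon>: "\<epsilon> > 0"
  shows "(\<lambda>t. wt \<epsilon> t * (metric_deriv u t)\<^sup>2) absolutely_integrable_on {0..}"
proof -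
  note m = WED_curves_sq_measurable[OF u]
  have "integrable (exp_measure \<epsilon>) (\<lambda>t. (metric_deriv u t)\<^sup>2)"
    using u exp_measure_measurable[OF m, of \<epsilon>] unfolding WED_curves_def
    by (intro integrableI_nonneg) auto
  then show ?thesis using exp_measure_integrable_iff(1)[OF \<epsilon> m] by blast
qed

lemma WED_curvesI:
  assumes \<epsilon>: "\<epsilon> > 0" and ac: "\<And>T. 0 \<le> T \<Longrightarrow> AC 1 {0..T} edist u"
    and sq: "(\<lambda>t. wt \<epsilon> t * (metric_deriv u t)\<^sup>2) absolutely_integrable_on {0..}"
  shows "u \<in> WED_curves \<epsilon> (u 0)"
  unfolding WED_curves_def AC_loc_def
proof (intro CollectI conjI allI impI)
  fix c d :: real assume cd: "c \<le> d \<and> {c..d} \<subseteq> {0..}"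
  then have c: "0 \<le> c" "c \<le> d" by auto
  show "AC 2 {c..d} edist u"
  proof (rule AC_2_intro)
    show u: "AC 1 {c..d} edist u" using AC_1_subset[OF ac[of d], of c d] c by simp
    show "(\<lambda>t. (metric_deriv u t)\<^sup>2) integrable_on {c..d}"
    proof (rule measurable_bounded_by_integrable_imp_integrable)
      have "speed u \<in> borel_measurable (lebesgue_on {c..d})"
        by (rule integrable_imp_measurable[OF AC_speed_integrable[OF u]])
      then have "(\<lambda>t. (speed u t)\<^sup>2) \<in> borel_measurable (lebesgue_on {c..d})" by measurable
      then show "(\<lambda>t. (metric_deriv u t)\<^sup>2) \<in> borel_measurable (lebesgue_on {c..d})" by simp
      have "(\<lambda>t. wt \<epsilon> t * (metric_deriv u t)\<^sup>2) integrable_on {c..d}"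
        using set_lebesgue_integral_eq_integral(1)[OF set_integrable_subset[OF sq]] c by auto
      then show "(\<lambda>t. 1 / wt \<epsilon> d * (wt \<epsilon> t * (metric_deriv u t)\<^sup>2)) integrable_on {c..d}"
        by (rule integrable_on_mult_right)
      fix t assume t: "t \<in> {c..d}"
      have "wt \<epsilon> d \<le> wt \<epsilon> t" using t \<epsilon> by (auto simp: wt_def divide_right_mono)
      then have "1 \<le> 1 / wt \<epsilon> d * wt \<epsilon> t" using wt_pos[OF \<epsilon>, of d] by simp
      then have "1 * (metric_deriv u t)\<^sup>2 \<le> 1 / wt \<epsilon> d * wt \<epsilon> t * (metric_deriv u t)\<^sup>2"
        by (intro mult_right_mono) auto
      then show "norm ((metric_deriv u t)\<^sup>2) \<le> 1 / wt \<epsilon> d * (wt \<epsilon> t * (metric_deriv u t)\<^sup>2)"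
        by (simp add: mult.assoc)
    qed simp
  qed
next
  have "integrable (exp_measure \<epsilon>) (\<lambda>t. (metric_deriv u t)\<^sup>2)"
    by (rule exp_measure_integrableI[OF \<epsilon> sq])
  then show "(\<integral>\<^sup>+t. ennreal ((metric_deriv u t)\<^sup>2) \<partial>exp_measure \<epsilon>) < \<infinity>"
    by (simp add: integrable_iff_bounded)
qed simp

section \<open>The value function\<close>

text \<open>The bound on \<open>B\<close> is the one that lets \<open>\<epsilon> / 2\<close> times the integral of \<open>|u'|\<^sup>2\<close> absorb \<open>B\<close> times the integral of
\<open>dist (u t) (u 0)\<^sup>2\<close>, as the constant in the Hardy inequality is \<open>4 * \<epsilon>\<^sup>2\<close>.\<close>

locale weighted_dissipation =
  fixes \<phi> :: "'a::metric_space \<Rightarrow> ereal" and p\<^sub>0 :: 'a and A B \<epsilon> :: real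
  assumes closed_sublevel: "\<And>c. closed {x. \<phi> x \<le> c}"
    and coercive: "\<And>u v. ereal (- B * (dist u v)\<^sup>2 - (B * (dist v p\<^sub>0)\<^sup>2 + A)) \<le> \<phi> u"
    and B_nonneg: "0 \<le> B"
    and eps_pos: "0 < \<epsilon>"
    and B_small: "8 * \<epsilon> * B \<le> 1"
begin

abbreviation "V \<equiv> value_fun \<epsilon> \<phi>"
abbreviation "p x \<equiv> real_of_ereal (\<phi> x)"
abbreviation "Q x \<equiv> B * (dist x p\<^sub>0)\<^sup>2 + A"

lemma phi_not_MInf: "\<phi> x \<noteq> -\<infinity>"
  using coercive[of x x] by auto

text \<open>Coercivity with the reference point \<open>x = u 0\<close> gives the minorant, and the Hardy inequality the bound on its
integral. The minorant also makes the negative part of the WED integrand integrable.\<close>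

lemma WED_minorant:
  assumes u: "u \<in> WED_curves \<epsilon> x"
  obtains h where "integrable (exp_measure \<epsilon>) h"
    "\<And>t. ereal (h t) \<le> ereal (\<epsilon> / 2 * (metric_deriv u t)\<^sup>2) + \<phi> (u t)"
    "- Q x \<le> integral\<^sup>L (exp_measure \<epsilon>) h"
proof -
  note sq = WED_curves_sq[OF u eps_pos]
  have u0: "u 0 = x" using u by (simp add: WED_curves_def)
  have sqT: "(\<lambda>t. wt \<epsilon> t * (metric_deriv u t)\<^sup>2) integrable_on {0..T}" for T
    using set_lebesgue_integral_eq_integral(1)[OF set_integrable_subset[OF sq, of "{0..T}"]] by auto
  define I where "I = integral {0..} (\<lambda>t. wt \<epsilon> t * (metric_deriv u t)\<^sup>2)"
  define d where "d t = wt \<epsilon> t * (dist (u t) x)\<^sup>2" for t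
  have nn: "0 \<le> wt \<epsilon> t * (r::real)\<^sup>2" for t r using wt_pos[OF eps_pos, of t] by simp
  have "integral {0..real n} d \<le> 4 * \<epsilon>\<^sup>2 * I" for n
  proof -
    have "integral {0..real n} d \<le> 4 * \<epsilon>\<^sup>2 * integral {0..real n} (\<lambda>t. wt \<epsilon> t * (metric_deriv u t)\<^sup>2)"
      unfolding d_def u0[symmetric] by (rule weighted_hardy[OF WED_curves_AC[OF u] eps_pos _ sqT]) simp
    also have "\<dots> \<le> 4 * \<epsilon>\<^sup>2 * I" unfolding I_def
      using sq nn by (intro mult_left_mono integral_subset_le sqT) (auto dest: set_lebesgue_integral_eq_integral(1))
    finally show ?thesis .
  qed
  moreover have "d integrable_on {0..real n}" for n
    unfolding d_def[abs_def]
    by (intro integrable_continuous_real continuous_intros wt_continuous AC_continuous[OF WED_curves_AC[OF u]])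
  ultimately have d: "d integrable_on {0..}" "integral {0..} d \<le> 4 * \<epsilon>\<^sup>2 * I"
    using integrable_half_line[of d "4 * \<epsilon>\<^sup>2 * I"] nn by (auto simp: d_def)
  have dabs: "d absolutely_integrable_on {0..}"
    using d(1) nn by (intro nonnegative_absolutely_integrable_1) (auto simp: d_def)
  have wabs: "wt \<epsilon> absolutely_integrable_on {0..}"
    using wt_integrable[OF eps_pos] wt_pos[OF eps_pos]
    by (intro nonnegative_absolutely_integrable_1) (auto intro: less_imp_le simp: integrable_on_def)
  define h where "h t = \<epsilon> / 2 * (metric_deriv u t)\<^sup>2 - B * (dist (u t) x)\<^sup>2 - Q x" for t
  have wh: "(\<lambda>t. wt \<epsilon> t * h t) = (\<lambda>t. \<epsilon> / 2 * (wt \<epsilon> t * (metric_deriv u t)\<^sup>2) - B * d t - Q x * wt \<epsilon> t)"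
    by (intro ext) (simp add: h_def d_def algebra_simps)
  have habs: "(\<lambda>t. wt \<epsilon> t * h t) absolutely_integrable_on {0..}"
    unfolding wh by (intro set_integral_diff set_integrable_mult_right impI sq dabs wabs)
  have sq': "(\<lambda>t. wt \<epsilon> t * (metric_deriv u t)\<^sup>2) integrable_on {0..}"
    using sq by (rule set_lebesgue_integral_eq_integral(1))
  have "((\<lambda>t. wt \<epsilon> t * h t) has_integral (\<epsilon> / 2 * I - B * integral {0..} d - Q x * 1)) {0..}"
    unfolding wh I_def by (intro has_integral_diff has_integral_mult_right integrable_integral sq' d(1) wt_integrable eps_pos)
  then have "integral {0..} (\<lambda>t. wt \<epsilon> t * h t) = \<epsilon> / 2 * I - B * integral {0..} d - Q x"
    by (simp add: integral_unique)
  moreover have "B * integral {0..} d \<le> B * (4 * \<epsilon>\<^sup>2 * I)"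
    using d(2) B_nonneg by (rule mult_left_mono)
  moreover have "B * (4 * \<epsilon>\<^sup>2 * I) \<le> \<epsilon> / 2 * I"
  proof -
    have "0 \<le> I" unfolding I_def by (rule integral_nonneg[OF sq' nn])
    then have "(8 * \<epsilon> * B) * (\<epsilon> * I / 2) \<le> 1 * (\<epsilon> * I / 2)"
      using B_small eps_pos by (intro mult_right_mono) auto
    then show ?thesis by (simp add: power2_eq_square algebra_simps)
  qed
  ultimately have "- Q x \<le> integral {0..} (\<lambda>t. wt \<epsilon> t * h t)" by linarith
  moreover have "ereal (h t) \<le> ereal (\<epsilon> / 2 * (metric_deriv u t)\<^sup>2) + \<phi> (u t)" for t
    using add_left_mono[OF coercive[of "u t" x], of "ereal (\<epsilon> / 2 * (metric_deriv u t)\<^sup>2)"]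
    by (simp add: h_def algebra_simps)
  ultimately show thesis
    using that[of h] exp_measure_integrableI[OF eps_pos habs] by simp
qed

lemma value_fun_ge: "ereal (- Q x) \<le> V x"
  unfolding value_fun_def
proof (rule INF_greatest)
  fix u assume u: "u \<in> WED_curves \<epsilon> x"
  obtain h where h: "integrable (exp_measure \<epsilon>) h"
    "\<And>t. ereal (h t) \<le> ereal (\<epsilon> / 2 * (metric_deriv u t)\<^sup>2) + \<phi> (u t)"
    "- Q x \<le> integral\<^sup>L (exp_measure \<epsilon>) h"
    using WED_minorant[OF u] by blast
  have "ereal (- Q x) \<le> ext_integral (exp_measure \<epsilon>) (\<lambda>t. ereal (h t))"
    using h by (simp add: ext_integral_ereal)
  also have "\<dots> \<le> WED \<epsilon> \<phi> u"
    unfolding WED_def by (intro ext_integral_mono AE_I2 h(2))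
  finally show "ereal (- Q x) \<le> WED \<epsilon> \<phi> u" .
qed

lemma value_fun_not_MInf: "V x \<noteq> -\<infinity>"
  using value_fun_ge[of x] by auto

lemma metric_deriv_const: "metric_deriv (\<lambda>_. x) t = 0"
  unfolding metric_deriv_def by (rule tendsto_Lim) auto

lemma const_WED_curve: "(\<lambda>_. x) \<in> WED_curves \<epsilon> x"
proof (rule WED_curvesI[OF eps_pos, of "\<lambda>_. x"])
  show "AC 1 {0..T} edist (\<lambda>_. x)" for T
    by (rule AC_1_intro[of "\<lambda>_. 0"]) auto
qed (simp add: metric_deriv_const)

lemma value_fun_le_phi: "V x \<le> \<phi> x"
proof (cases "\<phi> x")
  case (real r)
  have "(\<lambda>t. wt \<epsilon> t * r) absolutely_integrable_on {0..}"
    using wt_integrable[OF eps_pos] wt_pos[OF eps_pos]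
    by (intro set_integrable_mult_left impI nonnegative_absolutely_integrable_1) (auto intro: less_imp_le simp: integrable_on_def)
  note r = exp_measure_integrableI[OF eps_pos this]
  have "integral {0..} (\<lambda>t. wt \<epsilon> t * r) = r"
    by (rule integral_unique) (use has_integral_mult_left[OF wt_integrable[OF eps_pos], of r] in simp)
  then have "ext_integral (exp_measure \<epsilon>) (\<lambda>_. ereal r) = ereal r"
    by (simp only: ext_integral_ereal[OF r(1)] r(2))
  then have "WED \<epsilon> \<phi> (\<lambda>_. x) = ereal r"
    unfolding WED_def metric_deriv_const using real by simp
  then show ?thesis
    unfolding value_fun_def using const_WED_curve real by (metis INF_lower)
qed (use phi_not_MInf in auto)

lemma WED_real:
  assumes u: "u \<in> WED_curves \<epsilon> x" and fin: "WED \<epsilon> \<phi> u < \<infinity>"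
  shows "AE t in lebesgue_on {0..}. \<phi> (u t) = ereal (p (u t))"
    and "(\<lambda>t. wt \<epsilon> t * (\<epsilon> / 2 * (metric_deriv u t)\<^sup>2 + p (u t))) absolutely_integrable_on {0..}"
    and "WED \<epsilon> \<phi> u = ereal (integral {0..} (\<lambda>t. wt \<epsilon> t * (\<epsilon> / 2 * (metric_deriv u t)\<^sup>2 + p (u t))))"
proof -
  define f where "f t = ereal (\<epsilon> / 2 * (metric_deriv u t)\<^sup>2) + \<phi> (u t)" for t
  define g where "g t = \<epsilon> / 2 * (metric_deriv u t)\<^sup>2 + p (u t)" for t
  have phim: "(\<lambda>t. \<phi> (u t)) \<in> borel_measurable (lebesgue_on {0..})"
    by (intro measurable_half_line lsc_curve_measurable closed_sublevel AC_continuous[OF WED_curves_AC[OF u]]) auto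
  have fm: "f \<in> borel_measurable (lebesgue_on {0..})"
    unfolding f_def using phim WED_curves_sq_measurable[OF u] by measurable
  have gm: "g \<in> borel_measurable (lebesgue_on {0..})"
    unfolding g_def using phim WED_curves_sq_measurable[OF u] by measurable
  obtain h where h: "integrable (exp_measure \<epsilon>) h" "\<And>t. ereal (h t) \<le> f t"
    using WED_minorant[OF u] unfolding f_def by metis
  have fin': "ext_integral (exp_measure \<epsilon>) f < \<infinity>" using fin unfolding WED_def f_def .
  note F = ext_integral_finite[OF h(1) AE_I2[OF h(2)] exp_measure_measurable[OF fm] fin']
  from F(1) have ae: "AE t in exp_measure \<epsilon>. \<phi> (u t) = ereal (p (u t))"
    unfolding f_def
  proof eventually_elim
    case (elim t)
    then show ?case by (cases "\<phi> (u t)") (use phi_not_MInf in auto)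
  qed
  then show ae': "AE t in lebesgue_on {0..}. \<phi> (u t) = ereal (p (u t))"
    by (simp add: AE_exp_measure_iff[OF eps_pos])
  have fg: "AE t in exp_measure \<epsilon>. real_of_ereal (f t) = g t"
    using ae
  proof eventually_elim
    case (elim t)
    show ?case unfolding f_def g_def by (subst elim) simp
  qed
  have gi: "integrable (exp_measure \<epsilon>) g"
    using F(2) by (rule integrable_cong_AE_imp) (use fg exp_measure_measurable[OF gm] in auto)
  then show gabs: "(\<lambda>t. wt \<epsilon> t * (\<epsilon> / 2 * (metric_deriv u t)\<^sup>2 + p (u t))) absolutely_integrable_on {0..}"
    using exp_measure_integrable_iff(1)[OF eps_pos gm] by (simp add: g_def)
  have "WED \<epsilon> \<phi> u = ereal (integral\<^sup>L (exp_measure \<epsilon>) g)"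
  proof -
    have "integral\<^sup>L (exp_measure \<epsilon>) (\<lambda>t. real_of_ereal (f t)) = integral\<^sup>L (exp_measure \<epsilon>) g"
      by (rule integral_cong_AE[OF borel_measurable_integrable[OF F(2)] borel_measurable_integrable[OF gi] fg])
    then show ?thesis using F(3) unfolding WED_def f_def by simp
  qed
  then show "WED \<epsilon> \<phi> u = ereal (integral {0..} (\<lambda>t. wt \<epsilon> t * (\<epsilon> / 2 * (metric_deriv u t)\<^sup>2 + p (u t))))"
    using exp_measure_integrableI(2)[OF eps_pos gabs] by (simp add: g_def[abs_def])
qed

text \<open>The competitor runs along \<open>\<theta>\<close> up to time \<open>T\<close> and then along a competitor for \<open>\<theta> T\<close>, whose action is discounted
by \<open>exp (- T / \<epsilon>)\<close>. The real function \<open>L\<close> majorises the action density of \<open>\<theta>\<close>, which may be infinite on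
a null set.\<close>

theorem value_fun_concat:
  assumes \<theta>: "AC 1 {0..T} edist \<theta>" and T: "0 \<le> T"
    and sq: "(\<lambda>t. (metric_deriv \<theta> t)\<^sup>2) integrable_on {0..T}"
    and L: "(\<lambda>t. wt \<epsilon> t * L t) absolutely_integrable_on {0..T}"
    and le: "AE t in lebesgue_on {0..T}. ereal (\<epsilon> / 2 * (metric_deriv \<theta> t)\<^sup>2) + \<phi> (\<theta> t) \<le> ereal (L t)"
  shows "V (\<theta> 0) \<le> ereal (integral {0..T} (\<lambda>t. wt \<epsilon> t * L t)) + ereal (exp (- T / \<epsilon>)) * V (\<theta> T)"
proof -
  let ?I = "integral {0..T} (\<lambda>t. wt \<epsilon> t * L t)"
  have main: "V (\<theta> 0) \<le> ereal ?I + ereal (exp (- T / \<epsilon>)) * WED \<epsilon> \<phi> v"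
    if v: "v \<in> WED_curves \<epsilon> (\<theta> T)" and fin: "WED \<epsilon> \<phi> v < \<infinity>" for v
  proof -
    have v0: "v 0 = \<theta> T" using v by (simp add: WED_curves_def)
    define \<omega> where "\<omega> t = (if t < T then \<theta> t else v (t - T))" for t
    have \<omega>\<theta>: "\<omega> t = \<theta> t" if "t \<le> T" for t using that v0 by (auto simp: \<omega>_def)
    have ac: "AC 1 {0..S} edist \<omega>" if "0 \<le> S" for S
    proof (rule AC_1_subset)
      show "AC 1 {0..T + S} edist \<omega>"
      proof (rule AC_1_concat[of 0 T])
        show "AC 1 {0..T} edist \<omega>" using \<theta> AC_cong[of "{0..T}" \<omega> \<theta>] \<omega>\<theta> by simp
        have "AC 1 {T + 0..T + S} edist (\<lambda>t. v (t - T))"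
          by (rule AC_1_shift[OF WED_curves_AC[OF v]])
        then show "AC 1 {T..T + S} edist \<omega>"
          using AC_cong[of "{T..T + S}" \<omega> "\<lambda>t. v (t - T)"] by (simp add: \<omega>_def)
      qed (use T that in auto)
    qed (use T in auto)
    have md1: "metric_deriv \<omega> t = metric_deriv \<theta> t" if "t < T" for t
      by (rule metric_deriv_cong_open[of "{..<T}"]) (use that in \<open>auto simp: \<omega>_def\<close>)
    have md2: "metric_deriv \<omega> t = metric_deriv v (t - T)" if "T < t" for t
      unfolding metric_deriv_shift[symmetric]
      by (rule metric_deriv_cong_open[of "{T<..}"]) (use that in \<open>auto simp: \<omega>_def\<close>)
    have wT: "wt \<epsilon> t = exp (- T / \<epsilon>) * wt \<epsilon> (t - T)" for t
      using wt_shift[of \<epsilon> T "t - T"] by simp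
    have sq1: "(\<lambda>t. wt \<epsilon> t * (metric_deriv \<theta> t)\<^sup>2) absolutely_integrable_on {0..T}"
    proof (rule measurable_bounded_by_integrable_imp_absolutely_integrable)
      show "(\<lambda>t. wt \<epsilon> t * (metric_deriv \<theta> t)\<^sup>2) \<in> borel_measurable (lebesgue_on {0..T})"
        using wt_measurable integrable_imp_measurable[OF sq] by measurable
      show "(\<lambda>t. 1 / \<epsilon> * (metric_deriv \<theta> t)\<^sup>2) integrable_on {0..T}"
        using sq by (rule integrable_on_mult_right)
      show "norm (wt \<epsilon> t * (metric_deriv \<theta> t)\<^sup>2) \<le> 1 / \<epsilon> * (metric_deriv \<theta> t)\<^sup>2" if "t \<in> {0..T}" for t
        using that wt_le[OF eps_pos, of t] wt_pos[OF eps_pos, of t] eps_pos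
        by (simp only: norm_mult) (intro mult_mono, auto)
    qed simp
    have sq2: "(\<lambda>t. exp (- T / \<epsilon>) * (wt \<epsilon> t * (metric_deriv v t)\<^sup>2)) absolutely_integrable_on {0..}"
      by (intro set_integrable_mult_right impI WED_curves_sq[OF v eps_pos])
    have sq\<omega>: "(\<lambda>t. wt \<epsilon> t * (metric_deriv \<omega> t)\<^sup>2) absolutely_integrable_on {0..}"
    proof (rule absolutely_integrable_spike[OF absolutely_integrable_concat(1)[OF sq1 sq2 T], of "{T}"])
      show "wt \<epsilon> t * (metric_deriv \<omega> t)\<^sup>2 = (if t < T then wt \<epsilon> t * (metric_deriv \<theta> t)\<^sup>2
          else exp (- T / \<epsilon>) * (wt \<epsilon> (t - T) * (metric_deriv v (t - T))\<^sup>2))" if "t \<in> {0..} - {T}" for t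
        using that by (cases "t < T") (simp_all add: md1 md2 wT[of t])
    qed simp
    have "\<omega> \<in> WED_curves \<epsilon> (\<omega> 0)"
      by (rule WED_curvesI[OF eps_pos ac sq\<omega>])
    then have \<omega>: "\<omega> \<in> WED_curves \<epsilon> (\<theta> 0)" using \<omega>\<theta> T by simp
    define l where "l t = \<epsilon> / 2 * (metric_deriv v t)\<^sup>2 + p (v t)" for t
    note W = WED_real[OF v fin, folded l_def]
    have W2: "(\<lambda>t. exp (- T / \<epsilon>) * (wt \<epsilon> t * l t)) absolutely_integrable_on {0..}"
      by (intro set_integrable_mult_right impI W(2))
    define k where "k t = (if t < T then L t else l (t - T))" for t
    have wk: "(\<lambda>t. wt \<epsilon> t * k t) = (\<lambda>t. if t < T then wt \<epsilon> t * L t else exp (- T / \<epsilon>) * (wt \<epsilon> (t - T) * l (t - T)))"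
    proof
      show "wt \<epsilon> t * k t = (if t < T then wt \<epsilon> t * L t else exp (- T / \<epsilon>) * (wt \<epsilon> (t - T) * l (t - T)))" for t
        using wT[of t] by (simp add: k_def)
    qed
    note K = absolutely_integrable_concat[OF L W2 T, folded wk]
    have "AE t in lebesgue_on {0..}. ereal (\<epsilon> / 2 * (metric_deriv \<omega> t)\<^sup>2) + \<phi> (\<omega> t) \<le> ereal (k t)"
    proof (rule AE_Icc_Ici)
      show "AE t in lebesgue_on {0..T}. t < T \<longrightarrow> ereal (\<epsilon> / 2 * (metric_deriv \<omega> t)\<^sup>2) + \<phi> (\<omega> t) \<le> ereal (k t)"
        using le by eventually_elim (auto simp: md1 \<omega>_def k_def)
      show "AE t in lebesgue_on {T..}. T < t \<longrightarrow> ereal (\<epsilon> / 2 * (metric_deriv \<omega> t)\<^sup>2) + \<phi> (\<omega> t) \<le> ereal (k t)"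
        using AE_shift[OF W(1), of T]
      proof eventually_elim
        case (elim t)
        show ?case using elim by (auto simp: md2 \<omega>_def k_def l_def) (metis order_refl plus_ereal.simps(1))
      qed
    qed
    then have "WED \<epsilon> \<phi> \<omega> \<le> ext_integral (exp_measure \<epsilon>) (\<lambda>t. ereal (k t))"
      unfolding WED_def by (intro ext_integral_mono) (simp add: AE_exp_measure_iff[OF eps_pos])
    also have "\<dots> = ereal (integral {0..} (\<lambda>t. wt \<epsilon> t * k t))"
      using exp_measure_integrableI[OF eps_pos K(1)] by (simp add: ext_integral_ereal)
    also have "\<dots> = ereal ?I + ereal (exp (- T / \<epsilon>)) * WED \<epsilon> \<phi> v"
      unfolding K(2) W(3) by simp
    finally show ?thesis
      unfolding value_fun_def using \<omega> by (meson INF_lower order_trans)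
  qed
  show ?thesis
  proof (cases "V (\<theta> T)")
    case PInf
    then show ?thesis by simp
  next
    case (real r)
    show ?thesis
    proof (rule ereal_le_epsilon2)
      fix e :: real assume e: "0 < e"
      have "V (\<theta> T) < ereal (r + e)" using real e by simp
      then obtain v where v: "v \<in> WED_curves \<epsilon> (\<theta> T)" "WED \<epsilon> \<phi> v < ereal (r + e)"
        unfolding value_fun_def INF_less_iff by blast
      then have "V (\<theta> 0) \<le> ereal ?I + ereal (exp (- T / \<epsilon>)) * WED \<epsilon> \<phi> v"
        by (intro main) (auto intro: less_trans)
      also have "\<dots> \<le> ereal ?I + ereal (exp (- T / \<epsilon>)) * ereal (r + e)"
        using v(2) by (intro add_left_mono ereal_mult_left_mono) auto
      also have "\<dots> \<le> ereal ?I + ereal (exp (- T / \<epsilon>)) * V (\<theta> T) + ereal e"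
        using mult_right_mono[of "exp (- T / \<epsilon>)" 1 e] T eps_pos e by (simp add: real algebra_simps)
      finally show "V (\<theta> 0) \<le> ereal ?I + ereal (exp (- T / \<epsilon>)) * V (\<theta> T) + ereal e" .
    qed
  qed (use value_fun_not_MInf in auto)
qed

section \<open>Finsler curves and dynamic programming\<close>

text \<open>The weight of the Finsler distance. The conversion to the reals makes it \<open>0\<close> where \<open>\<phi> = \<infinity>\<close>, and at least
\<open>1\<close> elsewhere.\<close>

definition S :: "'a \<Rightarrow> real" where
  "S x = sqrt (real_of_ereal (max (\<phi> x) 1))"

lemma S_PInf: "\<phi> x = \<infinity> \<Longrightarrow> S x = 0"
  by (simp add: S_def)

lemma S_finite:
  assumes "\<phi> x \<noteq> \<infinity>"
  shows "(S x)\<^sup>2 = max (p x) 1" "1 \<le> S x"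
proof -
  obtain r where r: "\<phi> x = ereal r" using assms phi_not_MInf[of x] by (cases "\<phi> x") auto
  have "max (\<phi> x) 1 = ereal (max r 1)" by (cases "r \<le> 1") (simp_all add: r one_ereal_def max_def)
  then have "S x = sqrt (max r 1)" unfolding S_def by (simp only: real_of_ereal.simps)
  then show "(S x)\<^sup>2 = max (p x) 1" "1 \<le> S x" by (simp_all add: r)
qed

lemma S_nonneg: "0 \<le> S x"
  using S_PInf[of x] S_finite(2)[of x] by (cases "\<phi> x = \<infinity>") auto

lemma S_eq_0_iff: "S x = 0 \<longleftrightarrow> \<phi> x = \<infinity>"
  by (cases "\<phi> x = \<infinity>") (use S_PInf[of x] S_finite(2)[of x] in auto)

text \<open>Curves of finite Finsler length. The last condition accounts for the convention \<open>\<infinity> \<cdot> 0 = 0\<close>: time may be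
spent where \<open>\<phi> = \<infinity>\<close> only without moving.\<close>

definition finsler_curve :: "real \<Rightarrow> real \<Rightarrow> (real \<Rightarrow> 'a) \<Rightarrow> bool" where
  "finsler_curve a b u \<longleftrightarrow> AC 1 {a..b} edist u \<and> (\<lambda>t. S (u t) * speed u t) integrable_on {a..b} \<and>
     (AE t in lebesgue_on {a..b}. \<phi> (u t) = \<infinity> \<longrightarrow> metric_deriv u t = 0)"

lemma finsler_curveD:
  assumes "finsler_curve a b u"
  shows "AC 1 {a..b} edist u" "(\<lambda>t. S (u t) * speed u t) integrable_on {a..b}"
    "AE t in lebesgue_on {a..b}. \<phi> (u t) = \<infinity> \<longrightarrow> metric_deriv u t = 0"
  using assms unfolding finsler_curve_def by blast+

lemma finsler_curve_subset:
  assumes "finsler_curve a b u" "a \<le> c" "d \<le> b"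
  shows "finsler_curve c d u"
  unfolding finsler_curve_def
proof (intro conjI)
  note F = finsler_curveD[OF assms(1)]
  show "AC 1 {c..d} edist u" using AC_1_subset[OF F(1)] assms by blast
  show "(\<lambda>t. S (u t) * speed u t) integrable_on {c..d}"
    using assms by (intro integrable_subinterval_real[OF F(2)]) auto
  show "AE t in lebesgue_on {c..d}. \<phi> (u t) = \<infinity> \<longrightarrow> metric_deriv u t = 0"
    using assms by (intro AE_lebesgue_on_subset[OF F(3)]) auto
qed

lemma phi_curve_measurable:
  assumes "AC 1 {a..b} edist u"
  shows "(\<lambda>t. \<phi> (u t)) \<in> borel_measurable (lebesgue_on {a..b})"
  by (intro lsc_curve_measurable closed_sublevel AC_continuous[OF assms]) auto

lemma S_curve_measurable:
  assumes "AC 1 {a..b} edist u"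
  shows "(\<lambda>t. S (u t)) \<in> borel_measurable (lebesgue_on {a..b})"
    "(\<lambda>t. p (u t)) \<in> borel_measurable (lebesgue_on {a..b})"
    "speed u \<in> borel_measurable (lebesgue_on {a..b})"
proof -
  note [measurable] = phi_curve_measurable[OF assms]
  show "(\<lambda>t. S (u t)) \<in> borel_measurable (lebesgue_on {a..b})" unfolding S_def by measurable
  show "(\<lambda>t. p (u t)) \<in> borel_measurable (lebesgue_on {a..b})" by measurable
qed (rule integrable_imp_measurable[OF AC_speed_integrable[OF assms]])

lemma phi_curve_bound:
  assumes u: "AC 1 {a..b} edist u"
  obtains K where "0 \<le> K" "\<And>t. t \<in> {a..b} \<Longrightarrow> \<phi> (u t) \<noteq> \<infinity> \<Longrightarrow> \<bar>p (u t)\<bar> \<le> K * (S (u t))\<^sup>2"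
proof -
  have "compact ((\<lambda>t. dist (u t) (u a)) ` {a..b})"
    by (intro compact_continuous_image continuous_intros AC_continuous[OF u]) simp
  then obtain R where R: "\<And>t. t \<in> {a..b} \<Longrightarrow> dist (u t) (u a) \<le> R"
    using bounded_real[THEN iffD1, OF compact_imp_bounded] by (metis abs_le_D1 imageI)
  define K where "K = 1 + \<bar>B * R\<^sup>2\<bar> + \<bar>Q (u a)\<bar>"
  have K: "1 \<le> K" by (simp add: K_def)
  show thesis
  proof (rule that)
    show "0 \<le> K" using K by simp
    fix t assume t: "t \<in> {a..b}" and fin: "\<phi> (u t) \<noteq> \<infinity>"
    obtain r where r: "\<phi> (u t) = ereal r" using fin phi_not_MInf[of "u t"] by (cases "\<phi> (u t)") auto
    have "B * (dist (u t) (u a))\<^sup>2 \<le> B * R\<^sup>2"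
      using R[OF t] B_nonneg by (intro mult_left_mono power_mono) auto
    then have low: "- r \<le> K" using coercive[of "u t" "u a"] unfolding K_def r by simp
    have "(S (u t))\<^sup>2 = max r 1" using S_finite(1)[OF fin] r by simp
    moreover have "\<bar>r\<bar> \<le> K * max r 1"
    proof (cases "1 \<le> r")
      case True
      then show ?thesis using K mult_right_mono[of 1 K r] by simp
    next
      case False
      then show ?thesis using low K by simp
    qed
    ultimately show "\<bar>p (u t)\<bar> \<le> K * (S (u t))\<^sup>2" using r by simp
  qed
qed

text \<open>The amount of new time per unit of old time when \<open>u\<close> is traversed with speed \<open>q * S\<close>, and the action
density of the new curve with respect to the old time. Both vanish where \<open>\<phi> = \<infinity>\<close>, because \<open>S\<close> is \<open>0\<close> there.\<close>

definition rate :: "real \<Rightarrow> (real \<Rightarrow> 'a) \<Rightarrow> real \<Rightarrow> real" where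
  "rate q u t = speed u t / (q * S (u t))"

definition cost :: "real \<Rightarrow> (real \<Rightarrow> 'a) \<Rightarrow> real \<Rightarrow> real" where
  "cost q u t = (\<epsilon> / 2 * q\<^sup>2 * (S (u t))\<^sup>2 + p (u t)) * rate q u t"

lemma rate_nonneg: "0 < q \<Longrightarrow> 0 \<le> rate q u t"
  using S_nonneg by (simp add: rate_def)

lemma S_sq_rate: "0 < q \<Longrightarrow> (S (u t))\<^sup>2 * rate q u t = S (u t) * speed u t / q"
  by (simp add: rate_def power2_eq_square)

lemma rate_le: "0 < q \<Longrightarrow> rate q u t \<le> 1 / q * (S (u t) * speed u t)"
proof -
  assume q: "0 < q"
  have "rate q u t = 1 / q * (speed u t / S (u t))" by (simp add: rate_def)
  also have "\<dots> \<le> 1 / q * (S (u t) * speed u t)"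
  proof (cases "\<phi> (u t) = \<infinity>")
    case False
    have "speed u t / S (u t) \<le> speed u t / 1"
      using S_finite(2)[OF False] by (intro divide_left_mono) auto
    also have "\<dots> \<le> S (u t) * speed u t"
      using mult_right_mono[OF S_finite(2)[OF False], of "speed u t"] by simp
    finally show ?thesis using q by (intro mult_left_mono) auto
  qed (simp add: S_PInf)
  finally show ?thesis .
qed

lemma rate_integrable:
  assumes u: "finsler_curve a b u" and q: "0 < q"
  shows "rate q u integrable_on {a..b}"
proof (rule measurable_bounded_by_integrable_imp_integrable)
  note [measurable] = S_curve_measurable[OF finsler_curveD(1)[OF u]]
  show "rate q u \<in> borel_measurable (lebesgue_on {a..b})" unfolding rate_def[abs_def] by measurable
  show "(\<lambda>t. 1 / q * (S (u t) * speed u t)) integrable_on {a..b}"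
    by (rule integrable_on_mult_right[OF finsler_curveD(2)[OF u]])
  show "norm (rate q u t) \<le> 1 / q * (S (u t) * speed u t)" for t
    using rate_le[OF q, of u t] rate_nonneg[OF q, of u t] by simp
qed simp

lemma cost_integrable:
  assumes u: "finsler_curve a b u" and q: "0 < q"
  shows "cost q u absolutely_integrable_on {a..b}"
proof -
  note [measurable] = S_curve_measurable[OF finsler_curveD(1)[OF u]]
  obtain K where K: "0 \<le> K" "\<And>t. t \<in> {a..b} \<Longrightarrow> \<phi> (u t) \<noteq> \<infinity> \<Longrightarrow> \<bar>p (u t)\<bar> \<le> K * (S (u t))\<^sup>2"
    using phi_curve_bound[OF finsler_curveD(1)[OF u]] by blast
  show ?thesis
  proof (rule measurable_bounded_by_integrable_imp_absolutely_integrable)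
    show "cost q u \<in> borel_measurable (lebesgue_on {a..b})" unfolding cost_def[abs_def] rate_def[abs_def] by measurable
    show "(\<lambda>t. (\<epsilon> / 2 * q\<^sup>2 + K) / q * (S (u t) * speed u t)) integrable_on {a..b}"
      by (rule integrable_on_mult_right[OF finsler_curveD(2)[OF u]])
    fix t assume t: "t \<in> {a..b}"
    show "norm (cost q u t) \<le> (\<epsilon> / 2 * q\<^sup>2 + K) / q * (S (u t) * speed u t)"
    proof (cases "\<phi> (u t) = \<infinity>")
      case False
      have "\<bar>\<epsilon> / 2 * q\<^sup>2 * (S (u t))\<^sup>2 + p (u t)\<bar> \<le> \<epsilon> / 2 * q\<^sup>2 * (S (u t))\<^sup>2 + K * (S (u t))\<^sup>2"
      proof -
        have "0 \<le> \<epsilon> / 2 * q\<^sup>2 * (S (u t))\<^sup>2" using eps_pos by simp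
        then show ?thesis using K(2)[OF t False] by linarith
      qed
      then have "norm (cost q u t) \<le> (\<epsilon> / 2 * q\<^sup>2 * (S (u t))\<^sup>2 + K * (S (u t))\<^sup>2) * rate q u t"
        unfolding cost_def real_norm_def abs_mult using rate_nonneg[OF q, of u t]
        by (metis abs_of_nonneg mult_right_mono)
      also have "\<dots> = (\<epsilon> / 2 * q\<^sup>2 + K) * ((S (u t))\<^sup>2 * rate q u t)" by (simp add: algebra_simps)
      also have "\<dots> = (\<epsilon> / 2 * q\<^sup>2 + K) / q * (S (u t) * speed u t)" unfolding S_sq_rate[OF q] by simp
      finally show ?thesis .
    qed (simp add: cost_def rate_def S_PInf)
  qed simp
qed

lemma rate_integral_nonneg:
  assumes u: "finsler_curve a b u" and q: "0 < q" and "a \<le> x" "y \<le> b"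
  shows "0 \<le> integral {x..y} (rate q u)"
  using assms(3,4) rate_nonneg[OF q]
  by (intro integral_nonneg integrable_subinterval_real[OF rate_integrable[OF u q]]) auto

lemma wt_cost_integrable:
  assumes u: "finsler_curve a b u" and q: "0 < q"
  shows "(\<lambda>r. wt \<epsilon> (integral {a..r} (rate q u)) * cost q u r) absolutely_integrable_on {a..b}"
proof (rule measurable_bounded_by_integrable_imp_absolutely_integrable)
  note c = cost_integrable[OF u q]
  have "continuous_on {a..b} (\<lambda>r. wt \<epsilon> (integral {a..r} (rate q u)))"
    by (rule continuous_on_compose2[OF wt_continuous indefinite_integral_continuous_1[OF rate_integrable[OF u q]], of UNIV]) simp
  then have "(\<lambda>r. wt \<epsilon> (integral {a..r} (rate q u))) \<in> borel_measurable (lebesgue_on {a..b})"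
    by (rule continuous_imp_measurable_on_sets_lebesgue) simp
  moreover have "cost q u \<in> borel_measurable (lebesgue_on {a..b})"
    by (rule absolutely_integrable_imp_borel_measurable[OF c]) simp
  ultimately show "(\<lambda>r. wt \<epsilon> (integral {a..r} (rate q u)) * cost q u r) \<in> borel_measurable (lebesgue_on {a..b})"
    by measurable
  show "(\<lambda>r. 1 / \<epsilon> * \<bar>cost q u r\<bar>) integrable_on {a..b}"
    using c unfolding absolutely_integrable_on_def by (intro integrable_on_mult_right) simp
  fix r assume r: "r \<in> {a..b}"
  have "0 \<le> integral {a..r} (rate q u)" using r by (intro rate_integral_nonneg[OF u q]) auto
  then have "wt \<epsilon> (integral {a..r} (rate q u)) \<le> 1 / \<epsilon>" by (rule wt_le[OF eps_pos])
  then show "norm (wt \<epsilon> (integral {a..r} (rate q u)) * cost q u r) \<le> 1 / \<epsilon> * \<bar>cost q u r\<bar>"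
    using wt_pos[OF eps_pos, of "integral {a..r} (rate q u)"] eps_pos
    by (simp only: real_norm_def abs_mult) (intro mult_mono, auto)
qed simp

text \<open>The new time is \<open>\<tau> r = \<integral>\<^sub>a\<^sup>r rate q u\<close>, and the curve \<open>\<theta>\<close> with \<open>\<theta> (\<tau> r) = u r\<close> is well defined because \<open>u\<close> rests
wherever \<open>\<tau>\<close> is constant. By the change of variables \<open>\<theta>\<close> has speed at most \<open>q * S \<circ> \<theta>\<close> and square-integrable
speed, it spends almost no time where \<open>\<phi> = \<infinity>\<close>, and its action is the integral of \<open>cost q u\<close> with the
weight taken at \<open>\<tau>\<close>. It remains to concatenate.\<close>

theorem dynamic_programming:
  assumes u: "finsler_curve a b u" and ab: "a \<le> b" and q: "0 < q"
  shows "V (u a) \<le> ereal (integral {a..b} (\<lambda>r. wt \<epsilon> (integral {a..r} (rate q u)) * cost q u r))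
           + ereal (exp (- integral {a..b} (rate q u) / \<epsilon>)) * V (u b)"
proof -
  note F = finsler_curveD[OF u]
  define w where "w = rate q u"
  have w: "w integrable_on {a..b}" "\<And>r. 0 \<le> w r"
    unfolding w_def using rate_integrable[OF u q] rate_nonneg[OF q] by auto
  have wsub: "w integrable_on {x..y}" if "a \<le> x" "y \<le> b" for x y
    using that by (intro integrable_subinterval_real[OF w(1)]) auto
  define cl where "cl x = max a (min b x)" for x
  have cl: "cl x \<in> {a..b}" "x \<in> {a..b} \<Longrightarrow> cl x = x" for x using ab by (auto simp: cl_def)
  define \<tau> where "\<tau> x = integral {a..cl x} w" for x
  have \<tau>_eq: "\<tau> x = integral {a..x} w" if "x \<in> {a..b}" for x using cl(2)[OF that] by (simp add: \<tau>_def)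
  have \<tau>diff: "\<tau> y - \<tau> x = integral {x..y} w" if "a \<le> x" "x \<le> y" "y \<le> b" for x y
    using integral_diff_Icc[OF w(1) that] that by (simp add: \<tau>_eq)
  have \<tau>c: "continuous_on UNIV \<tau>"
    unfolding \<tau>_def[abs_def] cl_def by (rule clamped_integral_continuous[OF w(1) ab])
  have \<tau>mono: "\<tau> x \<le> \<tau> y" if "a \<le> x" "x \<le> y" "y \<le> b" for x y
    using \<tau>diff[OF that] integral_nonneg[OF wsub[of x y]] w(2) that by auto
  define T where "T = \<tau> b"
  have \<tau>0: "\<tau> a = 0" using ab by (simp add: \<tau>_eq)
  have T: "0 \<le> T" using \<tau>mono[of a b] ab by (simp add: T_def \<tau>0)
  have sp: "AE r in lebesgue_on {a..b}. speed u r = q * S (u r) * w r"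
    using F(3) by eventually_elim (use q in \<open>auto simp: w_def rate_def S_eq_0_iff\<close>)
  have sp': "integral {x..y} (speed u) = integral {x..y} (\<lambda>r. q * S (u r) * w r)"
    "(\<lambda>r. q * S (u r) * w r) integrable_on {x..y}" if "a \<le> x" "y \<le> b" for x y
  proof -
    have "AE r in lebesgue_on {x..y}. speed u r = q * S (u r) * w r"
      using that by (intro AE_lebesgue_on_subset[OF sp]) auto
    from has_integral_cong_AE[OF this] that integrable_subinterval_real[OF AC_speed_integrable[OF F(1)], of x y]
    have "((\<lambda>r. q * S (u r) * w r) has_integral (integral {x..y} (speed u))) {x..y}"
      by (auto dest: integrable_integral)
    then show "integral {x..y} (speed u) = integral {x..y} (\<lambda>r. q * S (u r) * w r)"
      "(\<lambda>r. q * S (u r) * w r) integrable_on {x..y}" by (auto simp: integral_unique)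
  qed
  have const: "u x = u y" if "a \<le> x" "x \<le> y" "y \<le> b" "\<tau> x = \<tau> y" for x y
  proof -
    have "integral {x..y} w = 0" using \<tau>diff[OF that(1-3)] that(4) by simp
    then have "AE r in lebesgue_on {x..y}. w r = 0"
      using that w(2) by (intro integral_eq_0_imp_AE_0 wsub) auto
    then have "AE r in lebesgue_on {x..y}. q * S (u r) * w r = 0" by eventually_elim simp
    then have "((\<lambda>r. q * S (u r) * w r) has_integral 0) {x..y}"
      using has_integral_cong_AE[where a = x and b = y and f = "\<lambda>r. q * S (u r) * w r" and g = "\<lambda>_. 0" and I = 0] by simp
    then have "integral {x..y} (speed u) = 0" using sp'(1)[of x y] that by (simp add: integral_unique)
    then show ?thesis using AC_dist_le_integral_speed[OF F(1), of x y] that by simp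
  qed
  define cT where "cT t = max 0 (min T t)" for t
  have cT: "cT t \<in> {0..T}" "t \<in> {0..T} \<Longrightarrow> cT t = t" for t using T by (auto simp: cT_def)
  have "\<exists>r. r \<in> {a..b} \<and> \<tau> r = t" if "t \<in> {0..T}" for t
    using IVT'[of \<tau> a t b] that ab continuous_on_subset[OF \<tau>c] \<tau>0 by (auto simp: T_def)
  then obtain \<rho> where \<rho>: "\<And>t. t \<in> {0..T} \<Longrightarrow> \<rho> t \<in> {a..b}" "\<And>t. t \<in> {0..T} \<Longrightarrow> \<tau> (\<rho> t) = t" by metis
  define \<theta> where "\<theta> t = u (\<rho> (cT t))" for t
  have \<tau>T: "\<tau> r \<in> {0..T}" if "r \<in> {a..b}" for r
    using \<tau>mono[of a r] \<tau>mono[of r b] that by (auto simp: T_def \<tau>0)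
  have \<theta>\<tau>: "\<theta> (\<tau> r) = u r" if r: "r \<in> {a..b}" for r
  proof -
    have "\<theta> (\<tau> r) = u (\<rho> (\<tau> r))" unfolding \<theta>_def using cT(2)[OF \<tau>T[OF r]] by simp
    also have "\<dots> = u r"
    proof (cases "r \<le> \<rho> (\<tau> r)")
      case True
      then show ?thesis using \<rho>[OF \<tau>T[OF r]] r by (intro const[symmetric]) auto
    next
      case False
      then show ?thesis using \<rho>[OF \<tau>T[OF r]] r by (intro const) auto
    qed
    finally show ?thesis .
  qed
  \<comment> \<open>Sublevel sets of \<open>\<phi> \<circ> \<theta>\<close> are images under \<open>\<tau>\<close> of the compact sublevel sets of \<open>\<phi> \<circ> u\<close>.\<close>
  have \<phi>\<theta>[measurable]: "(\<lambda>t. \<phi> (\<theta> t)) \<in> borel_measurable borel"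
  proof (rule borel_measurableI_le)
    fix c
    define Z where "Z = \<tau> ` {r \<in> {a..b}. \<phi> (u r) \<le> c}"
    have "closed {r \<in> {a..b}. \<phi> (u r) \<le> c}"
      by (intro closed_sublevel_compose closed_sublevel AC_continuous[OF F(1)]) auto
    moreover have "{r \<in> {a..b}. \<phi> (u r) \<le> c} = {r \<in> {a..b}. \<phi> (u r) \<le> c} \<inter> {a..b}" by blast
    ultimately have "compact {r \<in> {a..b}. \<phi> (u r) \<le> c}"
      using closed_Int_compact[OF _ compact_Icc[of a b]] by metis
    then have "closed Z"
      unfolding Z_def by (intro compact_imp_closed compact_continuous_image continuous_on_subset[OF \<tau>c]) auto
    moreover have "continuous_on UNIV cT" unfolding cT_def by (intro continuous_intros)
    ultimately have "closed (cT -` Z)" by (rule closed_vimage)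
    moreover have "{t. \<phi> (\<theta> t) \<le> c} = cT -` Z"
    proof (intro equalityI subsetI)
      fix t assume "t \<in> {t. \<phi> (\<theta> t) \<le> c}"
      then have "\<rho> (cT t) \<in> {r \<in> {a..b}. \<phi> (u r) \<le> c}" using \<rho>(1)[OF cT(1)] by (simp add: \<theta>_def)
      then have "\<tau> (\<rho> (cT t)) \<in> Z" unfolding Z_def by (rule imageI)
      then show "t \<in> cT -` Z" using \<rho>(2)[OF cT(1)] by simp
    next
      fix t assume "t \<in> cT -` Z"
      then obtain r where r: "r \<in> {a..b}" "\<phi> (u r) \<le> c" "cT t = \<tau> r" unfolding Z_def by auto
      have "\<theta> t = \<theta> (\<tau> r)" unfolding \<theta>_def using cT(2)[OF cT(1)[of t]] r(3) by simp
      then show "t \<in> {t. \<phi> (\<theta> t) \<le> c}" using \<theta>\<tau>[OF r(1)] r(2) by simp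
    qed
    ultimately show "{t \<in> space borel. \<phi> (\<theta> t) \<le> c} \<in> sets borel" by simp
  qed
  have S\<theta>[measurable]: "(\<lambda>t. S (\<theta> t)) \<in> borel_measurable borel" unfolding S_def by measurable
  have tc: "h absolutely_integrable_on {\<tau> x..\<tau> y}" "integral {\<tau> x..\<tau> y} h = integral {x..y} f"
    if h: "h \<in> borel_measurable borel" and f: "f absolutely_integrable_on {x..y}" and xy: "a \<le> x" "x \<le> y" "y \<le> b"
      and hf: "\<And>r. r \<in> {a..b} \<Longrightarrow> h (\<tau> r) * w r = f r" for h f x y
  proof -
    have eq: "h (\<tau> r) * w r = f r" if "r \<in> {x..y}" for r using that hf xy by auto
    have int: "(\<lambda>r. h (\<tau> r) * w r) absolutely_integrable_on {x..y}"
      using f by (rule absolutely_integrable_spike[of _ _ "{}"]) (auto simp: eq)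
    have \<tau>d: "\<tau> y' - \<tau> x' = integral {x'..y'} w" if "x \<le> x'" "x' \<le> y'" "y' \<le> y" for x' y'
      using that xy by (intro \<tau>diff) auto
    note tc = time_change[OF xy(2) wsub[OF xy(1,3)] w(2) \<tau>d \<tau>c h int]
    show "h absolutely_integrable_on {\<tau> x..\<tau> y}" by (rule tc)
    show "integral {\<tau> x..\<tau> y} h = integral {x..y} f"
    proof -
      have "integral {x..y} (\<lambda>r. h (\<tau> r) * w r) = integral {x..y} f"
        by (rule integral_cong) (rule eq)
      then show ?thesis using tc(2) by simp
    qed
  qed
  define m where "m t = q * S (\<theta> t)" for t
  have mm: "m \<in> borel_measurable borel" unfolding m_def by measurable
  have m0: "0 \<le> m t" for t using q S_nonneg by (simp add: m_def)
  have m\<tau>: "m (\<tau> r) * w r = q * S (u r) * w r" if "r \<in> {a..b}" for r using that by (simp add: m_def \<theta>\<tau>)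
  have qSw: "(\<lambda>r. q * S (u r) * w r) absolutely_integrable_on {x..y}" if "a \<le> x" "y \<le> b" for x y
    using sp'(2)[OF that] q S_nonneg w(2) by (intro nonnegative_absolutely_integrable_1) auto
  have mint: "m integrable_on {0..T}"
    using tc(1)[OF mm qSw[of a b] _ ab _ m\<tau>] by (simp add: \<tau>0 T_def set_lebesgue_integral_eq_integral(1))
  have dist\<theta>: "dist (\<theta> s) (\<theta> t) \<le> integral {s..t} m" if st: "0 \<le> s" "s \<le> t" "t \<le> T" for s t
  proof (cases "s = t")
    case False
    have s: "s \<in> {0..T}" and t: "t \<in> {0..T}" using st by auto
    have r: "\<rho> s \<le> \<rho> t"
      using \<tau>mono[of "\<rho> t" "\<rho> s"] \<rho>[OF s] \<rho>[OF t] st False by force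
    have ab': "a \<le> \<rho> s" "\<rho> t \<le> b" using \<rho>(1)[OF s] \<rho>(1)[OF t] by auto
    have "dist (\<theta> s) (\<theta> t) = dist (u (\<rho> s)) (u (\<rho> t))"
      unfolding \<theta>_def using cT(2)[OF s] cT(2)[OF t] by simp
    also have "\<dots> \<le> integral {\<rho> s..\<rho> t} (speed u)"
      by (rule AC_dist_le_integral_speed[OF F(1) ab'(1) r ab'(2)])
    also have "\<dots> = integral {\<tau> (\<rho> s)..\<tau> (\<rho> t)} m"
      using tc(2)[OF mm qSw[OF ab'] ab'(1) r ab'(2) m\<tau>] sp'(1)[OF ab'] by simp
    finally show ?thesis using \<rho>(2)[OF s] \<rho>(2)[OF t] by simp
  qed simp
  have AC\<theta>: "AC 1 {0..T} edist \<theta>"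
    by (rule AC_1_intro[OF mint]) (use m0 dist\<theta> in auto)
  have sp\<theta>: "AE t in lebesgue_on {0..T}. speed \<theta> t \<le> m t"
    by (rule AC_speed_le[OF mint m0 dist\<theta>])
  have m2: "(\<lambda>t. (m t)\<^sup>2) integrable_on {0..T}"
  proof -
    have "(\<lambda>r. q * (S (u r) * speed u r)) absolutely_integrable_on {a..b}"
      using q S_nonneg by (intro nonnegative_absolutely_integrable_1 integrable_on_mult_right F(2)) auto
    moreover have "(m (\<tau> r))\<^sup>2 * w r = q * (S (u r) * speed u r)" if "r \<in> {a..b}" for r
    proof -
      have "(m (\<tau> r))\<^sup>2 * w r = q\<^sup>2 * ((S (u r))\<^sup>2 * w r)"
        using that by (simp add: m_def \<theta>\<tau> power_mult_distrib)
      then show ?thesis unfolding w_def S_sq_rate[OF q] using q by (simp add: power2_eq_square)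
    qed
    ultimately have "(\<lambda>t. (m t)\<^sup>2) absolutely_integrable_on {\<tau> a..\<tau> b}"
      using mm by (intro tc(1)) (auto simp: ab)
    then show ?thesis by (simp add: \<tau>0 T_def set_lebesgue_integral_eq_integral(1))
  qed
  have sq: "(\<lambda>t. (metric_deriv \<theta> t)\<^sup>2) integrable_on {0..T}"
  proof (rule set_lebesgue_integral_eq_integral(1)[OF absolutely_integrable_bound_AE[OF _ m2]])
    have "(\<lambda>t. (speed \<theta> t)\<^sup>2) \<in> borel_measurable (lebesgue_on {0..T})"
      using S_curve_measurable(3)[OF AC\<theta>] by measurable
    then show "(\<lambda>t. (metric_deriv \<theta> t)\<^sup>2) \<in> borel_measurable (lebesgue_on {0..T})" by simp
    show "AE t in lebesgue_on {0..T}. \<bar>(metric_deriv \<theta> t)\<^sup>2\<bar> \<le> (m t)\<^sup>2"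
      using sp\<theta> by eventually_elim (use abs_le_square_iff m0 in \<open>auto simp: power2_le_iff_abs_le\<close>)
  qed
  have fin\<theta>: "AE t in lebesgue_on {0..T}. \<phi> (\<theta> t) \<noteq> \<infinity>"
  proof -
    define h where "h t = (if \<phi> (\<theta> t) = \<infinity> then 1 else 0 :: real)" for t
    have hm: "h \<in> borel_measurable borel" unfolding h_def by measurable
    have h0: "(\<lambda>_. 0 :: real) absolutely_integrable_on {a..b}" by simp
    have h\<tau>: "h (\<tau> r) * w r = 0" if "r \<in> {a..b}" for r
      using that by (simp add: h_def \<theta>\<tau> w_def rate_def S_PInf)
    have "h absolutely_integrable_on {\<tau> a..\<tau> b}" "integral {\<tau> a..\<tau> b} h = 0"
      using tc[OF hm h0 order_refl ab order_refl h\<tau>] by simp_all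
    then have "AE t in lebesgue_on {0..T}. h t = 0"
      by (intro integral_eq_0_imp_AE_0) (simp_all add: \<tau>0 T_def set_lebesgue_integral_eq_integral(1), simp add: h_def)
    then show ?thesis by eventually_elim (auto simp: h_def split: if_splits)
  qed
  define L where "L t = \<epsilon> / 2 * q\<^sup>2 * (S (\<theta> t))\<^sup>2 + p (\<theta> t)" for t
  define f where "f r = wt \<epsilon> (integral {a..r} w) * cost q u r" for r
  have fabs: "f absolutely_integrable_on {a..b}"
    unfolding f_def[abs_def] w_def by (rule wt_cost_integrable[OF u q])
  have wtL: "(\<lambda>t. wt \<epsilon> t * L t) absolutely_integrable_on {\<tau> a..\<tau> b}"
    "integral {\<tau> a..\<tau> b} (\<lambda>t. wt \<epsilon> t * L t) = integral {a..b} f"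
  proof -
    have wtm: "wt \<epsilon> \<in> borel_measurable borel" by (rule borel_measurable_continuous_onI[OF wt_continuous])
    have hm: "(\<lambda>t. wt \<epsilon> t * L t) \<in> borel_measurable borel" unfolding L_def using wtm by measurable
    have hf: "wt \<epsilon> (\<tau> r) * L (\<tau> r) * w r = f r" if "r \<in> {a..b}" for r
      unfolding L_def f_def cost_def \<theta>\<tau>[OF that] by (simp add: \<tau>_eq[OF that] w_def mult.assoc)
    show "(\<lambda>t. wt \<epsilon> t * L t) absolutely_integrable_on {\<tau> a..\<tau> b}"
      "integral {\<tau> a..\<tau> b} (\<lambda>t. wt \<epsilon> t * L t) = integral {a..b} f"
      using tc[OF hm fabs order_refl ab order_refl hf] by blast+
  qed
  have le: "AE t in lebesgue_on {0..T}. ereal (\<epsilon> / 2 * (metric_deriv \<theta> t)\<^sup>2) + \<phi> (\<theta> t) \<le> ereal (L t)"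
    using sp\<theta> fin\<theta>
  proof eventually_elim
    case (elim t)
    obtain r where r: "\<phi> (\<theta> t) = ereal r" using elim(2) phi_not_MInf[of "\<theta> t"] by (cases "\<phi> (\<theta> t)") auto
    have "(metric_deriv \<theta> t)\<^sup>2 \<le> (m t)\<^sup>2" using elim(1) m0[of t] abs_le_square_iff[of "metric_deriv \<theta> t" "m t"] by simp
    then have "\<epsilon> / 2 * (metric_deriv \<theta> t)\<^sup>2 \<le> \<epsilon> / 2 * (m t)\<^sup>2" using eps_pos by (intro mult_left_mono) auto
    then show ?case by (simp add: r L_def m_def power_mult_distrib)
  qed
  have "V (\<theta> 0) \<le> ereal (integral {0..T} (\<lambda>t. wt \<epsilon> t * L t)) + ereal (exp (- T / \<epsilon>)) * V (\<theta> T)"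
    by (rule value_fun_concat[OF AC\<theta> T sq _ le]) (use wtL(1) in \<open>simp add: \<tau>0 T_def\<close>)
  moreover have "\<theta> 0 = u a" "\<theta> T = u b"
    using \<theta>\<tau>[of a] \<theta>\<tau>[of b] ab by (simp_all add: \<tau>0 T_def)
  moreover have "integral {0..T} (\<lambda>t. wt \<epsilon> t * L t) = integral {a..b} f"
    using wtL(2) by (simp add: \<tau>0 T_def)
  moreover have "T = integral {a..b} w" using ab by (simp add: T_def \<tau>_eq)
  ultimately show ?thesis by (simp add: f_def[abs_def] w_def)
qed

section \<open>Oscillation of the value function along a Finsler curve\<close>

definition C where "C = 1 / 2 + 1 / \<epsilon>"

lemma C_pos: "0 < C"
  using eps_pos by (simp add: C_def add_pos_pos)

definition len :: "real \<Rightarrow> real \<Rightarrow> (real \<Rightarrow> 'a) \<Rightarrow> real" where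
  "len a b u = integral {a..b} (\<lambda>t. S (u t) * speed u t)"

lemma len_nonneg: "finsler_curve a b u \<Longrightarrow> 0 \<le> len a b u"
  unfolding len_def using S_nonneg by (intro integral_nonneg finsler_curveD(2)) auto

lemma value_fun_finsler:
  assumes u: "finsler_curve a b u" and ab: "a \<le> b"
  obtains T where "0 \<le> T" "T \<le> len a b u"
    "V (u a) \<le> ereal (C * len a b u) + ereal (exp (- T / \<epsilon>)) * V (u b)"
proof -
  define w where "w = rate 1 u"
  have w: "w integrable_on {a..b}" "\<And>r. 0 \<le> w r"
    unfolding w_def using rate_integrable[OF u, of 1] rate_nonneg[of 1] by auto
  define T where "T = integral {a..b} w"
  have T: "0 \<le> T" unfolding T_def using w by (intro integral_nonneg) auto
  have "T \<le> len a b u" unfolding T_def len_def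
    using rate_le[of 1 u] by (intro integral_le w(1) finsler_curveD(2)[OF u]) (simp add: w_def)
  define f where "f r = wt \<epsilon> (integral {a..r} w) * cost 1 u r" for r
  have "integral {a..b} f \<le> integral {a..b} (\<lambda>t. C * (S (u t) * speed u t))"
  proof (rule integral_le)
    show "(\<lambda>t. C * (S (u t) * speed u t)) integrable_on {a..b}"
      by (rule integrable_on_mult_right[OF finsler_curveD(2)[OF u]])
    have wt: "0 < wt \<epsilon> (integral {a..r} w)" "wt \<epsilon> (integral {a..r} w) \<le> 1 / \<epsilon>" if "r \<in> {a..b}" for r
      using wt_pos[OF eps_pos] wt_le[OF eps_pos rate_integral_nonneg[OF u, of 1 a r]] that by (auto simp: w_def)
    show "f integrable_on {a..b}"
      unfolding f_def[abs_def] w_def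
      by (intro set_lebesgue_integral_eq_integral(1) wt_cost_integrable[OF u]) simp
    fix r assume r: "r \<in> {a..b}"
    show "f r \<le> C * (S (u r) * speed u r)"
    proof (cases "\<phi> (u r) = \<infinity>")
      case False
      have "cost 1 u r \<le> (\<epsilon> / 2 + 1) * (S (u r))\<^sup>2 * w r"
        unfolding cost_def w_def using S_finite(1)[OF False] rate_nonneg[of 1 u r]
        by (intro mult_right_mono) (auto simp: algebra_simps)
      also have "\<dots> = (\<epsilon> / 2 + 1) * (S (u r) * speed u r)"
        using S_sq_rate[of 1 u r] by (simp add: w_def mult.assoc)
      finally have "f r \<le> wt \<epsilon> (integral {a..r} w) * ((\<epsilon> / 2 + 1) * (S (u r) * speed u r))"
        unfolding f_def using wt(1)[OF r] by (intro mult_left_mono) auto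
      also have "\<dots> \<le> 1 / \<epsilon> * ((\<epsilon> / 2 + 1) * (S (u r) * speed u r))"
        using wt(2)[OF r] eps_pos S_nonneg by (intro mult_right_mono mult_nonneg_nonneg) auto
      also have "\<dots> = C * (S (u r) * speed u r)" using eps_pos by (simp add: C_def field_simps)
      finally show ?thesis .
    qed (simp add: f_def cost_def rate_def S_PInf)
  qed
  then have I: "integral {a..b} f \<le> C * len a b u" by (simp add: len_def)
  have "V (u a) \<le> ereal (integral {a..b} f) + ereal (exp (- T / \<epsilon>)) * V (u b)"
    using dynamic_programming[OF u ab, of 1] by (simp add: f_def[abs_def] w_def T_def)
  also have "\<dots> \<le> ereal (C * len a b u) + ereal (exp (- T / \<epsilon>)) * V (u b)"
    using I by (intro add_right_mono) simp
  finally show thesis using that T \<open>T \<le> len a b u\<close> by blast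
qed

lemma finsler_curve_reverse:
  assumes u: "finsler_curve a b u"
  shows "finsler_curve (-b) (-a) (\<lambda>r. u (- r))" "len (-b) (-a) (\<lambda>r. u (- r)) = len a b u"
proof -
  note F = finsler_curveD[OF u]
  have eq: "(\<lambda>t. S (u (- t)) * speed (\<lambda>r. u (- r)) t) = (\<lambda>t. (\<lambda>t. S (u t) * speed u t) (- t))"
    by (simp add: metric_deriv_reverse)
  show "finsler_curve (-b) (-a) (\<lambda>r. u (- r))"
    unfolding finsler_curve_def eq metric_deriv_reverse
    using AC_1_reverse[OF F(1)] AE_lebesgue_on_reverse[OF F(3)]
      Henstock_Kurzweil_Integration.integrable_reflect_real[where f = "\<lambda>t. S (u t) * speed u t" and a = a and b = b] F(2)
    by blast
  show "len (-b) (-a) (\<lambda>r. u (- r)) = len a b u"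
    unfolding len_def eq by (rule Henstock_Kurzweil_Integration.integral_reflect_real)
qed

text \<open>A bound for \<open>|V y - v|\<close> when \<open>V x = v\<close> and \<open>l\<close> is the Finsler length of a curve between \<open>x\<close> and \<open>y\<close>. It depends
on the value at one end only. The exponential appears because the discount factor acts on the unknown
value at the other end.\<close>

definition modulus :: "real \<Rightarrow> real \<Rightarrow> real" where
  "modulus v l = C * l + l / \<epsilon> * exp (l / \<epsilon>) * (C * l + \<bar>v\<bar>)"

lemma one_minus_exp_bounds:
  assumes "0 \<le> T" "T \<le> l"
  shows "0 \<le> 1 - exp (- T / \<epsilon>)" "1 - exp (- T / \<epsilon>) \<le> l / \<epsilon>"
proof -
  show "0 \<le> 1 - exp (- T / \<epsilon>)" using assms eps_pos by simp
  have "1 - exp (- T / \<epsilon>) \<le> T / \<epsilon>" using exp_ge_add_one_self[of "- T / \<epsilon>"] by simp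
  also have "\<dots> \<le> l / \<epsilon>" using assms eps_pos by (simp add: divide_right_mono)
  finally show "1 - exp (- T / \<epsilon>) \<le> l / \<epsilon>" .
qed

lemma value_fun_modulus:
  assumes u: "finsler_curve a b u" and ab: "a \<le> b"
  shows "V (u b) = \<infinity> \<longleftrightarrow> V (u a) = \<infinity>"
    and "V (u a) = ereal v \<Longrightarrow> V (u b) = ereal v' \<Longrightarrow> \<bar>v' - v\<bar> \<le> modulus v (len a b u)"
proof -
  define l where "l = len a b u"
  obtain T where T: "0 \<le> T" "T \<le> l" "V (u a) \<le> ereal (C * l) + ereal (exp (- T / \<epsilon>)) * V (u b)"
    using value_fun_finsler[OF u ab] unfolding l_def by blast
  obtain R where R: "0 \<le> R" "R \<le> l" "V (u b) \<le> ereal (C * l) + ereal (exp (- R / \<epsilon>)) * V (u a)"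
    using value_fun_finsler[OF finsler_curve_reverse(1)[OF u]] ab
    unfolding l_def finsler_curve_reverse(2)[OF u] by auto
  show "V (u b) = \<infinity> \<longleftrightarrow> V (u a) = \<infinity>"
    using T(3) R(3) value_fun_not_MInf[of "u a"] value_fun_not_MInf[of "u b"]
    by (cases "V (u a)"; cases "V (u b)") auto
  assume v: "V (u a) = ereal v" "V (u b) = ereal v'"
  have 1: "v \<le> C * l + exp (- T / \<epsilon>) * v'" and 2: "v' \<le> C * l + exp (- R / \<epsilon>) * v"
    using T(3) R(3) by (simp_all add: v)
  note eT = one_minus_exp_bounds[OF T(1,2)] and eR = one_minus_exp_bounds[OF R(1,2)]
  have l0: "0 \<le> l" using T by simp
  have Cl: "0 \<le> C * l" using C_pos l0 by simp
  have el: "1 \<le> exp (l / \<epsilon>)" using l0 eps_pos by simp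
  define D where "D = C * l + \<bar>v\<bar>"
  have D: "0 \<le> D" "\<bar>v\<bar> \<le> D" using Cl by (simp_all add: D_def)
  have upper: "v' - v \<le> C * l + l / \<epsilon> * D"
  proof -
    have "(1 - exp (- R / \<epsilon>)) * (- v) \<le> (1 - exp (- R / \<epsilon>)) * \<bar>v\<bar>"
      using eR(1) by (intro mult_left_mono) auto
    also have "\<dots> \<le> l / \<epsilon> * D" using eR D l0 eps_pos by (intro mult_mono) auto
    finally show ?thesis using 2 by (simp add: algebra_simps)
  qed
  have lower: "v - v' \<le> C * l + l / \<epsilon> * (exp (l / \<epsilon>) * D)"
  proof (cases "0 \<le> v'")
    case True
    have "v - v' \<le> C * l - (1 - exp (- T / \<epsilon>)) * v'" using 1 by (simp add: algebra_simps)
    also have "\<dots> \<le> C * l" using eT(1) True by simp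
    also have "\<dots> \<le> C * l + l / \<epsilon> * (exp (l / \<epsilon>) * D)" using l0 eps_pos D by simp
    finally show ?thesis .
  next
    case False
    have "exp (- T / \<epsilon>) * (- v') \<le> C * l - v" using 1 by simp
    also have "\<dots> \<le> D" by (simp add: D_def)
    finally have "exp (T / \<epsilon>) * (exp (- T / \<epsilon>) * (- v')) \<le> exp (T / \<epsilon>) * D" by (intro mult_left_mono) auto
    then have "- v' \<le> exp (T / \<epsilon>) * D" by (simp add: mult.assoc[symmetric] exp_add[symmetric])
    also have "\<dots> \<le> exp (l / \<epsilon>) * D"
      using D T eps_pos by (intro mult_right_mono) (auto simp: divide_right_mono)
    finally have "- v' \<le> exp (l / \<epsilon>) * D" .
    then have "(1 - exp (- T / \<epsilon>)) * (- v') \<le> l / \<epsilon> * (exp (l / \<epsilon>) * D)"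
      using eT False l0 eps_pos by (intro mult_mono) auto
    moreover have "v - v' \<le> C * l + (1 - exp (- T / \<epsilon>)) * (- v')" using 1 by (simp add: algebra_simps)
    ultimately show ?thesis by simp
  qed
  have "l / \<epsilon> * D \<le> l / \<epsilon> * (exp (l / \<epsilon>) * D)"
    using el D l0 eps_pos mult_right_mono[OF el D(1)] by (intro mult_left_mono) auto
  with upper lower show "\<bar>v' - v\<bar> \<le> modulus v (len a b u)"
    unfolding modulus_def l_def[symmetric] D_def[symmetric] mult.assoc by linarith
qed

section \<open>The derivative of the value function along a curve\<close>

text \<open>For \<open>s > t\<close> the dynamic programming inequality on \<open>{t..s}\<close> says that \<open>\<Psi> s \<ge> 0\<close>, where \<open>\<Psi>\<close> is differentiable at
\<open>t\<close> and \<open>\<Psi> t = 0\<close>. So its derivative at \<open>t\<close> is nonnegative. The discount inside the integral costs at most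
\<open>W s * H s / \<epsilon>\<^sup>2\<close>, which vanishes to second order.\<close>

lemma value_fun_derivative_rate:
  assumes u: "finsler_curve a b u" and q: "0 < q"
    and v: "\<And>t. t \<in> {a..b} \<Longrightarrow> V (u t) = ereal (v t)"
  shows "AE t in lebesgue_on {a<..<b}. \<forall>v'. (v has_real_derivative v') (at t) \<longrightarrow>
     - v' \<le> (cost q u t - rate q u t * v t) / \<epsilon>"
proof -
  have wint: "rate q u integrable_on {a..b}" by (rule rate_integrable[OF u q])
  have cabs: "cost q u absolutely_integrable_on {a..b}" by (rule cost_integrable[OF u q])
  have cint: "cost q u integrable_on {a..b}" and aint: "(\<lambda>r. \<bar>cost q u r\<bar>) integrable_on {a..b}"
    using cabs unfolding absolutely_integrable_on_def by simp_all
  show ?thesis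
    using lebesgue_differentiation[OF wint] lebesgue_differentiation[OF cint] lebesgue_differentiation[OF aint]
      AE_lebesgue_on_Ioo[of a b]
  proof eventually_elim
    case (elim t)
    show ?case
    proof (intro allI impI)
      fix v' assume v': "(v has_real_derivative v') (at t)"
      define W G H where "W s = integral {a..s} (rate q u) - integral {a..t} (rate q u)"
        and "G s = integral {a..s} (cost q u) - integral {a..t} (cost q u)"
        and "H s = integral {a..s} (\<lambda>r. \<bar>cost q u r\<bar>) - integral {a..t} (\<lambda>r. \<bar>cost q u r\<bar>)" for s
      have dW: "(W has_real_derivative rate q u t) (at t)" and dG: "(G has_real_derivative cost q u t) (at t)"
        and dH: "(H has_real_derivative \<bar>cost q u t\<bar>) (at t)"
        unfolding W_def G_def H_def using elim by (auto intro!: derivative_eq_intros)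
      have t0: "W t = 0" "G t = 0" "H t = 0" by (simp_all add: W_def G_def H_def)
      define \<Psi> where "\<Psi> s = G s / \<epsilon> + W s * H s / \<epsilon>\<^sup>2 + exp (- W s / \<epsilon>) * v s - v t" for s
      have d\<Psi>: "(\<Psi> has_real_derivative (cost q u t / \<epsilon> - rate q u t / \<epsilon> * v t + v')) (at t)"
        unfolding \<Psi>_def using dW dG dH v' eps_pos
        by (auto intro!: derivative_eq_intros simp: t0)
      have \<Psi>t: "\<Psi> t = 0" by (simp add: \<Psi>_def t0)
      have "0 \<le> \<Psi> s" if s: "t < s" "s < b" for s
      proof -
        have comb: "integral {t..s} f = integral {a..s} f - integral {a..t} f"
          if "f integrable_on {a..b}" for f :: "real \<Rightarrow> real"
          using integral_diff_Icc[OF that, of t s] elim s by simp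
        have sub: "f integrable_on {t..r}" if "f integrable_on {a..b}" "r \<le> s" for f :: "real \<Rightarrow> real" and r
          using integrable_subinterval_real[OF that(1), of t r] that elim s by auto
        have uts: "finsler_curve t s u" using finsler_curve_subset[OF u] elim s by simp
        have Wr: "0 \<le> integral {t..r} (rate q u)" "integral {t..r} (rate q u) \<le> W s" if "r \<in> {t..s}" for r
        proof -
          show "0 \<le> integral {t..r} (rate q u)"
            using that rate_nonneg[OF q] by (intro integral_nonneg sub wint) auto
          have "integral {t..r} (rate q u) \<le> integral {t..s} (rate q u)"
            using that rate_nonneg[OF q] by (intro integral_subset_le sub wint) auto
          then show "integral {t..r} (rate q u) \<le> W s" using comb[OF wint] s by (simp add: W_def)
        qed
        let ?f = "\<lambda>r. wt \<epsilon> (integral {t..r} (rate q u)) * cost q u r"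
        have bd: "?f r \<le> 1 / \<epsilon> * cost q u r + W s / \<epsilon>\<^sup>2 * \<bar>cost q u r\<bar>" if r: "r \<in> {t..s}" for r
        proof -
          define \<tau> where "\<tau> = integral {t..r} (rate q u)"
          have "\<bar>wt \<epsilon> \<tau> - 1 / \<epsilon>\<bar> = (1 - exp (- \<tau> / \<epsilon>)) / \<epsilon>"
            using one_minus_exp_bounds(1)[of \<tau> \<tau>] Wr(1)[OF r] eps_pos
            by (simp add: wt_def \<tau>_def diff_divide_distrib[symmetric] abs_minus_commute)
          also have "\<dots> \<le> (W s / \<epsilon>) / \<epsilon>"
            using one_minus_exp_bounds(2)[of \<tau> "W s"] Wr[OF r] eps_pos
            by (intro divide_right_mono) (auto simp: \<tau>_def)
          finally have "\<bar>wt \<epsilon> \<tau> - 1 / \<epsilon>\<bar> * \<bar>cost q u r\<bar> \<le> W s / \<epsilon>\<^sup>2 * \<bar>cost q u r\<bar>"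
            by (intro mult_right_mono) (auto simp: power2_eq_square)
          moreover have "wt \<epsilon> \<tau> * cost q u r - 1 / \<epsilon> * cost q u r \<le> \<bar>wt \<epsilon> \<tau> - 1 / \<epsilon>\<bar> * \<bar>cost q u r\<bar>"
            unfolding abs_mult[symmetric] left_diff_distrib by (rule abs_ge_self)
          ultimately show ?thesis unfolding \<tau>_def by linarith
        qed
        have g: "((\<lambda>r. 1 / \<epsilon> * cost q u r + W s / \<epsilon>\<^sup>2 * \<bar>cost q u r\<bar>) has_integral (1 / \<epsilon> * G s + W s / \<epsilon>\<^sup>2 * H s)) {t..s}"
          using comb[OF cint] comb[OF aint] s sub[OF cint, of s] sub[OF aint, of s]
          by (intro has_integral_add has_integral_mult_right) (auto simp: G_def H_def has_integral_iff)
        have "integral {t..s} ?f \<le> 1 / \<epsilon> * G s + W s / \<epsilon>\<^sup>2 * H s"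
          using integral_le[OF set_lebesgue_integral_eq_integral(1)[OF wt_cost_integrable[OF uts q]]
            has_integral_integrable[OF g] bd] integral_unique[OF g] by simp
        moreover have "v t \<le> integral {t..s} ?f + exp (- W s / \<epsilon>) * v s"
          using dynamic_programming[OF uts _ q] s v[of t] v[of s] elim comb[OF wint] by (simp add: W_def)
        ultimately show ?thesis by (simp add: \<Psi>_def)
      qed
      then have pos: "0 \<le> \<Psi> (t + h)" if "0 < h" "h < b - t" for h using that by simp
      have "0 \<le> cost q u t / \<epsilon> - rate q u t / \<epsilon> * v t + v'"
      proof (rule ccontr)
        assume "\<not> ?thesis"
        then obtain d where d: "0 < d" "\<And>h. 0 < h \<Longrightarrow> h < d \<Longrightarrow> \<Psi> (t + h) < \<Psi> t"
          using DERIV_neg_dec_right[OF d\<Psi>] by auto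
        have "0 < min d (b - t) / 2" "min d (b - t) / 2 < d" "min d (b - t) / 2 < b - t"
          using d(1) elim(4) by auto
        then show False using d(2) pos \<Psi>t by (metis not_less)
      qed
      then show "- v' \<le> (cost q u t - rate q u t * v t) / \<epsilon>" using eps_pos by (simp add: diff_divide_distrib)
    qed
  qed
qed

theorem value_fun_derivative_upper:
  assumes u: "finsler_curve a b u" and v: "\<And>t. t \<in> {a..b} \<Longrightarrow> V (u t) = ereal (v t)"
  shows "AE t in lebesgue_on {a<..<b}. \<forall>v'. (v has_real_derivative v') (at t) \<longrightarrow>
     ereal (- v') \<le> G_fun \<epsilon> \<phi> (u t) * ereal (metric_deriv u t)"
proof -
  define Q where "Q = \<rat> \<inter> {0::real<..}"
  have "countable Q" unfolding Q_def using countable_rat by (rule countable_Int1)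
  then have "AE t in lebesgue_on {a<..<b}. \<forall>q\<in>Q. \<forall>v'. (v has_real_derivative v') (at t) \<longrightarrow>
     - v' \<le> (cost q u t - rate q u t * v t) / \<epsilon>"
    using value_fun_derivative_rate[OF u _ v] by (subst AE_ball_countable) (auto simp: Q_def)
  then show ?thesis
    using finsler_curveD(3)[OF u, folded AE_lebesgue_on_Ioo_Icc]
      AC_metric_deriv_nonneg[OF finsler_curveD(1)[OF u], folded AE_lebesgue_on_Ioo_Icc]
      AE_lebesgue_on_Ioo[of a b]
  proof eventually_elim
    case (elim t)
    show ?case
    proof (intro allI impI)
      fix v' assume v': "(v has_real_derivative v') (at t)"
      have vt: "V (u t) = ereal (v t)" using elim(4) by (intro v) auto
      have rates: "- v' \<le> (cost q u t - rate q u t * v t) / \<epsilon>" if "q \<in> \<rat>" "0 < q" for q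
        using elim(1) that v' unfolding Q_def by blast
      show "ereal (- v') \<le> G_fun \<epsilon> \<phi> (u t) * ereal (metric_deriv u t)"
      proof (cases "\<phi> (u t) = \<infinity>")
        case True
        have "- v' \<le> 0" using rates[of 1] True by (simp add: cost_def rate_def S_PInf)
        then show ?thesis using elim(2) True by (simp add: zero_ereal_def[symmetric])
      next
        case False
        obtain r where r: "\<phi> (u t) = ereal r" using False phi_not_MInf[of "u t"] by (cases "\<phi> (u t)") auto
        have rv: "v t \<le> r" using value_fun_le_phi[of "u t"] by (simp add: r vt)
        have S1: "1 \<le> S (u t)" by (rule S_finite(2)[OF False])
        have "- v' \<le> 2 * (speed u t / \<epsilon>) * sqrt (\<epsilon> * S (u t) / 2 * ((r - v t) / S (u t)))"
        proof (rule mult_add_divide_le_sqrt)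
          fix q :: real assume q: "q \<in> \<rat>" "0 < q"
          have "(cost q u t - rate q u t * v t) / \<epsilon> = speed u t / \<epsilon> * (\<epsilon> * S (u t) / 2 * q + (r - v t) / S (u t) / q)"
            unfolding cost_def rate_def using q S1 eps_pos by (simp add: r field_simps power2_eq_square)
          with rates[OF q] show "- v' \<le> speed u t / \<epsilon> * (\<epsilon> * S (u t) / 2 * q + (r - v t) / S (u t) / q)" by simp
        qed (use eps_pos S1 rv in auto)
        also have "\<epsilon> * S (u t) / 2 * ((r - v t) / S (u t)) = \<epsilon> * (r - v t) / 2" using S1 by simp
        also have "2 * (speed u t / \<epsilon>) * sqrt (\<epsilon> * (r - v t) / 2) = sqrt (2 * (r - v t) / \<epsilon>) * speed u t"
        proof -
          have "2 / \<epsilon> * sqrt (\<epsilon> * (r - v t) / 2) = sqrt ((2 / \<epsilon>)\<^sup>2) * sqrt (\<epsilon> * (r - v t) / 2)"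
            using eps_pos by simp
          also have "\<dots> = sqrt ((2 / \<epsilon>)\<^sup>2 * (\<epsilon> * (r - v t) / 2))" by (rule real_sqrt_mult[symmetric])
          also have "(2 / \<epsilon>)\<^sup>2 * (\<epsilon> * (r - v t) / 2) = 2 * (r - v t) / \<epsilon>"
            using eps_pos by (simp add: field_simps power2_eq_square)
          finally have eq: "2 / \<epsilon> * sqrt (\<epsilon> * (r - v t) / 2) = sqrt (2 * (r - v t) / \<epsilon>)" .
          have "2 * (speed u t / \<epsilon>) * sqrt (\<epsilon> * (r - v t) / 2) = 2 / \<epsilon> * sqrt (\<epsilon> * (r - v t) / 2) * speed u t" by simp
          then show ?thesis unfolding eq .
        qed
        finally have "- v' \<le> sqrt (2 * (r - v t) / \<epsilon>) * metric_deriv u t" using elim(3) by simp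
        moreover have "G_fun \<epsilon> \<phi> (u t) = ereal (sqrt (2 * (r - v t) / \<epsilon>))"
          unfolding G_fun_def by (simp add: vt r ereal_root2_def eps_pos less_imp_neq[OF eps_pos, symmetric])
        ultimately show ?thesis by simp
      qed
    qed
  qed
qed

section \<open>The Finsler distance\<close>

lemma finsler_length:
  assumes \<theta>: "AC 1 {a..b} edist \<theta>"
    and fin: "(\<integral>\<^sup>+t. e2ennreal (ereal_root2 (max (\<phi> (\<theta> t)) 1) * ereal (metric_deriv \<theta> t)) \<partial>lebesgue_on {a..b}) < \<infinity>"
  shows "finsler_curve a b \<theta>"
    and "enn2ereal (\<integral>\<^sup>+t. e2ennreal (ereal_root2 (max (\<phi> (\<theta> t)) 1) * ereal (metric_deriv \<theta> t)) \<partial>lebesgue_on {a..b}) = ereal (len a b \<theta>)"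
proof -
  define f where "f t = e2ennreal (ereal_root2 (max (\<phi> (\<theta> t)) 1) * ereal (metric_deriv \<theta> t))" for t
  define g where "g t = (if \<phi> (\<theta> t) = \<infinity> then (if speed \<theta> t = 0 then 0 else top) else ennreal (S (\<theta> t) * speed \<theta> t))" for t
  have fg: "AE t in lebesgue_on {a..b}. f t = g t"
    using AC_metric_deriv_nonneg[OF \<theta>]
  proof eventually_elim
    case (elim t)
    show ?case
    proof (cases "\<phi> (\<theta> t) = \<infinity>")
      case True
      then show ?thesis using elim by (auto simp: f_def g_def ereal_root2_def max_def zero_ereal_def[symmetric] e2ennreal_neg)
    next
      case False
      obtain r where r: "\<phi> (\<theta> t) = ereal r" using False phi_not_MInf[of "\<theta> t"] by (cases "\<phi> (\<theta> t)") auto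
      have "max (\<phi> (\<theta> t)) 1 \<noteq> \<infinity>" by (simp add: r max_def)
      then have "ereal_root2 (max (\<phi> (\<theta> t)) 1) = ereal (S (\<theta> t))" by (simp add: ereal_root2_def S_def)
      then show ?thesis using elim False by (simp add: f_def g_def)
    qed
  qed
  note [measurable] = S_curve_measurable[OF \<theta>] phi_curve_measurable[OF \<theta>]
  have gm: "g \<in> borel_measurable (lebesgue_on {a..b})" unfolding g_def by measurable
  have fin': "integral\<^sup>N (lebesgue_on {a..b}) g < \<infinity>"
    using fin nn_integral_cong_AE[OF fg] unfolding f_def by simp
  then have "AE t in lebesgue_on {a..b}. g t \<noteq> \<infinity>"
    using gm by (intro nn_integral_PInf_AE) auto
  then have ae: "AE t in lebesgue_on {a..b}. \<phi> (\<theta> t) = \<infinity> \<longrightarrow> metric_deriv \<theta> t = 0"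
    by eventually_elim (auto simp: g_def split: if_splits)
  then have "AE t in lebesgue_on {a..b}. g t = ennreal (S (\<theta> t) * speed \<theta> t)"
    by eventually_elim (auto simp: g_def)
  note gS = nn_integral_cong_AE[OF this]
  have nn: "0 \<le> S (\<theta> t) * speed \<theta> t" for t using S_nonneg by simp
  have int: "integrable (lebesgue_on {a..b}) (\<lambda>t. S (\<theta> t) * speed \<theta> t)"
    by (rule integrableI_nonneg) (use fin' gS nn in auto)
  then have int': "(\<lambda>t. S (\<theta> t) * speed \<theta> t) absolutely_integrable_on {a..b}"
    by (simp add: integrable_restrict_space set_integrable_def)
  then show "finsler_curve a b \<theta>"
    unfolding finsler_curve_def using \<theta> ae set_lebesgue_integral_eq_integral(1) by blast
  have "integral\<^sup>N (lebesgue_on {a..b}) f = integral\<^sup>N (lebesgue_on {a..b}) g" by (rule nn_integral_cong_AE[OF fg])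
  also have "\<dots> = ennreal (integral\<^sup>L (lebesgue_on {a..b}) (\<lambda>t. S (\<theta> t) * speed \<theta> t))"
    unfolding gS using int nn by (intro nn_integral_eq_integral) auto
  also have "\<dots> = ennreal (len a b \<theta>)"
    using lebesgue_integral_eq_integral[OF int] by (simp add: len_def)
  finally have "integral\<^sup>N (lebesgue_on {a..b}) f = ennreal (len a b \<theta>)" .
  moreover have "0 \<le> len a b \<theta>" by (rule len_nonneg) fact
  ultimately show "enn2ereal (\<integral>\<^sup>+t. e2ennreal (ereal_root2 (max (\<phi> (\<theta> t)) 1) * ereal (metric_deriv \<theta> t)) \<partial>lebesgue_on {a..b}) = ereal (len a b \<theta>)"
    unfolding f_def by (simp add: enn2ereal_ennreal)
qed

lemma finsler_dist_less:
  assumes "finsler_dist \<phi> x y < c"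
  obtains a b \<theta> where "a \<le> b" "finsler_curve a b \<theta>" "\<theta> a = x" "\<theta> b = y" "ereal (len a b \<theta>) < c"
proof -
  obtain a b \<theta> where *: "a \<le> b" "AC 1 {a..b} edist \<theta>" "\<theta> a = x" "\<theta> b = y"
    "enn2ereal (\<integral>\<^sup>+t. e2ennreal (ereal_root2 (max (\<phi> (\<theta> t)) 1) * ereal (metric_deriv \<theta> t)) \<partial>lebesgue_on {a..b}) < c"
    using assms unfolding finsler_dist_def Inf_less_iff by blast
  then have "enn2ereal (\<integral>\<^sup>+t. e2ennreal (ereal_root2 (max (\<phi> (\<theta> t)) 1) * ereal (metric_deriv \<theta> t)) \<partial>lebesgue_on {a..b}) < \<infinity>"
    by (auto elim: less_le_trans)
  then have "(\<integral>\<^sup>+t. e2ennreal (ereal_root2 (max (\<phi> (\<theta> t)) 1) * ereal (metric_deriv \<theta> t)) \<partial>lebesgue_on {a..b}) < \<infinity>"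
    by (simp add: less_ennreal.rep_eq)
  from finsler_length[OF *(2) this] * show thesis by (intro that) auto
qed

text \<open>A curve from \<open>x\<close> of Finsler length below \<open>\<delta>\<close> stays in the \<open>\<delta>\<close>-ball around \<open>x\<close>, since \<open>S \<ge> 1\<close> wherever it
moves. In this ball \<open>S \<ge> \<alpha>\<close>.\<close>

lemma finsler_dist_ge_scaled_dist:
  assumes fd: "finsler_dist \<phi> x y < ereal \<delta>" and \<alpha>: "0 \<le> \<alpha>"
    and S: "\<And>z. dist x z < \<delta> \<Longrightarrow> \<phi> z = \<infinity> \<or> \<alpha> \<le> S z"
  shows "ereal (\<alpha> * dist x y) \<le> finsler_dist \<phi> x y"
proof (rule dense_ge)
  fix c assume c: "finsler_dist \<phi> x y < c"
  then have "finsler_dist \<phi> x y < min c (ereal \<delta>)" using fd by simp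
  then obtain a b \<theta> where \<theta>: "a \<le> b" "finsler_curve a b \<theta>" "\<theta> a = x" "\<theta> b = y" "ereal (len a b \<theta>) < min c (ereal \<delta>)"
    using finsler_dist_less by blast
  note F = finsler_curveD[OF \<theta>(2)]
  have le1: "AE t in lebesgue_on {a..b}. speed \<theta> t \<le> S (\<theta> t) * speed \<theta> t"
    using F(3)
  proof eventually_elim
    case (elim t)
    then show ?case using S_finite(2)[of "\<theta> t"] mult_right_mono[of 1 "S (\<theta> t)" "speed \<theta> t"]
      by (cases "\<phi> (\<theta> t) = \<infinity>") auto
  qed
  have near: "dist x (\<theta> r) < \<delta>" if r: "r \<in> {a..b}" for r
  proof -
    have "dist x (\<theta> r) \<le> integral {a..r} (speed \<theta>)"
      using AC_dist_le_integral_speed[OF F(1), of a r] r \<theta>(3) by simp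
    also have "\<dots> \<le> integral {a..b} (speed \<theta>)"
      using r by (intro integral_subset_le integrable_subinterval_real[OF AC_speed_integrable[OF F(1)]] AC_speed_integrable[OF F(1)]) auto
    also have "\<dots> \<le> len a b \<theta>"
      unfolding len_def by (rule integral_mono_AE_Icc[OF AC_speed_integrable[OF F(1)] F(2) le1])
    also have "\<dots> < \<delta>" using \<theta>(5) by simp
    finally show ?thesis .
  qed
  have le2: "AE t in lebesgue_on {a..b}. \<alpha> * speed \<theta> t \<le> S (\<theta> t) * speed \<theta> t"
    using F(3) AE_lebesgue_on_Icc[of a b]
  proof eventually_elim
    case (elim t)
    have "dist x (\<theta> t) < \<delta>" using elim(2) by (intro near) auto
    then show ?case using elim(1) S[of "\<theta> t"] mult_right_mono[of \<alpha> "S (\<theta> t)" "speed \<theta> t"]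
      by (cases "\<phi> (\<theta> t) = \<infinity>") auto
  qed
  have "\<alpha> * dist x y \<le> \<alpha> * integral {a..b} (speed \<theta>)"
    using AC_dist_le_integral_speed[OF F(1), of a b] \<theta> \<alpha> by (intro mult_left_mono) auto
  also have "\<dots> = integral {a..b} (\<lambda>t. \<alpha> * speed \<theta> t)" by simp
  also have "\<dots> \<le> len a b \<theta>"
    unfolding len_def by (rule integral_mono_AE_Icc[OF integrable_on_mult_right[OF AC_speed_integrable[OF F(1)]] F(2) le2])
  finally have "ereal (\<alpha> * dist x y) \<le> ereal (len a b \<theta>)" by simp
  then show "ereal (\<alpha> * dist x y) \<le> c"
    using \<theta>(5) by (meson less_imp_le min.strict_boundedE order_trans)
qed

lemma finsler_dist_ge_dist: "edist x y \<le> finsler_dist \<phi> x y"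
proof (cases "finsler_dist \<phi> x y")
  case (real r)
  then show ?thesis
    using finsler_dist_ge_scaled_dist[of x y "r + 1" 1] S_finite(2) by force
next
  case MInf
  then have "edist x y \<le> finsler_dist \<phi> x y"
    using finsler_dist_ge_scaled_dist[of x y 1 1] S_finite(2) by force
  then show ?thesis .
qed simp

lemma S_local_lower_bound:
  assumes "\<phi> x = \<infinity> \<or> \<alpha> < S x" "0 \<le> \<alpha>"
  obtains \<delta> where "0 < \<delta>" "\<And>z. dist x z < \<delta> \<Longrightarrow> \<phi> z = \<infinity> \<or> \<alpha> \<le> S z"
proof (cases "\<alpha> \<le> 1")
  case True
  then show thesis using that[of 1] S_finite(2) by (meson order_trans zero_less_one)
next
  case False
  have "open (- {z. \<phi> z \<le> ereal (\<alpha>\<^sup>2)})" using closed_sublevel by (rule open_Compl)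
  moreover have "x \<in> - {z. \<phi> z \<le> ereal (\<alpha>\<^sup>2)}"
  proof (cases "\<phi> x = \<infinity>")
    case inf: False
    obtain r where r: "\<phi> x = ereal r" using inf phi_not_MInf[of x] by (cases "\<phi> x") auto
    have "\<alpha>\<^sup>2 < (S x)\<^sup>2" using assms inf by (intro power_strict_mono) auto
    moreover have "1 < \<alpha>\<^sup>2" using False by (simp add: one_less_power)
    ultimately show ?thesis using S_finite(1)[OF inf] by (simp add: r)
  qed simp
  ultimately obtain \<delta> where \<delta>: "0 < \<delta>" "ball x \<delta> \<subseteq> - {z. \<phi> z \<le> ereal (\<alpha>\<^sup>2)}"
    by (meson open_contains_ball)
  show thesis
  proof (rule that[OF \<delta>(1)])
    fix z assume "dist x z < \<delta>"
    then have z: "\<not> \<phi> z \<le> ereal (\<alpha>\<^sup>2)" using \<delta>(2) by (auto simp: subset_iff)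
    show "\<phi> z = \<infinity> \<or> \<alpha> \<le> S z"
    proof (cases "\<phi> z = \<infinity>")
      case inf: False
      obtain r where r: "\<phi> z = ereal r" using inf phi_not_MInf[of z] by (cases "\<phi> z") auto
      have "\<alpha>\<^sup>2 \<le> (S z)\<^sup>2" using z S_finite(1)[OF inf] by (simp add: r)
      then show ?thesis using S_nonneg[of z] by (metis power2_le_imp_le)
    qed simp
  qed
qed

text \<open>Let \<open>m\<close> dominate the increments of \<open>u\<close> in the Finsler distance. Near \<open>u t\<close> the weight exceeds any given
\<open>\<alpha> < S (u t)\<close> by lower semicontinuity, so the Finsler distances dominate \<open>\<alpha>\<close> times the distances, and in the
limit \<open>\<alpha> * |u'| t \<le> m t\<close>. If \<open>\<phi> (u t) = \<infinity>\<close> this holds for all \<open>\<alpha>\<close> and forces \<open>|u'| t = 0\<close>.\<close>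

theorem AC_finsler_dist_imp_finsler_curve:
  assumes u: "AC 1 {a..b} (finsler_dist \<phi>) u"
  shows "finsler_curve a b u"
proof -
  obtain m :: "real \<Rightarrow> real" where m: "m integrable_on {a..b}" "\<And>t. 0 \<le> m t"
    "\<And>s t. \<lbrakk>a \<le> s; s \<le> t; t \<le> b\<rbrakk> \<Longrightarrow> finsler_dist \<phi> (u s) (u t) \<le> ereal (integral {s..t} m)"
    using AC_1_obtain[OF u] by blast
  have ac: "AC 1 {a..b} edist u"
    by (rule AC_1_intro[OF m(1,2)]) (use m(3) finsler_dist_ge_dist in \<open>blast intro: order_trans\<close>)
  have key: "AE t in lebesgue_on {a<..<b}. \<forall>\<alpha>. 0 \<le> \<alpha> \<longrightarrow> \<phi> (u t) = \<infinity> \<or> \<alpha> < S (u t) \<longrightarrow> \<alpha> * metric_deriv u t \<le> m t"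
    using AC_metric_deriv_tendsto[OF ac, folded AE_lebesgue_on_Ioo_Icc] lebesgue_differentiation[OF m(1)] AE_lebesgue_on_Ioo[of a b]
  proof eventually_elim
    case (elim t)
    show ?case
    proof (intro allI impI)
      fix \<alpha> :: real assume \<alpha>: "0 \<le> \<alpha>" "\<phi> (u t) = \<infinity> \<or> \<alpha> < S (u t)"
      obtain \<delta> where \<delta>: "0 < \<delta>" "\<And>z. dist (u t) z < \<delta> \<Longrightarrow> \<phi> z = \<infinity> \<or> \<alpha> \<le> S z"
        using S_local_lower_bound[OF \<alpha>(2,1)] by blast
      define M where "M s = integral {a..s} m" for s
      have dM: "(M has_real_derivative m t) (at t)" using elim(2) by (simp add: M_def[abs_def])
      have lim1: "((\<lambda>s. \<alpha> * (dist (u s) (u t) / \<bar>t - s\<bar>)) \<longlongrightarrow> \<alpha> * metric_deriv u t) (at_right t)"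
        using elim(1) by (intro tendsto_mult tendsto_const) (rule tendsto_mono[OF at_le], auto)
      have lim2: "((\<lambda>s. \<bar>M s - M t\<bar> / \<bar>t - s\<bar>) \<longlongrightarrow> \<bar>m t\<bar>) (at_right t)"
        using derivative_abs_quotient[OF dM] by (rule tendsto_mono[OF at_le, rotated]) auto
      have "isCont M t" using dM by (rule DERIV_isCont)
      then have "(M \<longlongrightarrow> M t) (at_right t)" unfolding isCont_def by (rule tendsto_mono[OF at_le, rotated]) auto
      then have "\<forall>\<^sub>F s in at_right t. M s < M t + \<delta>" using \<delta>(1) by (intro order_tendstoD(2)) auto
      moreover have "\<forall>\<^sub>F s in at_right t. s \<in> {t<..<b}"
        using elim(3) by (intro eventually_at_right_real) auto
      ultimately have "\<forall>\<^sub>F s in at_right t. \<alpha> * (dist (u s) (u t) / \<bar>t - s\<bar>) \<le> \<bar>M s - M t\<bar> / \<bar>t - s\<bar>"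
      proof eventually_elim
        case (elim s)
        have at: "a < t" using \<open>a < t \<and> t < b\<close> by simp
        have Ms: "M s - M t = integral {t..s} m"
          unfolding M_def using at elim by (intro integral_diff_Icc[OF m(1)]) auto
        have fd: "finsler_dist \<phi> (u t) (u s) \<le> ereal (M s - M t)"
          using m(3)[of t s] at elim by (simp add: Ms)
        moreover have "ereal (M s - M t) < ereal \<delta>" using elim by simp
        ultimately have "finsler_dist \<phi> (u t) (u s) < ereal \<delta>" by (rule le_less_trans)
        from order_trans[OF finsler_dist_ge_scaled_dist[OF this \<alpha>(1) \<delta>(2)] fd]
        have "\<alpha> * dist (u s) (u t) \<le> \<bar>M s - M t\<bar>" by (simp add: dist_commute)
        then show ?case by (simp add: divide_right_mono)
      qed
      then have "\<alpha> * metric_deriv u t \<le> \<bar>m t\<bar>"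
        by (rule tendsto_le[OF trivial_limit_at_right_real lim2 lim1])
      then show "\<alpha> * metric_deriv u t \<le> m t" using m(2)[of t] by simp
    qed
  qed
  have both: "AE t in lebesgue_on {a<..<b}. (\<phi> (u t) = \<infinity> \<longrightarrow> metric_deriv u t = 0) \<and> S (u t) * speed u t \<le> m t"
    using key AC_metric_deriv_nonneg[OF ac, folded AE_lebesgue_on_Ioo_Icc]
  proof eventually_elim
    case (elim t)
    show ?case
    proof (cases "\<phi> (u t) = \<infinity>")
      case True
      have "metric_deriv u t = 0"
      proof (rule ccontr)
        assume "metric_deriv u t \<noteq> 0"
        then have pos: "0 < metric_deriv u t" using elim(2) by simp
        have "(m t + 1) / metric_deriv u t * metric_deriv u t \<le> m t"
          using elim(1) True m(2)[of t] pos by (simp only: simp_thms) (metis add_nonneg_nonneg divide_nonneg_pos zero_le_one)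
        then show False using pos by simp
      qed
      then show ?thesis using m(2)[of t] by simp
    next
      case False
      have "S (u t) * metric_deriv u t \<le> m t"
      proof (cases "metric_deriv u t = 0")
        case md: False
        then have pos: "0 < metric_deriv u t" using elim(2) by simp
        have "S (u t) \<le> m t / metric_deriv u t"
        proof (rule dense_le_bounded[of 0])
          show "0 < S (u t)" using S_finite(2)[OF False] by simp
          show "\<alpha> \<le> m t / metric_deriv u t" if "0 < \<alpha>" "\<alpha> < S (u t)" for \<alpha>
            using elim(1) that pos by (simp add: pos_le_divide_eq)
        qed
        then show ?thesis using pos by (simp add: pos_le_divide_eq)
      qed (simp add: m(2))
      then show ?thesis using False elim(2) by simp
    qed
  qed
  have 1: "AE t in lebesgue_on {a..b}. \<phi> (u t) = \<infinity> \<longrightarrow> metric_deriv u t = 0"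
    unfolding AE_lebesgue_on_Ioo_Icc[symmetric] using both by eventually_elim blast
  have 2: "AE t in lebesgue_on {a..b}. \<bar>S (u t) * speed u t\<bar> \<le> m t"
    unfolding AE_lebesgue_on_Ioo_Icc[symmetric] using both by eventually_elim (use S_nonneg in \<open>simp add: abs_mult\<close>)
  have "(\<lambda>t. S (u t) * speed u t) absolutely_integrable_on {a..b}"
    by (rule absolutely_integrable_bound_AE[OF _ m(1) 2]) (use S_curve_measurable[OF ac] in measurable)
  then show ?thesis
    unfolding finsler_curve_def using ac 1 set_lebesgue_integral_eq_integral(1) by blast
qed

section \<open>Continuity and absolute continuity of the value function\<close>

theorem value_fun_finsler_continuous:
  assumes "(\<lambda>n. finsler_dist \<phi> (xs n) x) \<longlonglongrightarrow> 0"
  shows "(\<lambda>n. V (xs n)) \<longlonglongrightarrow> V x"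
proof -
  have ev: "\<forall>\<^sub>F n in sequentially. \<exists>a b \<theta>. a \<le> b \<and> finsler_curve a b \<theta> \<and> \<theta> a = x \<and> \<theta> b = xs n \<and> len a b \<theta> < l"
    if "0 < l" for l
  proof -
    have "\<forall>\<^sub>F n in sequentially. finsler_dist \<phi> (xs n) x < ereal l"
      using assms that by (intro order_tendstoD(2)) auto
    then show ?thesis
    proof eventually_elim
      case (elim n)
      then obtain a b \<theta> where \<theta>: "a \<le> b" "finsler_curve a b \<theta>" "\<theta> a = xs n" "\<theta> b = x" "ereal (len a b \<theta>) < ereal l"
        using finsler_dist_less by blast
      show ?case
        using \<theta> finsler_curve_reverse[OF \<theta>(2)]
        by (intro exI[of _ "-b"] exI[of _ "-a"] exI[of _ "\<lambda>r. \<theta> (- r)"]) auto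
    qed
  qed
  show ?thesis
  proof (cases "V x")
    case PInf
    have "\<forall>\<^sub>F n in sequentially. V (xs n) = \<infinity>"
      using ev[OF zero_less_one] by (rule eventually_mono) (use value_fun_modulus(1) PInf in \<open>auto, metis\<close>)
    then have "\<forall>\<^sub>F n in sequentially. V (xs n) = V x" by (simp add: PInf)
    then show ?thesis by (rule tendsto_eventually)
  next
    case (real v)
    have fin: "V (xs n) = ereal (real_of_ereal (V (xs n))) \<and> \<bar>real_of_ereal (V (xs n)) - v\<bar> \<le> modulus v (len a b \<theta>)"
      if \<theta>: "a \<le> b" "finsler_curve a b \<theta>" "\<theta> a = x" "\<theta> b = xs n" for n a b \<theta>
    proof -
      have "V (xs n) \<noteq> \<infinity>" using value_fun_modulus(1)[OF \<theta>(2,1)] \<theta> real by simp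
      then have eq: "V (xs n) = ereal (real_of_ereal (V (xs n)))"
        using value_fun_not_MInf[of "xs n"] by (cases "V (xs n)") auto
      then show ?thesis using value_fun_modulus(2)[OF \<theta>(2,1), of v "real_of_ereal (V (xs n))"] \<theta> real by simp
    qed
    have mono: "modulus v l \<le> modulus v l'" if "0 \<le> l" "l \<le> l'" for l l'
      unfolding modulus_def using that eps_pos C_pos
      by (intro add_mono mult_mono divide_right_mono) (auto simp: divide_right_mono)
    have mlim: "(modulus v \<longlongrightarrow> 0) (at_right 0)"
    proof -
      have "isCont (modulus v) 0" unfolding modulus_def[abs_def] using eps_pos by (intro continuous_intros) auto
      then have "(modulus v \<longlongrightarrow> modulus v 0) (at 0)" by (simp add: isCont_def)
      then show ?thesis by (auto simp: modulus_def intro: tendsto_mono[OF at_le, rotated])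
    qed
    have "(\<lambda>n. real_of_ereal (V (xs n))) \<longlonglongrightarrow> v"
    proof (rule tendstoI)
      fix e :: real assume e: "0 < e"
      have "\<forall>\<^sub>F l in at_right 0. modulus v l < e \<and> 0 < l"
        using order_tendstoD(2)[OF mlim e] eventually_at_right_less[of 0] by eventually_elim simp
      then obtain l where l: "0 < l" "modulus v l < e"
        using eventually_happens'[OF trivial_limit_at_right_real] by (metis (no_types, lifting))
      show "\<forall>\<^sub>F n in sequentially. dist (real_of_ereal (V (xs n))) v < e"
        using ev[OF l(1)]
      proof eventually_elim
        case (elim n)
        then obtain a b \<theta> where \<theta>: "a \<le> b" "finsler_curve a b \<theta>" "\<theta> a = x" "\<theta> b = xs n" "len a b \<theta> < l" by blast
        have "\<bar>real_of_ereal (V (xs n)) - v\<bar> \<le> modulus v (len a b \<theta>)" using fin[OF \<theta>(1-4)] by simp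
        also have "\<dots> \<le> modulus v l" using len_nonneg[OF \<theta>(2)] \<theta>(5) by (intro mono) auto
        finally show ?case using l(2) by (simp add: dist_real_def)
      qed
    qed
    then have "(\<lambda>n. ereal (real_of_ereal (V (xs n)))) \<longlonglongrightarrow> ereal v" by (rule tendsto_ereal)
    moreover have "\<forall>\<^sub>F n in sequentially. ereal (real_of_ereal (V (xs n))) = V (xs n)"
      using ev[OF zero_less_one]
    proof eventually_elim
      case (elim n)
      then show ?case using fin by (metis (no_types, lifting))
    qed
    ultimately show ?thesis unfolding real by (rule Lim_transform_eventually)
  qed (use value_fun_not_MInf in auto)
qed

text \<open>The modulus is linear in the length only while the values of \<open>V\<close> stay bounded. A first application from
the initial point \<open>a\<close> gives the bound \<open>R\<close> on the whole curve.\<close>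

theorem value_fun_AC:
  assumes u: "finsler_curve a b u" and ab: "a \<le> b"
    and fin: "V (u a) \<noteq> \<infinity>"
  obtains v where "\<And>t. t \<in> {a..b} \<Longrightarrow> V (u t) = ereal (v t)" "AC 1 {a..b} edist v"
    "AE t in lebesgue_on {a<..<b}. \<exists>v'. (v has_real_derivative v') (at t)"
proof -
  note F = finsler_curveD[OF u]
  define v where "v t = real_of_ereal (V (u t))" for t
  have v: "V (u t) = ereal (v t)" if "t \<in> {a..b}" for t
  proof -
    have "finsler_curve a t u" using finsler_curve_subset[OF u] that by simp
    then have "V (u t) \<noteq> \<infinity>" using value_fun_modulus(1)[of a t u] that fin by simp
    then show ?thesis unfolding v_def using value_fun_not_MInf[of "u t"] by (cases "V (u t)") auto
  qed
  define l where "l = len a b u"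
  have l: "0 \<le> len s t u" "len s t u \<le> l" if "a \<le> s" "s \<le> t" "t \<le> b" for s t
  proof -
    show "0 \<le> len s t u" using that by (intro len_nonneg finsler_curve_subset[OF u]) auto
    show "len s t u \<le> l" unfolding l_def len_def
      using that S_nonneg by (intro integral_subset_le integrable_subinterval_real[OF F(2)] F(2)) auto
  qed
  have l0: "0 \<le> l" using l[of a b] ab by simp
  define R where "R = \<bar>v a\<bar> + modulus (v a) l"
  have mono: "modulus r x \<le> modulus r y" if "0 \<le> x" "x \<le> y" for r x y
    unfolding modulus_def using that eps_pos C_pos
    by (intro add_mono mult_mono divide_right_mono) (auto simp: divide_right_mono)
  have R: "\<bar>v t\<bar> \<le> R" if t: "t \<in> {a..b}" for t
  proof -
    have "\<bar>v t - v a\<bar> \<le> modulus (v a) (len a t u)"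
      using value_fun_modulus(2)[OF finsler_curve_subset[OF u, of a t], of "v a" "v t"] v[of a] v[OF t] t by simp
    also have "\<dots> \<le> modulus (v a) l" using t l[of a t] by (intro mono) auto
    finally show ?thesis unfolding R_def by linarith
  qed
  define K where "K = C + 1 / \<epsilon> * exp (l / \<epsilon>) * (C * l + R)"
  have R0: "0 \<le> R" using R[of a] ab by force
  have K0: "0 \<le> K" unfolding K_def using C_pos eps_pos l0 R0 by (intro add_nonneg_nonneg mult_nonneg_nonneg) auto
  define k where "k t = K * (S (u t) * speed u t)" for t
  have kint: "k integrable_on {a..b}" unfolding k_def[abs_def] by (rule integrable_on_mult_right[OF F(2)])
  have k0: "0 \<le> k t" for t using K0 S_nonneg by (simp add: k_def)
  have bd: "\<bar>v t - v s\<bar> \<le> integral {s..t} k" if st: "a \<le> s" "s \<le> t" "t \<le> b" for s t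
  proof -
    define j where "j = len s t u"
    have j: "0 \<le> j" "j \<le> l" using l[OF st] by (simp_all add: j_def)
    have "\<bar>v t - v s\<bar> \<le> modulus (v s) j"
      using value_fun_modulus(2)[OF finsler_curve_subset[OF u, of s t], of "v s" "v t"] v[of s] v[of t] st by (simp add: j_def)
    also have "\<dots> \<le> C * j + j / \<epsilon> * exp (l / \<epsilon>) * (C * l + R)"
      unfolding modulus_def using j R[of s] st C_pos eps_pos l0
      by (intro add_mono mult_mono order_refl) (auto simp: divide_right_mono)
    also have "\<dots> = K * j" by (simp add: K_def algebra_simps)
    also have "\<dots> = integral {s..t} k" by (simp add: j_def len_def k_def[abs_def])
    finally show ?thesis .
  qed
  have "AC 1 {a..b} edist v"
    by (rule AC_1_intro[OF kint k0]) (use bd in \<open>simp add: dist_real_def abs_minus_commute\<close>)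
  moreover obtain \<rho> where "\<And>s t. \<lbrakk>a \<le> s; s \<le> t; t \<le> b\<rbrakk> \<Longrightarrow> (\<rho> has_integral (v t - v s)) {s..t}"
    "AE x in lebesgue_on {a<..<b}. (v has_real_derivative \<rho> x) (at x)"
    using dominated_increments_derivative[OF kint k0 bd] by blast
  then have "AE t in lebesgue_on {a<..<b}. \<exists>v'. (v has_real_derivative v') (at t)"
    by (auto elim!: eventually_mono)
  ultimately show thesis using that[of v] v by blast
qed

lemma value_fun_derivative_bound:
  assumes u: "finsler_curve a b u" and v: "\<And>t. t \<in> {a..b} \<Longrightarrow> V (u t) = ereal (v t)"
  shows "AE t in lebesgue_on {a<..<b}. \<forall>v'. (v has_real_derivative v') (at t) \<longrightarrow>
     ereal \<bar>v'\<bar> \<le> G_fun \<epsilon> \<phi> (u t) * ereal (metric_deriv u t)"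
proof -
  have "AE t in lebesgue_on {-b<..<-a}. \<forall>v'. ((\<lambda>t. v (- t)) has_real_derivative v') (at t) \<longrightarrow>
     ereal (- v') \<le> G_fun \<epsilon> \<phi> (u (- t)) * ereal (metric_deriv u (- t))"
    using value_fun_derivative_upper[OF finsler_curve_reverse(1)[OF u], of "\<lambda>t. v (- t)"] v
    by (simp add: metric_deriv_reverse)
  from AE_lebesgue_on_reverse[OF this[unfolded AE_lebesgue_on_Ioo_Icc], folded AE_lebesgue_on_Ioo_Icc]
  have lower: "AE t in lebesgue_on {a<..<b}. \<forall>v'. ((\<lambda>t. v (- t)) has_real_derivative v') (at (- t)) \<longrightarrow>
     ereal (- v') \<le> G_fun \<epsilon> \<phi> (u t) * ereal (metric_deriv u t)"
    unfolding minus_minus .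
  have upper: "AE t in lebesgue_on {a<..<b}. \<forall>v'. (v has_real_derivative v') (at t) \<longrightarrow>
     ereal (- v') \<le> G_fun \<epsilon> \<phi> (u t) * ereal (metric_deriv u t)"
    by (rule value_fun_derivative_upper[OF u]) (rule v)
  from upper lower show ?thesis
  proof eventually_elim
    case (elim t)
    show ?case
    proof (intro allI impI)
      fix v' assume v': "(v has_real_derivative v') (at t)"
      then have "((\<lambda>t. v (- t)) has_real_derivative - v') (at (- t))"
        using DERIV_mirror[of v v' "- t"] by simp
      then have "ereal v' \<le> G_fun \<epsilon> \<phi> (u t) * ereal (metric_deriv u t)"
        "ereal (- v') \<le> G_fun \<epsilon> \<phi> (u t) * ereal (metric_deriv u t)"
        using elim v' by force+
      then show "ereal \<bar>v'\<bar> \<le> G_fun \<epsilon> \<phi> (u t) * ereal (metric_deriv u t)"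
        by (cases "0 \<le> v'") auto
    qed
  qed
qed

theorem value_fun_along_finsler_curve:
  assumes u: "AC 1 {a..b} (finsler_dist \<phi>) u" and ab: "a \<le> b"
  shows "AC 1 {a..b} ext_real_dist (\<lambda>t. V (u t))"
    and "AE t in lebesgue_on {a<..<b}. \<exists>v'. ((\<lambda>s. real_of_ereal (V (u s))) has_real_derivative v') (at t) \<and>
           ereal \<bar>v'\<bar> \<le> G_fun \<epsilon> \<phi> (u t) * ereal (metric_deriv u t)"
proof -
  have F: "finsler_curve a b u" by (rule AC_finsler_dist_imp_finsler_curve[OF u])
  have transfer: "((\<lambda>s. real_of_ereal (V (u s))) has_real_derivative d) (at t)"
    if g: "\<And>s. s \<in> {a..b} \<Longrightarrow> real_of_ereal (V (u s)) = g s" and d: "(g has_real_derivative d) (at t)" and t: "a < t" "t < b" for g d t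
    by (rule has_field_derivative_transform_within_open[OF d, of "{a<..<b}"]) (use g t in auto)
  have "AC 1 {a..b} ext_real_dist (\<lambda>t. V (u t)) \<and>
    (AE t in lebesgue_on {a<..<b}. \<exists>v'. ((\<lambda>s. real_of_ereal (V (u s))) has_real_derivative v') (at t) \<and>
           ereal \<bar>v'\<bar> \<le> G_fun \<epsilon> \<phi> (u t) * ereal (metric_deriv u t))"
  proof (cases "V (u a) = \<infinity>")
    case True
    have inf: "V (u t) = \<infinity>" if "t \<in> {a..b}" for t
      using value_fun_modulus(1)[OF finsler_curve_subset[OF F, of a t]] that True by simp
    have "AE t in lebesgue_on {a<..<b}. \<exists>v'. ((\<lambda>s. real_of_ereal (V (u s))) has_real_derivative v') (at t) \<and>
           ereal \<bar>v'\<bar> \<le> G_fun \<epsilon> \<phi> (u t) * ereal (metric_deriv u t)"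
      using AC_metric_deriv_nonneg[OF finsler_curveD(1)[OF F], folded AE_lebesgue_on_Ioo_Icc] AE_lebesgue_on_Ioo[of a b]
    proof eventually_elim
      case (elim t)
      have "((\<lambda>s. real_of_ereal (V (u s))) has_real_derivative 0) (at t)"
        using transfer[of "\<lambda>_. 0" 0 t] inf elim by simp
      moreover have "ereal \<bar>0\<bar> \<le> G_fun \<epsilon> \<phi> (u t) * ereal (metric_deriv u t)"
        using inf[of t] elim by (simp add: G_fun_def zero_ereal_def[symmetric])
      ultimately show ?case by blast
    qed
    then show ?thesis using inf by (auto simp: AC_ext_real_dist_iff)
  next
    case False
    then obtain v where v: "\<And>t. t \<in> {a..b} \<Longrightarrow> V (u t) = ereal (v t)" "AC 1 {a..b} edist v"
      "AE t in lebesgue_on {a<..<b}. \<exists>v'. (v has_real_derivative v') (at t)"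
      using value_fun_AC[OF F ab] by blast
    have bound: "AE t in lebesgue_on {a<..<b}. \<forall>v'. (v has_real_derivative v') (at t) \<longrightarrow>
        ereal \<bar>v'\<bar> \<le> G_fun \<epsilon> \<phi> (u t) * ereal (metric_deriv u t)"
      by (rule value_fun_derivative_bound[OF F]) (rule v(1))
    have "AE t in lebesgue_on {a<..<b}. \<exists>v'. ((\<lambda>s. real_of_ereal (V (u s))) has_real_derivative v') (at t) \<and>
           ereal \<bar>v'\<bar> \<le> G_fun \<epsilon> \<phi> (u t) * ereal (metric_deriv u t)"
      using v(3) bound AE_lebesgue_on_Ioo[of a b]
    proof eventually_elim
      case (elim t)
      then obtain d where d: "(v has_real_derivative d) (at t)" by blast
      show ?case using transfer[of v d t] v(1) d elim(2,3) by auto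
    qed
    then show ?thesis using v(1,2) by (auto simp: AC_ext_real_dist_iff)
  qed
  then show "AC 1 {a..b} ext_real_dist (\<lambda>t. V (u t))"
    "AE t in lebesgue_on {a<..<b}. \<exists>v'. ((\<lambda>s. real_of_ereal (V (u s))) has_real_derivative v') (at t) \<and>
           ereal \<bar>v'\<bar> \<le> G_fun \<epsilon> \<phi> (u t) * ereal (metric_deriv u t)" by blast+
qed

end

theorem theoremA6:
  fixes \<sigma> :: "'a::complete_space topology" and \<phi> :: "'a \<Rightarrow> ereal"
    and u\<^sub>s :: 'a and A B \<epsilon> :: real
  assumes "compatible \<sigma>"
    and "proper_functional \<phi>"
    and "LSCC \<sigma> \<phi> u\<^sub>s A B"
    and "\<epsilon> > 0"
    and "1 / (16 * \<epsilon>) > B"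
  shows "(\<forall>xs x. (\<lambda>n. finsler_dist \<phi> (xs n) x) \<longlonglongrightarrow> 0 \<longrightarrow>
             (\<lambda>n. value_fun \<epsilon> \<phi> (xs n)) \<longlonglongrightarrow> value_fun \<epsilon> \<phi> x) \<and>
         (\<forall>a b u. a \<le> b \<and> AC 1 {a..b} (finsler_dist \<phi>) u \<longrightarrow>
             AC 1 {a..b} ext_real_dist (\<lambda>t. value_fun \<epsilon> \<phi> (u t)) \<and>
             (AE t in lebesgue_on {a<..<b}.
                \<exists>v'. ((\<lambda>s. real_of_ereal (value_fun \<epsilon> \<phi> (u s))) has_real_derivative v') (at t) \<and>
                     ereal \<bar>v'\<bar> \<le> G_fun \<epsilon> \<phi> (u t) * ereal (metric_deriv u t)))"
proof -
  interpret weighted_dissipation \<phi> u\<^sub>s A B \<epsilon>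
  proof
    show "closed {x. \<phi> x \<le> c}" for c
      by (rule LSCC_closed_sublevel[OF assms(1,3)])
    show "ereal (- B * (dist u v)\<^sup>2 - (B * (dist v u\<^sub>s)\<^sup>2 + A)) \<le> \<phi> u" for u v
      using assms(3) unfolding LSCC_def by blast
    show "0 \<le> B" using assms(3) unfolding LSCC_def by blast
    then show "8 * \<epsilon> * B \<le> 1" using assms(4,5) by (simp add: field_simps)
  qed (rule assms(4))
  show ?thesis
    using value_fun_finsler_continuous value_fun_along_finsler_curve by blast
qed

end
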